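(* Let $\ell_{\max}\in\{1,2,3,\ldots\}$ and $\varepsilon_1>\varepsilon_2>\ldots>\varepsilon_{\ell_{\max}}>0$. Then the Iterative Boundary Tracking Algorithm (defined in the context), run with these thresholds, terminates in finite time and returns a discretization $\boldsymbol{\delta}=(\boldsymbol{h},\boldsymbol{t},\boldsymbol{\rho})\in\aleph$ with $E(\boldsymbol{\delta})\le\varepsilon_{\ell_{\max}}$, together with the corresponding reachable sets, i.e. with pairs $(D_0^k,D_1^k)$, $k=0,\ldots,n$ (where $\boldsymbol{\delta}\in\aleph_n$), such that $(D_0^k,D_1^k)=\mathrm{tr}_{\rho_k}(\mathcal{R}^F_{\boldsymbol{\delta}}(k))$, where these boundary pairs are given by the recursion $$\mathrm{tr}_{\rho_0}(\mathcal{R}^F_{\boldsymbol{\delta}}(0))=\mathrm{tr}_{\rho_0}(\pi_{\rho_0}^{\rho_0/2}(X_0)),\qquad \mathrm{tr}_{\rho_k}(\mathcal{R}^F_{\boldsymbol{\delta}}(k))=\Psi_{h_k,\rho_{k-1},\rho_k}\big(\mathrm{tr}_{\rho_{k-1}}(\mathcal{R}^F_{\boldsymbol{\delta}}(k-1))\big),\quad k=1,\ldots,n.$$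
   Context: **Control system.** $\|\cdot\|_\infty$ is the max norm, $B_r(x)$ the closed max-norm ball, $B_r(M)=\bigcup_{x\in M}B_r(x)$; for a set-valued map $G$ and a set $M$, $G(M):=\bigcup_{x\in M}G(x)$. $\mathrm{dist}(x,M)=\inf_{y\in M}\|x-y\|_\infty$. Fixed: $T,L,P>0$; a nonempty, compact, path-connected set $X_0\subset\mathbb{R}^d$; a map $F$ from $\mathbb{R}^d$ to the nonempty compact convex subsets of $\mathbb{R}^d$ which is $L$-Lipschitz with respect to the Hausdorff distance induced by $\|\cdot\|_\infty$ and satisfies $\|f\|_\infty\le P$ for all $f\in F(x)$, $x\in\mathbb{R}^d$. The reachable set $\mathcal{R}^F(t)$ is the set of all $x(t)$ with $x\in W^{1,1}([0,T],\mathbb{R}^d)$, $x(0)\in X_0$, $\dot x(s)\in F(x(s))$ for a.e. $s\in(0,T)$. Set $d_x:=\max_{t\in[0,T]}\dim\mathcal{R}^F(t)$, $d_u:=\max_{t\in[0,T]}\max_{x\in\mathcal{R}^F(t)}\dim F(x)$, $d_R:=\min(d-1,d_x)$, $d_F:=\min(d-1,d_u)$; it is assumed that $d_R\ge1$. (These enter the construction only as fixed integers $d_R\ge 1$, $d_F\ge 0$.) **Grids and boundary pairs.** For $\rho>0$: $\Delta_\rho=\rho\mathbb{Z}^d$; $S_\rho$ is the set of nonempty subsets of $\Delta_\rho$; $S_\rho^+$ is the set of all subsets of $\Delta_\rho$; $C_\rho$ is the set of all $M\in S_\rho$ such that any $x,z\in M$ are joined by a finite sequence $y_0=x,\ldots,y_m=z$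 in $M$ with $\|y_{i+1}-y_i\|_\infty=\rho$. For $M\subset\Delta_\rho$: $\partial^0_\rho M:=\{x\in M:\exists z\in\Delta_\rho\setminus M,\ \|x-z\|_\infty=\rho\}$ and, for $j\ge1$, $\partial^j_\rho M:=\{x\in\Delta_\rho\setminus M:\mathrm{dist}(x,\partial_\rho^0M)=j\rho\}$, $\partial^{-j}_\rho M:=\{x\in M:\mathrm{dist}(x,\partial_\rho^0M)=j\rho\}$. The map $\mathrm{tr}_\rho:S_\rho\to S^+_\rho\times S^+_\rho$, $\mathrm{tr}_\rho(M)=(\partial^0_\rho M,\partial^1_\rho M)$, is injective (known); $\mathrm{bd}_\rho:=\mathrm{tr}_\rho(S_\rho)$, $\mathrm{bdc}_\rho:=\mathrm{tr}_\rho(C_\rho)$. For $\rho'/\rho\in\{2,3,\ldots\}$: $R_\rho^{\rho'}(M):=B_{\rho'/2}(M)\cap\Delta_{\rho'}$ for $M\in S_\rho$, and $\partial R_\rho^{\rho'}:=\mathrm{tr}_{\rho'}\circ R_\rho^{\rho'}\circ\mathrm{tr}_\rho^{-1}:\mathrm{bd}_\rho\to\mathrm{bd}_{\rho'}$. **Euler maps.** $\pi^\alpha_\rho(M):=B_\alpha(M)\cap\Delta_\rho$; $\phi_h(x):=x+hF(x)$; $\Phi^\alpha_{h,\rho}(x):=\pi^\alpha_\rho(\phi_h(x))$; $\Phi^{\partial,\alpha}_{h,\rho}(x):=\pi^\alpha_\rho(\partial\phi_h(x))$ with $\partial\phi_h(x)$ the topological boundary of $\phi_h(x)$ in $\mathbb{R}^d$.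 $\alpha(h,\rho):=(1+Lh)\frac\rho2$, $\kappa(h,\rho):=2(1+Lh)\big(\frac{\alpha(h,\rho)}{1-Lh}+\rho\big)$. For $\rho'/\rho\in(0,1)\cup\{1,2,\ldots\}$: $\Phi^\alpha_{h,\rho,\rho'}(x):=R_\rho^{\rho'}(\Phi^\alpha_{h,\rho}(x))$ if $\rho<\rho'$ and $\Phi^\alpha_{h,\rho,\rho'}(x):=\Phi^\alpha_{h,\rho'}(x)$ if $\rho\ge\rho'$; $\Psi_{h,\rho,\rho'}:=\mathrm{tr}_{\rho'}\circ\Phi^{\alpha(h,\rho)}_{h,\rho,\rho'}\circ\mathrm{tr}_\rho^{-1}:\mathrm{bdc}_\rho\to\mathrm{bdc}_{\rho'}$. The discrete reachable sets for $\boldsymbol\delta=(\boldsymbol h,\boldsymbol t,\boldsymbol\rho)$ are $\mathcal{R}^F_{\boldsymbol\delta}(0)=\pi_{\rho_0}^{\rho_0/2}(X_0)$, $\mathcal{R}^F_{\boldsymbol\delta}(k)=\Phi^{\alpha(h_k,\rho_{k-1})}_{h_k,\rho_{k-1},\rho_k}(\mathcal{R}^F_{\boldsymbol\delta}(k-1))$, $k=1,\ldots,n$. **Discretizations.** For $n\ge1$, $\aleph_n$ is the set of all $\boldsymbol\delta=(\boldsymbol h,\boldsymbol t,\boldsymbol\rho)$ with $\boldsymbol h=(h_1,\ldots,h_n)\in\mathbb{R}^n_{>0}$, $\boldsymbol t=(t_0,\ldots,t_n)$, $\boldsymbol\rho=(\rho_0,\ldots,\rho_n)\in\mathbb{R}_{>0}^{n+1}$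 such that $t_k=\sum_{j=1}^kh_j$ for $0\le k\le n$, $t_n=T$, $\|\boldsymbol h\|_\infty\le\frac1{4L}$, $\|\boldsymbol\rho\|_\infty\le\frac{P}{8L}$, $\rho_j/\rho_k\in\{4^\ell:\ell\in\mathbb{Z}\}$ for all $j,k\in\{0,\ldots,n\}$, and $\rho_j=2LPh_j^2$ for $j\in\{1,\ldots,n\}$. $\aleph:=\bigcup_{n\ge1}\aleph_n$. Subdivision: $\psi[\boldsymbol\delta;0]$ replaces $\rho_0$ by $\rho_0/4$ and leaves everything else unchanged; for $j\in\{1,\ldots,n\}$, $\psi[\boldsymbol\delta;j]$ replaces the entry $h_j$ by the two entries $h_j/2,h_j/2$, inserts $t_j-h_j/2$ between $t_{j-1}$ and $t_j$, and replaces the entry $\rho_j$ by the two entries $\rho_j/4,\rho_j/4$. **Error and cost functions.** $E(\boldsymbol\delta)=\sum_{k=0}^n\mathcal{E}_k(\boldsymbol\delta)$ with $\mathcal{E}_0(\boldsymbol\delta)=\frac{\rho_0}2e^{LT}$ and, for $1\le k\le n$, $$\mathcal{E}_k(\boldsymbol\delta)=e^{L(T-t_k)}\Big[(e^{Lh_k}-1)\Big(Ph_k+\tfrac{(1+Lh_k)^2}{Lh_k}\tfrac{\rho_{k-1}}2\Big)+\chi_k(\boldsymbol\delta)\Big],$$ where $\chi_k(\boldsymbol\delta)=\rho_k/2$ if $\rho_{k-1}<\rho_k$ and $\chi_k(\boldsymbol\delta)=0$ otherwise. $\sigma(h,\rho):=\frac\rho4(1+Lh)\big(\frac{1+Lh}{1-Lh}+6\big)$.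 For $v\in C^0([0,T],\mathbb{R}_{>0})$, $$C(\boldsymbol\delta;v)=\sum_{k=0}^{n-1}\frac{4v(t_k)h_{k+1}^{d_F}}{\rho_k^{d_R}\min(\rho_k,\rho_{k+1})^{d_F+1}}\sigma(h_{k+1},\rho_k).$$ **Step procedure** (input $h,\rho,\rho'$, $(D_0,D_1)\in\mathrm{bdc}_\rho$). Let $\alpha=\alpha(h,\rho)$, $\kappa=\kappa(h,\rho)$, $\tilde\rho=\min(\rho,\rho')$, $D_{-1}=\partial^{-1}_\rho(\mathrm{tr}_\rho^{-1}(D_0,D_1))$, $D_2=\partial^2_\rho(\mathrm{tr}_\rho^{-1}(D_0,D_1))$, $\hat c_R=\sum_{j=-1}^2\#D_j$. Compute $W_0^0=\Phi^{\partial,\alpha+\kappa}_{h,\tilde\rho}(D_0)\cap\Phi^\alpha_{h,\tilde\rho}(D_0)$, $W_1=\Phi^{\partial,\alpha}_{h,\tilde\rho}(D_1\cup D_2)$, $W_0^{-1}=\Phi^{\partial,\alpha}_{h,\tilde\rho}(D_{-1})$, then $\tilde D_1=\{x\in W_1:\mathrm{dist}(x,W_0^0\cup W_0^{-1})=\tilde\rho\}$, $\tilde D_0=\{x\in W_0^0\cup W_0^{-1}:\mathrm{dist}(x,\tilde D_1)=\tilde\rho\}$, and $$\hat c_F=\sum_{j\in\{-1,1,2\}}\sum_{x\in D_j}\#\Phi^{\partial,\alpha}_{h,\tilde\rho}(x)+\sum_{x\in D_0}\#\big(\Phi^{\partial,\alpha+\kappa}_{h,\tilde\rho}(x)\cap\Phi^\alpha_{h,\tilde\rho}(x)\big).$$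 Return (as the value $\Psi_{h,\rho,\rho'}(D_0,D_1)$) the pair $\partial R_{\tilde\rho}^{\rho'}(\tilde D_0,\tilde D_1)$ if $\rho'>\rho$ and $(\tilde D_0,\tilde D_1)$ otherwise, and return $\hat c_R,\hat c_F$. **Tracking procedure** (input $\boldsymbol\delta\in\aleph_n$, $(D_0^0,D_1^0)\in\mathrm{bdc}_{\rho_0}$). For $k=0,\ldots,n-1$ apply the step procedure to $(h_{k+1},\rho_k,\rho_{k+1},D_0^k,D_1^k)$ to obtain $(D_0^{k+1},D_1^{k+1})$, $\hat c_{R,k}$, $\hat c_{F,k}$, and set $\hat v_{R,k}=\frac14\hat c_{R,k}\rho_k^{d_R}$, $\hat v_{F,k}=\frac{\min(\rho_k,\rho_{k+1})^{d_F+1}}{h_{k+1}^{d_F}\sigma(h_{k+1},\rho_k)}\frac{\hat c_{F,k}}{\hat c_{R,k}}$. Set $\hat c_{R,n}=\sum_{j=-1}^2\#\partial^j_{\rho_n}(\mathrm{tr}_{\rho_n}^{-1}(D_0^n,D_1^n))$, $\hat v_{R,n}=\frac14\hat c_{R,n}\rho_n^{d_R}$, $\hat v_{F,n}=\hat v_{F,n-1}$. Return all pairs $(D_0^k,D_1^k)$ and the piecewise linear interpolants $v_R,v_F$ on $[0,T]$ of $(t_k,\hat v_{R,k})_{k=0}^n$ and $(t_k,\hat v_{F,k})_{k=0}^n$. **Refinement procedure** (input $\varepsilon>0$, $\boldsymbol\delta^{(0)}\in\aleph$, functions $C,E:\aleph\to\mathbb{R}_{>0}$). With $\Delta C(\boldsymbol\delta;j)=C(\psi[\boldsymbol\delta;j])-C(\boldsymbol\delta)$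 and $\Delta E(\boldsymbol\delta;j)=E(\psi[\boldsymbol\delta;j])-E(\boldsymbol\delta)$: start with $m=0$; while $E(\boldsymbol\delta^{(m)})>\varepsilon$, choose $k_m$ as a minimizer over $j$ of $\Delta E(\boldsymbol\delta^{(m)};j)/\Delta C(\boldsymbol\delta^{(m)};j)$ if $\min_j\Delta C(\boldsymbol\delta^{(m)};j)>0$, and as a minimizer over $j$ of $\Delta C(\boldsymbol\delta^{(m)};j)$ otherwise; set $\boldsymbol\delta^{(m+1)}=\psi[\boldsymbol\delta^{(m)};k_m]$ and increase $m$ by 1. Return the last $\boldsymbol\delta^{(m)}$. Here $j$ ranges over $\{0,\ldots,n_m\}$ when $\boldsymbol\delta^{(m)}\in\aleph_{n_m}$. **Iterative Boundary Tracking Algorithm** (input $\varepsilon_1>\ldots>\varepsilon_{\ell_{\max}}>0$). Let $n_0=\lceil4LT\rceil$ and let $\boldsymbol\delta^{(0)}$ have $h_j=T/n_0$ for $1\le j\le n_0$, $t_k=kT/n_0$, and $\rho_k=2LPT^2/n_0^2$ for $0\le k\le n_0$. For $\ell=0,1,\ldots,\ell_{\max}$: set $(D_0^0,D_1^0)=\mathrm{tr}_{\rho_0^{(\ell)}}\big(\pi^{\rho_0^{(\ell)}/2}_{\rho_0^{(\ell)}}(X_0)\big)$; run the tracking procedure on $\boldsymbol\delta^{(\ell)}$ and $(D_0^0,D_1^0)$ to obtain the pairs $(D_0^k,D_1^k)$, $k=0,\ldots,n_\ell$, and $v_R^{(\ell)},v_F^{(\ell)}$; if $\ell<\ell_{\max}$,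 let $\boldsymbol\delta^{(\ell+1)}\in\aleph_{n_{\ell+1}}$ be the output of the refinement procedure with input $\varepsilon_{\ell+1}$, $\boldsymbol\delta^{(\ell)}$, $C(\,\cdot\,;v_R^{(\ell)}v_F^{(\ell)})$, $E$. Return $n=n_{\ell_{\max}}$, $\boldsymbol\delta=\boldsymbol\delta^{(\ell_{\max})}$ and the last computed pairs $(D_0^k,D_1^k)$, $k=0,\ldots,n$. *)

theory Defs
  imports "HOL-Analysis.Analysis"
begin

section \<open>Max-norm geometry\<close>

text \<open>Distances to sets are extended reals, so that the distance to the empty set is infinite.\<close>

definition linf_dist :: "real^'n \<Rightarrow> (real^'n) set \<Rightarrow> ereal" where
  "linf_dist x M = (INF y\<in>M. ereal (infnorm (x - y)))"

definition linf_hausdist :: "(real^'n) set \<Rightarrow> (real^'n) set \<Rightarrow> ereal" where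
  "linf_hausdist A B = max (SUP a\<in>A. linf_dist a B) (SUP b\<in>B. linf_dist b A)"

definition linf_nbhd :: "real \<Rightarrow> (real^'n) set \<Rightarrow> (real^'n) set" where
  "linf_nbhd r M = (\<Union>x\<in>M. {y. infnorm (x - y) \<le> r})"


section \<open>Reachable sets and dimensions\<close>

definition test_function :: "real \<Rightarrow> (real \<Rightarrow> real) \<Rightarrow> bool" where
  "test_function T \<phi> \<longleftrightarrow>
     (\<forall>k s. ((deriv ^^ k) \<phi>) field_differentiable (at s)) \<and>
     (\<exists>a b. 0 < a \<and> b < T \<and> (\<forall>s. s \<notin> {a..b} \<longrightarrow> \<phi> s = 0))"

text \<open>The function \<open>x\<close> is the continuous representative of an element of the Sobolev space
  \<open>W\<^sup>1\<^sup>,\<^sup>1\<close> on the interval from \<open>0\<close> to \<open>T\<close>, and \<open>g\<close> represents its weak derivative.\<close>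

definition sobolev_with_deriv :: "real \<Rightarrow> (real \<Rightarrow> real^'n) \<Rightarrow> (real \<Rightarrow> real^'n) \<Rightarrow> bool" where
  "sobolev_with_deriv T x g \<longleftrightarrow>
     continuous_on {0..T} x \<and>
     x absolutely_integrable_on {0..T} \<and>
     g absolutely_integrable_on {0..T} \<and>
     (\<forall>\<phi>. test_function T \<phi> \<longrightarrow>
        integral {0..T} (\<lambda>s. deriv \<phi> s *\<^sub>R x s) = - integral {0..T} (\<lambda>s. \<phi> s *\<^sub>R g s))"

definition reach ::
    "real \<Rightarrow> (real^'n) set \<Rightarrow> (real^'n \<Rightarrow> (real^'n) set) \<Rightarrow> real \<Rightarrow> (real^'n) set" where
  "reach T X0 F t =
     {x t | x. \<exists>g. sobolev_with_deriv T x g \<and> x 0 \<in> X0 \<and>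
                   (AE s in lebesgue. s \<in> {0<..<T} \<longrightarrow> g s \<in> F (x s))}"

text \<open>Reachable sets need not be convex, and their dimension enters the algorithm only through
  the integer exponents below.  Any integer-valued dimension is admitted that is monotone and
  assigns to nonempty convex sets their affine dimension (e.g. affine or topological dimension).\<close>

definition dimension_notion :: "((real^'n) set \<Rightarrow> int) \<Rightarrow> bool" where
  "dimension_notion sdim \<longleftrightarrow>
     (\<forall>A B. A \<subseteq> B \<longrightarrow> sdim A \<le> sdim B) \<and>
     (\<forall>K. convex K \<and> K \<noteq> {} \<longrightarrow> sdim K = aff_dim K)"

definition dim_x ::
    "((real^'n) set \<Rightarrow> int) \<Rightarrow> real \<Rightarrow> (real^'n) set \<Rightarrow> (real^'n \<Rightarrow> (real^'n) set) \<Rightarrow> int" where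
  "dim_x sdim T X0 F = Max ((\<lambda>t. sdim (reach T X0 F t)) ` {0..T})"

definition dim_u ::
    "((real^'n) set \<Rightarrow> int) \<Rightarrow> real \<Rightarrow> (real^'n) set \<Rightarrow> (real^'n \<Rightarrow> (real^'n) set) \<Rightarrow> int" where
  "dim_u sdim T X0 F = Max ((\<lambda>t. Max ((\<lambda>x. sdim (F x)) ` reach T X0 F t)) ` {0..T})"

definition dim_R ::
    "((real^'n) set \<Rightarrow> int) \<Rightarrow> real \<Rightarrow> (real^'n) set \<Rightarrow> (real^'n \<Rightarrow> (real^'n) set) \<Rightarrow> nat" where
  "dim_R sdim T X0 F = nat (min (int CARD('n) - 1) (dim_x sdim T X0 F))"

definition dim_F ::
    "((real^'n) set \<Rightarrow> int) \<Rightarrow> real \<Rightarrow> (real^'n) set \<Rightarrow> (real^'n \<Rightarrow> (real^'n) set) \<Rightarrow> nat" where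
  "dim_F sdim T X0 F = nat (min (int CARD('n) - 1) (dim_u sdim T X0 F))"


section \<open>Grids and boundary pairs\<close>

definition grid :: "real \<Rightarrow> (real^'n) set" where
  "grid \<rho> = {x. \<forall>i. \<exists>m::int. x $ i = \<rho> * of_int m}"

definition grid_sets :: "real \<Rightarrow> (real^'n) set set" where
  "grid_sets \<rho> = {M. M \<subseteq> grid \<rho> \<and> M \<noteq> {}}"

definition conn_grid_sets :: "real \<Rightarrow> (real^'n) set set" where
  "conn_grid_sets \<rho> =
     {M \<in> grid_sets \<rho>. \<forall>x\<in>M. \<forall>z\<in>M. \<exists>(y :: nat \<Rightarrow> real^'n) m.
        y 0 = x \<and> y m = z \<and> (\<forall>i\<le>m. y i \<in> M) \<and> (\<forall>i<m. infnorm (y (Suc i) - y i) = \<rho>)}"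

definition layer0 :: "real \<Rightarrow> (real^'n) set \<Rightarrow> (real^'n) set" where
  "layer0 \<rho> M = {x \<in> M. \<exists>z \<in> grid \<rho> - M. infnorm (x - z) = \<rho>}"

definition layer :: "real \<Rightarrow> int \<Rightarrow> (real^'n) set \<Rightarrow> (real^'n) set" where
  "layer \<rho> j M =
     (if j = 0 then layer0 \<rho> M
      else if j > 0 then {x \<in> grid \<rho> - M. linf_dist x (layer0 \<rho> M) = ereal (of_int j * \<rho>)}
      else {x \<in> M. linf_dist x (layer0 \<rho> M) = ereal (of_int (- j) * \<rho>)})"

definition tr :: "real \<Rightarrow> (real^'n) set \<Rightarrow> (real^'n) set \<times> (real^'n) set" where
  "tr \<rho> M = (layer \<rho> 0 M, layer \<rho> 1 M)"

definition tr_inv :: "real \<Rightarrow> (real^'n) set \<times> (real^'n) set \<Rightarrow> (real^'n) set" where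
  "tr_inv \<rho> D = inv_into (grid_sets \<rho>) (tr \<rho>) D"

definition bdc :: "real \<Rightarrow> ((real^'n) set \<times> (real^'n) set) set" where
  "bdc \<rho> = tr \<rho> ` conn_grid_sets \<rho>"

definition coarsen :: "real \<Rightarrow> (real^'n) set \<Rightarrow> (real^'n) set" where
  "coarsen \<rho>' M = linf_nbhd (\<rho>' / 2) M \<inter> grid \<rho>'"

definition coarsen_bd ::
    "real \<Rightarrow> real \<Rightarrow> (real^'n) set \<times> (real^'n) set \<Rightarrow> (real^'n) set \<times> (real^'n) set" where
  "coarsen_bd \<rho> \<rho>' D = tr \<rho>' (coarsen \<rho>' (tr_inv \<rho> D))"


section \<open>Euler maps\<close>

definition grid_proj :: "real \<Rightarrow> real \<Rightarrow> (real^'n) set \<Rightarrow> (real^'n) set" where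
  "grid_proj \<alpha> \<rho> M = linf_nbhd \<alpha> M \<inter> grid \<rho>"

definition euler :: "(real^'n \<Rightarrow> (real^'n) set) \<Rightarrow> real \<Rightarrow> real^'n \<Rightarrow> (real^'n) set" where
  "euler F h x = (\<lambda>f. x + h *\<^sub>R f) ` F x"

definition Phi ::
    "(real^'n \<Rightarrow> (real^'n) set) \<Rightarrow> real \<Rightarrow> real \<Rightarrow> real \<Rightarrow> real^'n \<Rightarrow> (real^'n) set" where
  "Phi F \<alpha> h \<rho> x = grid_proj \<alpha> \<rho> (euler F h x)"

definition Phi_bd ::
    "(real^'n \<Rightarrow> (real^'n) set) \<Rightarrow> real \<Rightarrow> real \<Rightarrow> real \<Rightarrow> real^'n \<Rightarrow> (real^'n) set" where
  "Phi_bd F \<alpha> h \<rho> x = grid_proj \<alpha> \<rho> (frontier (euler F h x))"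

definition alpha :: "real \<Rightarrow> real \<Rightarrow> real \<Rightarrow> real" where
  "alpha L h \<rho> = (1 + L * h) * (\<rho> / 2)"

definition kappa :: "real \<Rightarrow> real \<Rightarrow> real \<Rightarrow> real" where
  "kappa L h \<rho> = 2 * (1 + L * h) * (alpha L h \<rho> / (1 - L * h) + \<rho>)"

definition Phi2 ::
    "(real^'n \<Rightarrow> (real^'n) set) \<Rightarrow> real \<Rightarrow> real \<Rightarrow> real \<Rightarrow> real \<Rightarrow> real^'n \<Rightarrow> (real^'n) set" where
  "Phi2 F \<alpha> h \<rho> \<rho>' x =
     (if \<rho> < \<rho>' then coarsen \<rho>' (Phi F \<alpha> h \<rho> x) else Phi F \<alpha> h \<rho>' x)"

definition Psi ::
    "real \<Rightarrow> (real^'n \<Rightarrow> (real^'n) set) \<Rightarrow> real \<Rightarrow> real \<Rightarrow> real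
       \<Rightarrow> (real^'n) set \<times> (real^'n) set \<Rightarrow> (real^'n) set \<times> (real^'n) set" where
  "Psi L F h \<rho> \<rho>' D = tr \<rho>' (\<Union>x \<in> tr_inv \<rho> D. Phi2 F (alpha L h \<rho>) h \<rho> \<rho>' x)"


section \<open>Discretizations\<close>

text \<open>The list \<open>step_sizes\<close> holds \<open>h\<^sub>1, \<dots>, h\<^sub>n\<close>, whereas \<open>nodes\<close> and \<open>meshes\<close> are
  indexed from \<open>0\<close> to \<open>n\<close>.\<close>

record discretization =
  step_sizes :: "real list"
  nodes :: "real list"
  meshes :: "real list"

definition nsteps :: "discretization \<Rightarrow> nat" where
  "nsteps \<delta> = length (step_sizes \<delta>)"

definition hh :: "discretization \<Rightarrow> nat \<Rightarrow> real" where
  "hh \<delta> j = step_sizes \<delta> ! (j - 1)"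

definition tt :: "discretization \<Rightarrow> nat \<Rightarrow> real" where
  "tt \<delta> k = nodes \<delta> ! k"

definition rr :: "discretization \<Rightarrow> nat \<Rightarrow> real" where
  "rr \<delta> k = meshes \<delta> ! k"

definition aleph_n :: "real \<Rightarrow> real \<Rightarrow> real \<Rightarrow> nat \<Rightarrow> discretization set" where
  "aleph_n T L P n =
     {\<delta>. length (step_sizes \<delta>) = n \<and> length (nodes \<delta>) = Suc n \<and> length (meshes \<delta>) = Suc n \<and>
         (\<forall>j\<in>{1..n}. hh \<delta> j > 0) \<and>
         (\<forall>k\<in>{0..n}. rr \<delta> k > 0) \<and>
         (\<forall>k\<in>{0..n}. tt \<delta> k = (\<Sum>j=1..k. hh \<delta> j)) \<and>
         tt \<delta> n = T \<and>
         (\<forall>j\<in>{1..n}. \<bar>hh \<delta> j\<bar> \<le> 1 / (4 * L)) \<and>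
         (\<forall>k\<in>{0..n}. \<bar>rr \<delta> k\<bar> \<le> P / (8 * L)) \<and>
         (\<forall>j\<in>{0..n}. \<forall>k\<in>{0..n}. \<exists>l::int. rr \<delta> j / rr \<delta> k = 4 powi l) \<and>
         (\<forall>j\<in>{1..n}. rr \<delta> j = 2 * L * P * (hh \<delta> j)^2)}"

definition aleph :: "real \<Rightarrow> real \<Rightarrow> real \<Rightarrow> discretization set" where
  "aleph T L P = (\<Union>n\<in>{1..}. aleph_n T L P n)"

definition subdivide :: "discretization \<Rightarrow> nat \<Rightarrow> discretization" where
  "subdivide \<delta> j =
     (if j = 0 then \<delta>\<lparr>meshes := (meshes \<delta>)[0 := rr \<delta> 0 / 4]\<rparr>
      else \<lparr>step_sizes = take (j - 1) (step_sizes \<delta>) @ [hh \<delta> j / 2, hh \<delta> j / 2]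
                           @ drop j (step_sizes \<delta>),
            nodes = take j (nodes \<delta>) @ [tt \<delta> j - hh \<delta> j / 2] @ drop j (nodes \<delta>),
            meshes = take j (meshes \<delta>) @ [rr \<delta> j / 4, rr \<delta> j / 4]
                           @ drop (Suc j) (meshes \<delta>)\<rparr>)"

primrec discrete_reach ::
    "real \<Rightarrow> (real^'n) set \<Rightarrow> (real^'n \<Rightarrow> (real^'n) set) \<Rightarrow> discretization
       \<Rightarrow> nat \<Rightarrow> (real^'n) set" where
  "discrete_reach L X0 F \<delta> 0 = grid_proj (rr \<delta> 0 / 2) (rr \<delta> 0) X0"
| "discrete_reach L X0 F \<delta> (Suc k) =
     (\<Union>x \<in> discrete_reach L X0 F \<delta> k.
        Phi2 F (alpha L (hh \<delta> (Suc k)) (rr \<delta> k)) (hh \<delta> (Suc k)) (rr \<delta> k) (rr \<delta> (Suc k)) x)"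


section \<open>Error and cost\<close>

definition chi :: "discretization \<Rightarrow> nat \<Rightarrow> real" where
  "chi \<delta> k = (if rr \<delta> (k - 1) < rr \<delta> k then rr \<delta> k / 2 else 0)"

definition local_error :: "real \<Rightarrow> real \<Rightarrow> real \<Rightarrow> discretization \<Rightarrow> nat \<Rightarrow> real" where
  "local_error T L P \<delta> k =
     (if k = 0 then rr \<delta> 0 / 2 * exp (L * T)
      else exp (L * (T - tt \<delta> k)) *
           ((exp (L * hh \<delta> k) - 1) *
              (P * hh \<delta> k + (1 + L * hh \<delta> k)^2 / (L * hh \<delta> k) * (rr \<delta> (k - 1) / 2))
            + chi \<delta> k))"

definition err :: "real \<Rightarrow> real \<Rightarrow> real \<Rightarrow> discretization \<Rightarrow> real" where
  "err T L P \<delta> = (\<Sum>k=0..nsteps \<delta>. local_error T L P \<delta> k)"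

definition sigma :: "real \<Rightarrow> real \<Rightarrow> real \<Rightarrow> real" where
  "sigma L h \<rho> = \<rho> / 4 * (1 + L * h) * ((1 + L * h) / (1 - L * h) + 6)"

definition cost :: "real \<Rightarrow> nat \<Rightarrow> nat \<Rightarrow> (real \<Rightarrow> real) \<Rightarrow> discretization \<Rightarrow> real" where
  "cost L dR dF v \<delta> =
     (\<Sum>k<nsteps \<delta>.
        4 * v (tt \<delta> k) * hh \<delta> (Suc k) ^ dF
        / (rr \<delta> k ^ dR * min (rr \<delta> k) (rr \<delta> (Suc k)) ^ (dF + 1))
        * sigma L (hh \<delta> (Suc k)) (rr \<delta> k))"


section \<open>Step procedure\<close>

text \<open>Returns the new boundary pair together with the two counts.\<close>

definition step_procedure ::
    "real \<Rightarrow> (real^'n \<Rightarrow> (real^'n) set) \<Rightarrow> real \<Rightarrow> real \<Rightarrow> real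
       \<Rightarrow> (real^'n) set \<times> (real^'n) set
       \<Rightarrow> ((real^'n) set \<times> (real^'n) set) \<times> nat \<times> nat" where
  "step_procedure L F h \<rho> \<rho>' D =
    (let \<alpha> = alpha L h \<rho>;
         \<kappa> = kappa L h \<rho>;
         \<eta> = min \<rho> \<rho>';
         D0 = fst D;
         D1 = snd D;
         Dm1 = layer \<rho> (-1) (tr_inv \<rho> D);
         D2 = layer \<rho> 2 (tr_inv \<rho> D);
         cR = card Dm1 + card D0 + card D1 + card D2;
         W00 = (\<Union>x\<in>D0. Phi_bd F (\<alpha> + \<kappa>) h \<eta> x) \<inter> (\<Union>x\<in>D0. Phi F \<alpha> h \<eta> x);
         W1 = (\<Union>x \<in> D1 \<union> D2. Phi_bd F \<alpha> h \<eta> x);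
         W0m1 = (\<Union>x\<in>Dm1. Phi_bd F \<alpha> h \<eta> x);
         E1 = {x \<in> W1. linf_dist x (W00 \<union> W0m1) = ereal \<eta>};
         E0 = {x \<in> W00 \<union> W0m1. linf_dist x E1 = ereal \<eta>};
         cF = (\<Sum>x\<in>Dm1. card (Phi_bd F \<alpha> h \<eta> x))
              + (\<Sum>x\<in>D1. card (Phi_bd F \<alpha> h \<eta> x))
              + (\<Sum>x\<in>D2. card (Phi_bd F \<alpha> h \<eta> x))
              + (\<Sum>x\<in>D0. card (Phi_bd F (\<alpha> + \<kappa>) h \<eta> x \<inter> Phi F \<alpha> h \<eta> x))
     in (if \<rho>' > \<rho> then coarsen_bd \<eta> \<rho>' (E0, E1) else (E0, E1), cR, cF))"


section \<open>Tracking procedure\<close>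

primrec track_pair ::
    "real \<Rightarrow> (real^'n \<Rightarrow> (real^'n) set) \<Rightarrow> discretization
       \<Rightarrow> (real^'n) set \<times> (real^'n) set \<Rightarrow> nat \<Rightarrow> (real^'n) set \<times> (real^'n) set" where
  "track_pair L F \<delta> D 0 = D"
| "track_pair L F \<delta> D (Suc k) =
     fst (step_procedure L F (hh \<delta> (Suc k)) (rr \<delta> k) (rr \<delta> (Suc k)) (track_pair L F \<delta> D k))"

definition track_counts ::
    "real \<Rightarrow> (real^'n \<Rightarrow> (real^'n) set) \<Rightarrow> discretization
       \<Rightarrow> (real^'n) set \<times> (real^'n) set \<Rightarrow> nat \<Rightarrow> nat \<times> nat" where
  "track_counts L F \<delta> D k =
     snd (step_procedure L F (hh \<delta> (Suc k)) (rr \<delta> k) (rr \<delta> (Suc k)) (track_pair L F \<delta> D k))"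

definition track_cR ::
    "real \<Rightarrow> (real^'n \<Rightarrow> (real^'n) set) \<Rightarrow> discretization
       \<Rightarrow> (real^'n) set \<times> (real^'n) set \<Rightarrow> nat \<Rightarrow> nat" where
  "track_cR L F \<delta> D k =
     (if k < nsteps \<delta> then fst (track_counts L F \<delta> D k)
      else (\<Sum>j\<in>{-1..2}. card (layer (rr \<delta> k) j (tr_inv (rr \<delta> k) (track_pair L F \<delta> D k)))))"

definition vhat_R ::
    "real \<Rightarrow> (real^'n \<Rightarrow> (real^'n) set) \<Rightarrow> nat \<Rightarrow> discretization
       \<Rightarrow> (real^'n) set \<times> (real^'n) set \<Rightarrow> nat \<Rightarrow> real" where
  "vhat_R L F dR \<delta> D k = 1 / 4 * real (track_cR L F \<delta> D k) * rr \<delta> k ^ dR"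

definition vhat_F ::
    "real \<Rightarrow> (real^'n \<Rightarrow> (real^'n) set) \<Rightarrow> nat \<Rightarrow> discretization
       \<Rightarrow> (real^'n) set \<times> (real^'n) set \<Rightarrow> nat \<Rightarrow> real" where
  "vhat_F L F dF \<delta> D k =
     (let i = (if k < nsteps \<delta> then k else nsteps \<delta> - 1)
      in min (rr \<delta> i) (rr \<delta> (Suc i)) ^ (dF + 1)
           / (hh \<delta> (Suc i) ^ dF * sigma L (hh \<delta> (Suc i)) (rr \<delta> i))
         * (real (snd (track_counts L F \<delta> D i)) / real (fst (track_counts L F \<delta> D i))))"

text \<open>Piecewise linear interpolation of \<open>v 0, \<dots>, v n\<close> at the nodes of \<open>\<delta>\<close>; it is only
  meaningful for arguments between the first and the last node.\<close>

definition pl_interp :: "discretization \<Rightarrow> (nat \<Rightarrow> real) \<Rightarrow> real \<Rightarrow> real" where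
  "pl_interp \<delta> v s =
     (let k = (GREATEST k. k < nsteps \<delta> \<and> tt \<delta> k \<le> s)
      in v k + (s - tt \<delta> k) / (tt \<delta> (Suc k) - tt \<delta> k) * (v (Suc k) - v k))"

text \<open>The preconditions under which the tracking procedure is a well-defined finite computation:
  every boundary pair it meets lies in the domain of the subsequent operations, and the layers it
  enumerates are finite.\<close>

definition tracking_ok ::
    "real \<Rightarrow> real \<Rightarrow> real \<Rightarrow> (real^'n \<Rightarrow> (real^'n) set) \<Rightarrow> discretization
       \<Rightarrow> (real^'n) set \<times> (real^'n) set \<Rightarrow> bool" where
  "tracking_ok T L P F \<delta> D \<longleftrightarrow>
     \<delta> \<in> aleph T L P \<and>
     (\<forall>k\<in>{0..nsteps \<delta>}.
        track_pair L F \<delta> D k \<in> bdc (rr \<delta> k) \<and>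
        (\<forall>j\<in>{-1..2}. finite (layer (rr \<delta> k) j (tr_inv (rr \<delta> k) (track_pair L F \<delta> D k)))))"


section \<open>Refinement procedure\<close>

definition refine_choice ::
    "(discretization \<Rightarrow> real) \<Rightarrow> (discretization \<Rightarrow> real) \<Rightarrow> discretization \<Rightarrow> nat \<Rightarrow> bool" where
  "refine_choice C E \<delta> k \<longleftrightarrow>
     (let dC = (\<lambda>j. C (subdivide \<delta> j) - C \<delta>);
          dE = (\<lambda>j. E (subdivide \<delta> j) - E \<delta>);
          J = {0..nsteps \<delta>}
      in if Min (dC ` J) > 0
         then is_arg_min (\<lambda>j. dE j / dC j) (\<lambda>j. j \<in> J) k
         else is_arg_min dC (\<lambda>j. j \<in> J) k)"


section \<open>Iterative boundary tracking algorithm\<close>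

definition initial_disc :: "real \<Rightarrow> real \<Rightarrow> real \<Rightarrow> discretization" where
  "initial_disc T L P =
     (let n0 = nat \<lceil>4 * L * T\<rceil>
      in \<lparr>step_sizes = replicate n0 (T / real n0),
          nodes = map (\<lambda>k. real k * T / real n0) [0..<Suc n0],
          meshes = replicate (Suc n0) (2 * L * P * T^2 / (real n0)^2)\<rparr>)"

definition initial_pair ::
    "(real^'n) set \<Rightarrow> discretization \<Rightarrow> (real^'n) set \<times> (real^'n) set" where
  "initial_pair X0 \<delta> = tr (rr \<delta> 0) (grid_proj (rr \<delta> 0 / 2) (rr \<delta> 0) X0)"

text \<open>The algorithm is nondeterministic, because minimizers need not be unique, and its refinement
  loop need not stop a priori.  It is therefore modelled as a transition relation.  The state
  \<open>Tracking l \<delta>\<close> is the beginning of the outer loop body for the index \<open>l\<close>;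
  \<open>Refining l v \<delta>\<close> is the head of the inner while loop that computes the discretization with
  index \<open>l + 1\<close> using the weight \<open>v\<close>.  A violated precondition leaves the machine stuck in a
  state other than \<open>Returned\<close>.\<close>

datatype 'p ibta_state =
    Tracking nat discretization
  | Refining nat "real \<Rightarrow> real" discretization
  | Returned nat discretization "('p set \<times> 'p set) list"

inductive ibta_step ::
    "real \<Rightarrow> real \<Rightarrow> real \<Rightarrow> (real^'n) set \<Rightarrow> (real^'n \<Rightarrow> (real^'n) set) \<Rightarrow> nat \<Rightarrow> nat
       \<Rightarrow> nat \<Rightarrow> (nat \<Rightarrow> real) \<Rightarrow> (real^'n) ibta_state \<Rightarrow> (real^'n) ibta_state \<Rightarrow> bool"
  for T L P X0 F dR dF lmax \<epsilon>
where
  start_refinement: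
    "\<lbrakk> l < lmax; D = initial_pair X0 \<delta>; tracking_ok T L P F \<delta> D;
       vR = pl_interp \<delta> (vhat_R L F dR \<delta> D); vF = pl_interp \<delta> (vhat_F L F dF \<delta> D);
       v = (\<lambda>s. vR s * vF s);
       continuous_on {0..T} v; \<forall>s\<in>{0..T}. v s > 0;
       \<forall>\<delta>'\<in>aleph T L P. cost L dR dF v \<delta>' > 0 \<and> err T L P \<delta>' > 0 \<rbrakk>
     \<Longrightarrow> ibta_step T L P X0 F dR dF lmax \<epsilon> (Tracking l \<delta>) (Refining l v \<delta>)"
| refine:
    "\<lbrakk> err T L P \<delta> > \<epsilon> (Suc l); refine_choice (cost L dR dF v) (err T L P) \<delta> k \<rbrakk>
     \<Longrightarrow> ibta_step T L P X0 F dR dF lmax \<epsilon> (Refining l v \<delta>) (Refining l v (subdivide \<delta> k))"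
| end_refinement:
    "\<not> err T L P \<delta> > \<epsilon> (Suc l)
     \<Longrightarrow> ibta_step T L P X0 F dR dF lmax \<epsilon> (Refining l v \<delta>) (Tracking (Suc l) \<delta>)"
| return_result:
    "\<lbrakk> D = initial_pair X0 \<delta>; tracking_ok T L P F \<delta> D \<rbrakk>
     \<Longrightarrow> ibta_step T L P X0 F dR dF lmax \<epsilon> (Tracking lmax \<delta>)
           (Returned (nsteps \<delta>) \<delta> (map (track_pair L F \<delta> D) [0..<Suc (nsteps \<delta>)]))"

end

theory Submission
  imports Defs
begin

text \<open>
  Correctness of one step: let \<open>N\<close> be the image of the grid set \<open>M\<close> under the Euler map \<open>\<phi>\<close>. A boundary
  point of \<open>N\<close> lies close to the frontier of every \<open>\<phi>(y)\<close> that reaches it, and a neighbour outside \<open>N\<close> has,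
  since \<open>w \<mapsto> x - h F(w)\<close> is a contraction, a grid preimage outside \<open>M\<close> at distance at most \<open>2\<rho>\<close> from
  \<open>y\<close>; hence the layers \<open>-1, ..., 2\<close> of \<open>M\<close> suffice. Conversely, an outer candidate that belongs to \<open>N\<close>
  is an inner candidate, because the grid preimages of a point are chain connected and therefore meet the
  boundary layer of \<open>M\<close>.

  Termination of the refinement: define \<open>h\<^sub>0\<close> by \<open>\<rho>\<^sub>0 = 2 L P h\<^sub>0\<^sup>2\<close>. Only finitely many picks have size above
  a given bound, so either all sizes become small, and the error with them, or some cell is never picked
  again. That cell always offers a ratio below \<open>-c / (1 + 1/h ^ (dF + 2))\<close>, where \<open>h\<close> is the size of its
  right neighbour, whereas a pick of size \<open>s\<close> that has no finer neighbour on its left has a ratio above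
  \<open>-C s ^ (dF + 2 dR + 1)\<close>. Such picks recur with sizes tending to zero; if the right neighbour is picked
  infinitely often, then \<open>s = h\<close> at these picks, and otherwise \<open>h\<close> is eventually constant. Both cases are
  contradictory.
\<close>

section \<open>Max norm, grids and chains\<close>

text \<open>Fixed point sets of set-valued contractions with convex values are known to be
  connected. Here this is replaced by chains of approximate fixed points: convexity and
  \<open>L * h \<le> 1 / 4\<close> allow the tolerance of a chain to be halved, and a small
  tolerance survives rounding to the grid.

  In the refinement, neither increment has an obvious sign. The cost may fall if the left neighbour
  has a finer mesh, which is why only picks without such a neighbour are compared. A subdivision may
  also switch on the term \<open>chi\<close> of the right neighbour; the loss equals the gain to
  first order, and only the second order shows that every subdivision lowers the error by at least a
  constant times the cube of the step size. The exponents arise as follows: up to constants, a pick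
  of size \<open>s\<close> raises the cost by at least \<open>1 / s ^ (dF + 2 * dR)\<close> and
  lowers the error by at most \<open>s\<close>, whereas a right neighbour of size \<open>h\<close>
  and mesh \<open>2 * L * P * h\<^sup>2\<close> contributes
  \<open>h ^ dF / (h\<^sup>2) ^ (dF + 1) = 1 / h ^ (dF + 2)\<close>. For \<open>s = h\<close> the
  surplus is \<open>s ^ (2 * dR - 1)\<close>, which tends to zero because
  \<open>dR \<ge> 1\<close>.\<close>

lemma infnorm_le_iff: "infnorm (x :: real^'n) \<le> r \<longleftrightarrow> (\<forall>i. \<bar>x $ i\<bar> \<le> r)"
proof
  assume "\<forall>i. \<bar>x $ i\<bar> \<le> r"
  then show "infnorm x \<le> r"
    unfolding infnorm_cart by (intro cSup_least) auto
qed (use component_le_infnorm_cart order_trans in blast)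

lemma infnorm_attained: "\<exists>i. \<bar>(x :: real^'n) $ i\<bar> = infnorm x"
proof -
  have eq: "{\<bar>x $ i\<bar> |i. i \<in> UNIV} = range (\<lambda>i. \<bar>x $ i\<bar>)" by auto
  have "infnorm x = Max (range (\<lambda>i. \<bar>x $ i\<bar>))"
    unfolding infnorm_cart eq by (rule cSup_eq_Max) auto
  moreover have "Max (range (\<lambda>i. \<bar>x $ i\<bar>)) \<in> range (\<lambda>i. \<bar>x $ i\<bar>)" by (rule Max_in) auto
  ultimately show ?thesis by (metis imageE)
qed

lemma infnorm_triangle_diff: "infnorm (x - z) \<le> infnorm (x - y) + infnorm (y - z)"
  using infnorm_triangle[of "x - y" "y - z"] by simp

lemma mem_linf_nbhd: "y \<in> linf_nbhd r M \<longleftrightarrow> (\<exists>x\<in>M. infnorm (y - x) \<le> r)"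
  unfolding linf_nbhd_def by (auto simp: infnorm_sub)

lemma linf_nbhd_mono: "A \<subseteq> B \<Longrightarrow> r \<le> s \<Longrightarrow> linf_nbhd r A \<subseteq> linf_nbhd s B"
  by (force simp: mem_linf_nbhd)

lemma linf_nbhd_linf_nbhd:
  assumes "x \<in> linf_nbhd r A" "A \<subseteq> linf_nbhd s B"
  shows "x \<in> linf_nbhd (r + s) B"
proof -
  obtain a where a: "a \<in> A" "infnorm (x - a) \<le> r" using assms(1) by (auto simp: mem_linf_nbhd)
  obtain b where "b \<in> B" "infnorm (a - b) \<le> s" using assms(2) a(1) by (force simp: mem_linf_nbhd)
  then show ?thesis using a infnorm_triangle_diff[of x b a] by (force simp: mem_linf_nbhd)
qed

lemma bounded_linf_nbhd:
  assumes "bounded A"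
  shows "bounded (linf_nbhd r A :: (real^'n) set)"
proof -
  obtain B where B: "\<And>x. x \<in> A \<Longrightarrow> norm x \<le> B" using assms bounded_iff by blast
  have "norm y \<le> sqrt DIM(real^'n) * (r + B)" if y: "y \<in> linf_nbhd r A" for y
  proof -
    obtain x where "x \<in> A" "infnorm (y - x) \<le> r" using y by (auto simp: mem_linf_nbhd)
    then have "infnorm y \<le> r + B"
      using infnorm_triangle[of "y - x" x] infnorm_le_norm[of x] B[of x] by auto
    then have "sqrt DIM(real^'n) * infnorm y \<le> sqrt DIM(real^'n) * (r + B)"
      by (rule mult_left_mono) simp
    then show ?thesis using norm_le_infnorm[of y] by linarith
  qed
  then show ?thesis by (auto intro: boundedI)
qed

lemma finite_grid_bounded:
  assumes "bounded S" "\<rho> > 0"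
  shows "finite (S \<inter> grid \<rho> :: (real^'n) set)"
proof -
  obtain B where B: "\<And>x. x \<in> S \<Longrightarrow> norm x \<le> B" using assms bounded_iff by blast
  let ?K = "{-\<lceil>B / \<rho>\<rceil>..\<lceil>B / \<rho>\<rceil>} :: int set"
  let ?f = "\<lambda>m. \<chi> i. \<rho> * of_int (m i) :: real^'n"
  have "x \<in> ?f ` (UNIV \<rightarrow>\<^sub>E ?K)" if "x \<in> S \<inter> grid \<rho>" for x
  proof -
    from that obtain m where m: "\<And>i. x $ i = \<rho> * of_int (m i)"
      unfolding grid_def by (auto, metis)
    have "m i \<in> ?K" for i
    proof -
      have "\<bar>x $ i\<bar> \<le> B" using B[of x] that component_le_norm_cart[of x i] by simp
      then have "\<bar>of_int (m i)\<bar> \<le> B / \<rho>"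
        using assms(2) m[of i] by (simp add: abs_mult pos_le_divide_eq mult.commute)
      then show ?thesis by (simp add: abs_le_iff) linarith
    qed
    moreover have "x = ?f m" using m by (simp add: vec_eq_iff)
    ultimately show ?thesis by (intro image_eqI[of _ _ m]) auto
  qed
  moreover have "finite (?f ` (UNIV \<rightarrow>\<^sub>E ?K))" by (intro finite_imageI finite_PiE) auto
  ultimately show ?thesis by (meson finite_subset subsetI)
qed

lemma grid_infnorm_diff:
  assumes "x \<in> grid \<rho>" "y \<in> grid \<rho>" "\<rho> > 0"
  obtains k :: nat where "infnorm (x - y :: real^'n) = real k * \<rho>"
proof -
  obtain i where i: "\<bar>(x - y) $ i\<bar> = infnorm (x - y)" using infnorm_attained by blast
  obtain m n :: int where "x $ i = \<rho> * of_int m" "y $ i = \<rho> * of_int n"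
    using assms(1,2) unfolding grid_def by blast
  then have "infnorm (x - y) = real (nat \<bar>m - n\<bar>) * \<rho>"
    using i assms(3) by (simp add: right_diff_distrib[symmetric] abs_mult mult.commute flip: of_int_diff)
  then show ?thesis using that by blast
qed

text \<open>Distances in the grid are multiples of \<rho>. This turns estimates with fractional
  constants, such as \<open>13 / 6 * \<rho> + \<rho> / 2 < 3 * \<rho>\<close>, into sharp bounds on
  layers.\<close>

lemma grid_infnorm_less:
  assumes "x \<in> grid \<rho>" "y \<in> grid \<rho>" "\<rho> > 0" "infnorm (x - y :: real^'n) < real (Suc k) * \<rho>"
  shows "infnorm (x - y) \<le> real k * \<rho>"
proof -
  obtain j :: nat where j: "infnorm (x - y) = real j * \<rho>" using grid_infnorm_diff assms by metis
  then have "real j < real (Suc k)" using assms(3,4) by simp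
  then show ?thesis using j assms(3) by simp
qed

text \<open>The values of the distance form a discrete set, so the infimum is attained even over an
  infinite \<open>M\<close>. For empty \<open>M\<close> both sides are false, since the distance is
  then infinite.\<close>

lemma linf_dist_grid_iff:
  assumes "x \<in> grid \<rho>" "M \<subseteq> grid \<rho>" "\<rho> > 0"
  shows "linf_dist x M = ereal (real j * \<rho>) \<longleftrightarrow>
    (\<exists>y\<in>M. infnorm (x - y :: real^'n) = real j * \<rho>) \<and> (\<forall>y\<in>M. infnorm (x - y) \<ge> real j * \<rho>)"
    (is "?L \<longleftrightarrow> ?R")
proof
  assume ?L
  then have lower: "infnorm (x - y) \<ge> real j * \<rho>" if "y \<in> M" for y
    using INF_lower[OF that, of "\<lambda>y. ereal (infnorm (x - y))"] unfolding linf_dist_def by simp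
  have "linf_dist x M < ereal (real (Suc j) * \<rho>)" using \<open>?L\<close> assms(3) by simp
  then obtain y where y: "y \<in> M" "infnorm (x - y) < real (Suc j) * \<rho>"
    unfolding linf_dist_def INF_less_iff by auto
  then have "infnorm (x - y) \<le> real j * \<rho>" using grid_infnorm_less assms by blast
  then show ?R using lower y(1) by (force intro: antisym)
next
  assume ?R
  then show ?L unfolding linf_dist_def
    by (intro antisym INF_greatest) (auto intro: INF_lower2)
qed

text \<open>An inequality, not the equality of \<open>conn_grid_sets\<close>, so that one notion
  covers subsets of the whole space as well as grid sets.\<close>

definition hop :: "real \<Rightarrow> (real^'n) set \<Rightarrow> real^'n \<Rightarrow> real^'n \<Rightarrow> bool" where
  "hop r A x y \<longleftrightarrow> x \<in> A \<and> y \<in> A \<and> infnorm (x - y) \<le> r"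

definition chain_connected :: "real \<Rightarrow> (real^'n) set \<Rightarrow> bool" where
  "chain_connected r A \<longleftrightarrow> (\<forall>x\<in>A. \<forall>y\<in>A. (hop r A)\<^sup>*\<^sup>* x y)"

lemma hop_sym: "(hop r A)\<^sup>*\<^sup>* x y \<Longrightarrow> (hop r A)\<^sup>*\<^sup>* y x"
  by (rule sympD[OF symp_rtranclp]) (auto simp: symp_def hop_def infnorm_sub)

lemma hop_mono: "(hop r A)\<^sup>*\<^sup>* x y \<Longrightarrow> A \<subseteq> B \<Longrightarrow> r \<le> s \<Longrightarrow> (hop s B)\<^sup>*\<^sup>* x y"
  by (rule rtranclp_mono[THEN predicate2D, rotated]) (auto simp: hop_def)

text \<open>The classes of the chain relation are relatively open, because \<open>infnorm\<close> is
  at most the Euclidean norm and hence a Euclidean ball of radius \<open>r\<close> is reached from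
  its centre in one hop.\<close>

lemma connected_imp_chain_connected:
  assumes "connected (A :: (real^'n) set)" "r > 0"
  shows "chain_connected r A"
  unfolding chain_connected_def
proof (intro ballI)
  fix x y assume "x \<in> A" "y \<in> A"
  show "(hop r A)\<^sup>*\<^sup>* x y"
  proof (rule connected_equivalence_relation[OF assms(1) \<open>x \<in> A\<close> \<open>y \<in> A\<close>])
    fix a assume "a \<in> A"
    have "(hop r A)\<^sup>*\<^sup>* a x" if "x \<in> A \<inter> ball a r" for x
      using that \<open>a \<in> A\<close> order_trans[OF infnorm_le_norm, of "a - x" r]
      by (auto simp: hop_def dist_norm intro!: r_into_rtranclp[of "hop r A"])
    moreover have "openin (top_of_set A) (A \<inter> ball a r)" "a \<in> A \<inter> ball a r"
      using \<open>a \<in> A\<close> assms(2) by auto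
    ultimately show "\<exists>T. openin (top_of_set A) T \<and> a \<in> T \<and> (\<forall>x\<in>T. (hop r A)\<^sup>*\<^sup>* a x)"
      by blast
  next
    fix x y assume "(hop r A)\<^sup>*\<^sup>* x y"
    then show "(hop r A)\<^sup>*\<^sup>* y x" by (rule hop_sym)
  next
    fix x y z assume "(hop r A)\<^sup>*\<^sup>* x y" "(hop r A)\<^sup>*\<^sup>* y z"
    then show "(hop r A)\<^sup>*\<^sup>* x z" by (rule rtranclp_trans)
  qed
qed

text \<open>A chain of indices is lifted to the union. Two instances matter: grid boxes around the
  points of a set that is projected to the grid, and Euler images of the points of a grid
  set.\<close>

lemma chain_connected_UN:
  assumes M: "chain_connected s M"
    and B: "\<And>x. x \<in> M \<Longrightarrow> chain_connected r (B x)"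
    and link: "\<And>x y. x \<in> M \<Longrightarrow> y \<in> M \<Longrightarrow> infnorm (x - y) \<le> s \<Longrightarrow>
                 \<exists>a\<in>B x. \<exists>b\<in>B y. infnorm (a - b) \<le> r"
  shows "chain_connected r (\<Union>x\<in>M. B x)"
proof -
  let ?U = "\<Union>x\<in>M. B x"
  have same: "(hop r ?U)\<^sup>*\<^sup>* a b" if "x \<in> M" "a \<in> B x" "b \<in> B x" for x a b
  proof (rule hop_mono)
    show "(hop r (B x))\<^sup>*\<^sup>* a b" using B[OF that(1)] that by (simp add: chain_connected_def)
  qed (use that in auto)
  have "\<forall>a\<in>B x. \<forall>b\<in>B y. (hop r ?U)\<^sup>*\<^sup>* a b" if "x \<in> M" "(hop s M)\<^sup>*\<^sup>* x y" for x y
    using that(2,1)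
  proof (induction rule: rtranclp_induct)
    case base then show ?case using same by blast
  next
    case (step y z)
    then have yz: "y \<in> M" "z \<in> M" "infnorm (y - z) \<le> s" by (auto simp: hop_def)
    then obtain c d where cd: "c \<in> B y" "d \<in> B z" "infnorm (c - d) \<le> r" using link by blast
    have "hop r ?U c d" using cd yz by (auto simp: hop_def)
    show ?case
    proof (intro ballI)
      fix a b assume "a \<in> B x" "b \<in> B z"
      then have "(hop r ?U)\<^sup>*\<^sup>* a c" "(hop r ?U)\<^sup>*\<^sup>* d b"
        using step cd yz same by blast+
      then show "(hop r ?U)\<^sup>*\<^sup>* a b"
        using \<open>hop r ?U c d\<close> by (meson rtranclp.rtrancl_into_rtrancl rtranclp_trans)
    qed
  qed
  then show ?thesis using M unfolding chain_connected_def by blast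
qed

text \<open>A hop of size at most \<rho> between grid points has length 0 or \<rho>. Hops of length
  0 are dropped, and the remaining closure is unrolled into a finite sequence.\<close>

lemma conn_grid_setsI:
  assumes "M \<subseteq> grid \<rho>" "M \<noteq> {}" "\<rho> > 0" "chain_connected \<rho> M"
  shows "M \<in> conn_grid_sets \<rho>"
proof -
  let ?R = "\<lambda>x y. x \<in> M \<and> y \<in> M \<and> infnorm (y - x) = \<rho>"
  have "\<exists>y m. y 0 = x \<and> y m = z \<and> (\<forall>i\<le>m. y i \<in> M) \<and>
        (\<forall>i<m. infnorm (y (Suc i) - y i) = \<rho>)" if xz: "x \<in> M" "z \<in> M" for x z
  proof -
    have "(hop \<rho> M)\<^sup>*\<^sup>* x z" using assms(4) xz by (auto simp: chain_connected_def)
    then have "?R\<^sup>*\<^sup>* x z"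
    proof (induction rule: rtranclp_induct)
      case (step y z)
      then have yz: "y \<in> M" "z \<in> M" "infnorm (z - y) \<le> \<rho>" by (auto simp: hop_def infnorm_sub)
      obtain k :: nat where k: "infnorm (z - y) = real k * \<rho>"
        using grid_infnorm_diff[of z \<rho> y] yz assms(1,3) by blast
      then have "k \<le> 1" using yz(3) assms(3) by simp
      then have "k = 0 \<or> k = 1" by auto
      then have "z = y \<or> infnorm (z - y) = \<rho>"
        using k infnorm_eq_0[of "z - y"] by auto
      then have "z = y \<or> ?R y z" using yz by auto
      then show ?case
      proof
        assume "?R y z"
        with step.IH show ?thesis by (rule rtranclp.rtrancl_into_rtrancl)
      qed (use step.IH in simp)
    qed auto
    then obtain m where "(?R ^^ m) x z" by (auto dest: rtranclp_imp_relpowp)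
    then obtain f where f: "f 0 = x" "f m = z" "\<And>i. i < m \<Longrightarrow> ?R (f i) (f (Suc i))"
      unfolding relpowp_fun_conv by blast
    have "f i \<in> M" if "i \<le> m" for i
      using f xz that by (cases "i = m") auto
    then show ?thesis using f by (intro exI[of _ f] exI[of _ m]) simp
  qed
  then show ?thesis using assms(1,2) unfolding conn_grid_sets_def grid_sets_def by simp
qed

lemma conn_grid_sets_chain_connected:
  assumes "(M :: (real^'n) set) \<in> conn_grid_sets \<rho>"
  shows "chain_connected \<rho> M"
  unfolding chain_connected_def
proof (intro ballI)
  fix x z assume "x \<in> M" "z \<in> M"
  then obtain y :: "nat \<Rightarrow> real^'n" and m where y: "y 0 = x" "y m = z" "\<And>i. i \<le> m \<Longrightarrow> y i \<in> M"
    "\<And>i. i < m \<Longrightarrow> infnorm (y (Suc i) - y i) = \<rho>"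
    using assms unfolding conn_grid_sets_def by blast
  have "(hop \<rho> M)\<^sup>*\<^sup>* x (y i)" if "i \<le> m" for i
    using that
  proof (induction i)
    case 0 then show ?case using y by simp
  next
    case (Suc i)
    then have "hop \<rho> M (y i) (y (Suc i))" using y by (auto simp: hop_def infnorm_sub[of "y i"])
    then show ?case using Suc by (meson rtranclp.rtrancl_into_rtrancl Suc_leD)
  qed
  then show "(hop \<rho> M)\<^sup>*\<^sup>* x z" using y by auto
qed

text \<open>All coordinates move simultaneously, by one mesh width per hop, towards their targets
  and then rest. Every coordinate stays between its initial and final value, hence inside the
  box.\<close>

lemma chain_connected_box_grid:
  assumes "\<eta> > 0"
  shows "chain_connected \<eta> (linf_nbhd \<alpha> {p} \<inter> grid \<eta> :: (real^'n) set)"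
  unfolding chain_connected_def
proof (intro ballI)
  let ?B = "linf_nbhd \<alpha> {p} \<inter> grid \<eta> :: (real^'n) set"
  fix x z assume xz: "x \<in> ?B" "z \<in> ?B"
  then obtain m n :: "'n \<Rightarrow> int" where mn: "\<And>i. x $ i = \<eta> * of_int (m i)" "\<And>i. z $ i = \<eta> * of_int (n i)"
    unfolding grid_def by (auto, metis)
  have box: "\<bar>\<eta> * of_int (m i) - p $ i\<bar> \<le> \<alpha>" "\<bar>\<eta> * of_int (n i) - p $ i\<bar> \<le> \<alpha>" for i
    using xz mn by (auto simp: mem_linf_nbhd infnorm_le_iff)
  define c :: "nat \<Rightarrow> 'n \<Rightarrow> int" where
    "c k i = (if m i \<le> n i then min (m i + int k) (n i) else max (m i - int k) (n i))" for k i
  define y where "y k = (\<chi> i. \<eta> * of_int (c k i))" for k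
  have yB: "y k \<in> ?B" for k
  proof -
    have "\<bar>\<eta> * of_int (c k i) - p $ i\<bar> \<le> \<alpha>" for i
    proof -
      have "min (m i) (n i) \<le> c k i" "c k i \<le> max (m i) (n i)" by (auto simp: c_def)
      then have "\<eta> * of_int (min (m i) (n i)) \<le> \<eta> * of_int (c k i)"
        "\<eta> * of_int (c k i) \<le> \<eta> * of_int (max (m i) (n i))"
        using assms by (simp_all only: mult_le_cancel_left_pos of_int_le_iff)
      then show ?thesis using box[of i] by (auto simp: min_def max_def split: if_splits)
    qed
    then show ?thesis by (auto simp: y_def grid_def mem_linf_nbhd infnorm_le_iff)
  qed
  have "(hop \<eta> ?B)\<^sup>*\<^sup>* x (y k)" for k
  proof (induction k)
    case 0
    have "y 0 = x" using mn by (auto simp: y_def c_def vec_eq_iff)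
    then show ?case by simp
  next
    case (Suc k)
    have "\<bar>\<eta> * of_int (c k i) - \<eta> * of_int (c (Suc k) i)\<bar> \<le> \<eta>" for i
    proof -
      have "\<bar>c k i - c (Suc k) i\<bar> \<le> 1" by (auto simp: c_def min_def max_def)
      then have "\<bar>of_int (c k i) - of_int (c (Suc k) i)\<bar> \<le> (1::real)"
        by (metis of_int_1_le_iff of_int_abs of_int_diff of_int_le_1_iff)
      then show ?thesis using assms by (simp add: right_diff_distrib[symmetric] abs_mult)
    qed
    then have "hop \<eta> ?B (y k) (y (Suc k))"
      using yB by (auto simp: hop_def infnorm_le_iff) (auto simp: y_def)
    then show ?case using Suc by (meson rtranclp.rtrancl_into_rtrancl)
  qed
  \<comment> \<open>After as many hops as the largest coordinate difference, all coordinates have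
    arrived.\<close>
  moreover define K where "K = Max (range (\<lambda>i. \<bar>m i - n i\<bar>))"
  have "y (nat K) = z"
  proof -
    have K: "\<bar>m i - n i\<bar> \<le> K" for i unfolding K_def by (intro Max_ge) auto
    have "c (nat K) i = n i" for i
      using K[of i] unfolding c_def by (simp add: min_def max_def) linarith
    then show ?thesis using mn by (auto simp: y_def vec_eq_iff)
  qed
  ultimately show "(hop \<eta> ?B)\<^sup>*\<^sup>* x z" by metis
qed

lemma chain_connected_grid: "\<eta> > 0 \<Longrightarrow> chain_connected \<eta> (grid \<eta>)"
  unfolding chain_connected_def
proof (intro ballI)
  fix x z :: "real^'n" assume a: "\<eta> > 0" "x \<in> grid \<eta>" "z \<in> grid \<eta>"
  let ?B = "linf_nbhd (infnorm (z - x)) {x} \<inter> grid \<eta>"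
  have "x \<in> ?B" "z \<in> ?B" using a by (auto simp: mem_linf_nbhd infnorm_0 infnorm_pos_le)
  then have "(hop \<eta> ?B)\<^sup>*\<^sup>* x z"
    using chain_connected_box_grid[OF a(1)] by (auto simp: chain_connected_def)
  then show "(hop \<eta> (grid \<eta>))\<^sup>*\<^sup>* x z" by (rule hop_mono) auto
qed

lemma adjacent_grid_values:
  fixes p q \<alpha> \<eta> :: real
  assumes "\<eta> > 0" "\<eta> \<le> 2 * \<alpha>" "\<bar>p - q\<bar> \<le> 2 * \<alpha>"
  shows "\<exists>m n :: int. \<bar>\<eta> * of_int m - p\<bar> \<le> \<alpha> \<and> \<bar>\<eta> * of_int n - q\<bar> \<le> \<alpha>
           \<and> \<bar>\<eta> * of_int m - \<eta> * of_int n\<bar> \<le> \<eta>"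
proof -
  have *: "\<exists>m n :: int. \<bar>\<eta> * of_int m - p\<bar> \<le> \<alpha> \<and> \<bar>\<eta> * of_int n - q\<bar> \<le> \<alpha>
           \<and> \<bar>\<eta> * of_int m - \<eta> * of_int n\<bar> \<le> \<eta>" if "p \<le> q" "q - p \<le> 2 * \<alpha>" for p q
  proof -
    \<comment> \<open>The last grid value not beyond the right end of the interval around
      \<open>p\<close>. If it lies to the left of the interval around \<open>q\<close>, the next
      grid value lies in that interval, because the two intervals meet and have length at least
      \<eta>.\<close>
    define m where "m = \<lfloor>(p + \<alpha>) / \<eta>\<rfloor>"
    have "of_int m \<le> (p + \<alpha>) / \<eta>" "(p + \<alpha>) / \<eta> < of_int m + 1" unfolding m_def by linarith+
    then have m: "\<eta> * of_int m \<le> p + \<alpha>" "p + \<alpha> < \<eta> * of_int m + \<eta>"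
      using assms(1) by (simp_all add: field_simps)
    show ?thesis
    proof (cases "\<eta> * of_int m \<ge> q - \<alpha>")
      case True
      then show ?thesis using m that assms by (intro exI[of _ m]) auto
    next
      case False
      then show ?thesis using m that assms
        by (intro exI[of _ m] exI[of _ "m + 1"]) (auto simp: distrib_left)
    qed
  qed
  show ?thesis
  proof (cases "p \<le> q")
    case True then show ?thesis using * assms by auto
  next
    case False
    then obtain m n :: int where "\<bar>\<eta> * of_int m - q\<bar> \<le> \<alpha>" "\<bar>\<eta> * of_int n - p\<bar> \<le> \<alpha>"
           "\<bar>\<eta> * of_int m - \<eta> * of_int n\<bar> \<le> \<eta>" using *[of q p] assms by auto
    then show ?thesis by (metis abs_minus_commute)
  qed
qed

lemma adjacent_grid_points:
  fixes p q :: "real^'n"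
  assumes "\<eta> > 0" "\<eta> \<le> 2 * \<alpha>" "infnorm (p - q) \<le> 2 * \<alpha>"
  shows "\<exists>g\<in>linf_nbhd \<alpha> {p} \<inter> grid \<eta>. \<exists>g'\<in>linf_nbhd \<alpha> {q} \<inter> grid \<eta>. infnorm (g - g') \<le> \<eta>"
proof -
  have "\<forall>i. \<exists>mn :: int \<times> int. \<bar>\<eta> * of_int (fst mn) - p $ i\<bar> \<le> \<alpha> \<and> \<bar>\<eta> * of_int (snd mn) - q $ i\<bar> \<le> \<alpha>
           \<and> \<bar>\<eta> * of_int (fst mn) - \<eta> * of_int (snd mn)\<bar> \<le> \<eta>"
    using adjacent_grid_values[OF assms(1,2)] assms(3) by (simp add: infnorm_le_iff)
  then obtain f :: "'n \<Rightarrow> int \<times> int" where f: "\<And>i. \<bar>\<eta> * of_int (fst (f i)) - p $ i\<bar> \<le> \<alpha> \<and>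
      \<bar>\<eta> * of_int (snd (f i)) - q $ i\<bar> \<le> \<alpha> \<and> \<bar>\<eta> * of_int (fst (f i)) - \<eta> * of_int (snd (f i))\<bar> \<le> \<eta>"
    by metis
  show ?thesis
    by (rule bexI[of _ "\<chi> i. \<eta> * of_int (fst (f i))"], rule bexI[of _ "\<chi> i. \<eta> * of_int (snd (f i))"])
      (use f in \<open>auto simp: infnorm_le_iff mem_linf_nbhd grid_def\<close>)
qed

lemma nearest_grid_point:
  assumes "\<eta> > 0"
  obtains g where "g \<in> grid \<eta>" "infnorm (g - p :: real^'n) \<le> \<eta> / 2"
  using adjacent_grid_points[OF assms, of "\<eta> / 2" p p] assms
  by (auto simp: infnorm_0 mem_linf_nbhd)

lemma linf_nbhd_UN: "linf_nbhd r (\<Union>x\<in>M. A x) = (\<Union>x\<in>M. linf_nbhd r (A x))"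
  unfolding linf_nbhd_def by auto

lemma grid_proj_conn_grid_sets:
  assumes "chain_connected (2 * \<alpha>) A" "A \<noteq> {}" "\<eta> > 0" "\<eta> \<le> 2 * \<alpha>"
  shows "grid_proj \<alpha> \<eta> A \<in> conn_grid_sets \<eta>"
proof (rule conn_grid_setsI)
  have eq: "grid_proj \<alpha> \<eta> A = (\<Union>p\<in>A. linf_nbhd \<alpha> {p} \<inter> grid \<eta>)"
    by (auto simp: grid_proj_def linf_nbhd_def)
  show "chain_connected \<eta> (grid_proj \<alpha> \<eta> A)"
    unfolding eq using adjacent_grid_points[OF assms(3,4)] chain_connected_box_grid[OF assms(3)]
    by (intro chain_connected_UN[OF assms(1)]) auto
  obtain p where "p \<in> A" using assms by blast
  obtain g where "g \<in> grid \<eta>" "infnorm (g - p) \<le> \<eta> / 2" using nearest_grid_point[OF assms(3)] .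
  then show "grid_proj \<alpha> \<eta> A \<noteq> {}"
    using assms(4) \<open>p \<in> A\<close> by (force simp: grid_proj_def mem_linf_nbhd)
qed (use assms in \<open>auto simp: grid_proj_def\<close>)

section \<open>Boundary pairs\<close>

lemma grid_infnorm_eq_step:
  assumes "x \<in> grid \<rho>" "y \<in> grid \<rho>" "\<rho> > 0" "infnorm (x - y :: real^'n) \<le> \<rho>" "x \<noteq> y"
  shows "infnorm (x - y) = \<rho>"
proof -
  obtain k :: nat where k: "infnorm (x - y) = real k * \<rho>" using grid_infnorm_diff assms by metis
  moreover have "infnorm (x - y) > 0" using assms(5) by (simp add: infnorm_pos_lt)
  ultimately have "k \<ge> 1" by (cases k) auto
  then have "infnorm (x - y) \<ge> \<rho>" using k assms(3) mult_right_mono[of 1 "real k" \<rho>] by simp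
  then show ?thesis using assms by simp
qed

lemma layer1_iff:
  assumes "\<rho> > 0" "M \<subseteq> grid \<rho>"
  shows "x \<in> layer \<rho> 1 M \<longleftrightarrow> x \<in> grid \<rho> - M \<and> (\<exists>y\<in>layer0 \<rho> M. infnorm (x - y :: real^'n) \<le> \<rho>)"
proof -
  have "infnorm (x - y) \<ge> \<rho>" if "x \<in> grid \<rho> - M" "y \<in> layer0 \<rho> M" for y
    using grid_infnorm_eq_step[of x \<rho> y] that assms by (force simp: layer0_def)
  moreover have "layer0 \<rho> M \<subseteq> grid \<rho>" using assms by (auto simp: layer0_def)
  ultimately show ?thesis
    using linf_dist_grid_iff[of x \<rho> "layer0 \<rho> M" 1] assms(1)
    by (auto simp: layer_def intro: antisym)
qed

text \<open>A point of \<open>M\<close> within one mesh width of an outside grid point belongs to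
  \<open>layer0\<close> by definition, so proximity to \<open>M\<close> is as good as proximity to
  its boundary.\<close>

lemma layer1_iff':
  assumes "\<rho> > 0" "M \<subseteq> grid \<rho>"
  shows "x \<in> layer \<rho> 1 M \<longleftrightarrow> x \<in> grid \<rho> - M \<and> (\<exists>y\<in>M. infnorm (x - y :: real^'n) \<le> \<rho>)"
proof -
  have "y \<in> layer0 \<rho> M" if "x \<in> grid \<rho> - M" "y \<in> M" "infnorm (x - y) \<le> \<rho>" for y
    using that grid_infnorm_eq_step[of y \<rho> x] assms
    by (auto simp: layer0_def infnorm_sub intro!: bexI[of _ x])
  then show ?thesis using layer1_iff[OF assms] by (auto simp: layer0_def)
qed

lemma layer0_iff':
  assumes "\<rho> > 0" "M \<subseteq> grid \<rho>"
  shows "x \<in> layer0 \<rho> M \<longleftrightarrow> x \<in> M \<and> (\<exists>z\<in>grid \<rho> - M. infnorm (x - z :: real^'n) \<le> \<rho>)"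
  using grid_infnorm_eq_step[of x \<rho> _] assms unfolding layer0_def
  by (smt (verit) DiffD1 DiffD2 mem_Collect_eq subsetD)

text \<open>The symmetric difference of \<open>M\<close> and \<open>M'\<close> is closed under grid
  hops: if \<open>x\<close> lies in one set only and a neighbour lies in both or in neither, then
  \<open>x\<close> belongs to layer 1 of the set that misses it or to layer 0 of the set that
  contains it, and the equal layers of the other set contradict this. A nonempty symmetric
  difference is therefore the whole grid.\<close>

lemma tr_inj_aux:
  assumes \<rho>: "\<rho> > 0" and M: "M \<in> grid_sets \<rho>" "M' \<in> grid_sets \<rho>" and eq: "tr \<rho> M = tr \<rho> (M' :: (real^'n) set)"
  shows "M \<subseteq> M'"
proof -
  have sub: "M \<subseteq> grid \<rho>" "M' \<subseteq> grid \<rho>" "M \<noteq> {}" "M' \<noteq> {}" using M by (auto simp: grid_sets_def)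
  have l0: "layer0 \<rho> M = layer0 \<rho> M'" and l1: "layer \<rho> 1 M = layer \<rho> 1 M'"
    using eq by (auto simp: tr_def layer_def)
  have crossing: "y \<in> M - M' \<union> (M' - M)"
    if xy: "hop \<rho> (grid \<rho>) x y" and x: "x \<in> M - M' \<union> (M' - M)" for x y
  proof -
    have *: "y \<in> A - A' \<union> (A' - A)"
      if x: "x \<in> A - A'" and A: "A \<subseteq> grid \<rho>" "A' \<subseteq> grid \<rho>"
        and l0: "layer0 \<rho> A = layer0 \<rho> A'" and l1: "layer \<rho> 1 A = layer \<rho> 1 A'" for A A'
    proof (rule ccontr)
      assume "\<not> ?thesis"
      then consider "y \<in> A" "y \<in> A'" | "y \<notin> A" "y \<notin> A'" by blast
      then show False
      proof cases
        case 1
        then have "x \<in> layer \<rho> 1 A'"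
          using x xy A by (subst layer1_iff'[OF \<rho>]) (auto simp: hop_def)
        then show False using layer1_iff[OF \<rho> A(1), of x] x unfolding l1 by blast
      next
        case 2
        then have "x \<in> layer0 \<rho> A"
          using x xy A by (subst layer0_iff'[OF \<rho>]) (auto simp: hop_def)
        then show False using l0 x by (auto simp: layer0_def)
      qed
    qed
    show ?thesis using x *[OF _ sub(1,2) l0 l1] *[OF _ sub(2,1) l0[symmetric] l1[symmetric]] by blast
  qed
  show ?thesis
  proof (rule ccontr)
    assume "\<not> M \<subseteq> M'"
    then obtain x where x: "x \<in> M - M'" by blast
    have "y \<in> M - M' \<union> (M' - M)" if "y \<in> grid \<rho>" for y
    proof -
      have "(hop \<rho> (grid \<rho>))\<^sup>*\<^sup>* x y"
        using chain_connected_grid[OF \<rho>] that x sub by (auto simp: chain_connected_def)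
      then show ?thesis by (induction rule: rtranclp_induct) (use x crossing in blast)+
    qed
    \<comment> \<open>The sets are now complementary. The common layer 0 lies in both, so it is
      empty; a set without boundary cannot be left by hops, which makes \<open>M\<close> the whole
      grid and \<open>M'\<close> empty.\<close>
    then have disj: "M \<inter> M' = {}" using sub by blast
    then have "layer0 \<rho> M = {}" using l0 by (auto simp: layer0_def)
    moreover obtain z where "z \<in> M'" using sub by blast
    moreover have "(hop \<rho> (grid \<rho>))\<^sup>*\<^sup>* x z"
      using chain_connected_grid[OF \<rho>] \<open>z \<in> M'\<close> x sub by (auto simp: chain_connected_def)
    then have "z \<in> M \<or> layer0 \<rho> M \<noteq> {}"
    proof (induction rule: rtranclp_induct)
      case (step y z)
      then show ?case using layer0_iff'[OF \<rho> sub(1), of y] by (auto simp: hop_def)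
    qed (use x in auto)
    ultimately show False using disj by blast
  qed
qed

lemma inj_on_tr: "\<rho> > 0 \<Longrightarrow> inj_on (tr \<rho>) (grid_sets \<rho>)"
proof (rule inj_onI)
  fix M M' :: "(real^'n) set"
  assume *: "\<rho> > 0" "M \<in> grid_sets \<rho>" "M' \<in> grid_sets \<rho>" "tr \<rho> M = tr \<rho> M'"
  show "M = M'"
    using tr_inj_aux[OF *] tr_inj_aux[OF *(1,3,2) *(4)[symmetric]] by (rule subset_antisym)
qed

lemma tr_inv_tr: "\<rho> > 0 \<Longrightarrow> M \<in> grid_sets \<rho> \<Longrightarrow> tr_inv \<rho> (tr \<rho> M) = M"
  unfolding tr_inv_def by (rule inv_into_f_f[OF inj_on_tr])

lemma conn_grid_sets_grid_sets: "M \<in> conn_grid_sets \<rho> \<Longrightarrow> M \<in> grid_sets \<rho>"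
  by (simp add: conn_grid_sets_def)

lemma finite_layer:
  assumes "\<rho> > 0" "M \<subseteq> grid \<rho>" "finite (M :: (real^'n) set)"
  shows "finite (layer \<rho> j M)"
proof (cases "j > 0")
  case True
  have "layer \<rho> j M \<subseteq> linf_nbhd (real (nat j) * \<rho>) M \<inter> grid \<rho>"
  proof
    fix x assume "x \<in> layer \<rho> j M"
    then have x: "x \<in> grid \<rho> - M" "linf_dist x (layer0 \<rho> M) = ereal (real (nat j) * \<rho>)"
      using True by (auto simp: layer_def)
    moreover have "layer0 \<rho> M \<subseteq> grid \<rho>" "layer0 \<rho> M \<subseteq> M" using assms by (auto simp: layer0_def)
    ultimately show "x \<in> linf_nbhd (real (nat j) * \<rho>) M \<inter> grid \<rho>"
      using linf_dist_grid_iff[of x \<rho> "layer0 \<rho> M" "nat j"] assms(1)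
      by (auto simp: mem_linf_nbhd intro: eq_refl)
  qed
  moreover have "finite (linf_nbhd (real (nat j) * \<rho>) M \<inter> grid \<rho>)"
    using assms by (intro finite_grid_bounded bounded_linf_nbhd finite_imp_bounded)
  ultimately show ?thesis by (rule finite_subset)
next
  case False
  then have "layer \<rho> j M \<subseteq> M" by (auto simp: layer_def layer0_def)
  then show ?thesis using assms finite_subset by blast
qed

section \<open>Convex sets and their frontiers in the max norm\<close>

lemma compact_infnorm_cball: "compact {c :: real^'n. infnorm c \<le> r}"
proof -
  have "bounded (linf_nbhd r {0 :: real^'n})" by (rule bounded_linf_nbhd) simp
  moreover have "linf_nbhd r {0} = {c :: real^'n. infnorm c \<le> r}" by (auto simp: mem_linf_nbhd)
  moreover have "closed {c :: real^'n. infnorm c \<le> r}"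
    by (intro closed_Collect_le continuous_intros)
  ultimately show ?thesis by (simp add: compact_eq_bounded_closed)
qed

lemma infnorm_convex_comb:
  fixes a b :: "real^'n"
  assumes "infnorm a \<le> r" "infnorm b \<le> r" "0 \<le> t" "t \<le> 1"
  shows "infnorm ((1 - t) *\<^sub>R a + t *\<^sub>R b) \<le> r"
proof -
  have "infnorm ((1 - t) *\<^sub>R a + t *\<^sub>R b) \<le> (1 - t) * infnorm a + t * infnorm b"
    using infnorm_triangle[of "(1 - t) *\<^sub>R a" "t *\<^sub>R b"] assms(3,4) by (simp add: infnorm_mul)
  also have "\<dots> \<le> r" using assms by (intro convex_bound_le) auto
  finally show ?thesis .
qed

lemma convex_infnorm_cball: "convex {c :: real^'n. infnorm c \<le> r}"
  unfolding convex_alt by (auto intro!: infnorm_convex_comb)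

lemma linf_nbhd_eq_sums: "linf_nbhd r B = {b + c | b c. b \<in> B \<and> c \<in> {c. infnorm c \<le> r}}"
proof (intro equalityI subsetI)
  fix y assume "y \<in> linf_nbhd r B"
  then obtain x where "x \<in> B" "infnorm (y - x) \<le> r" by (auto simp: mem_linf_nbhd)
  then show "y \<in> {b + c | b c. b \<in> B \<and> c \<in> {c. infnorm c \<le> r}}"
    by (intro CollectI exI[of _ x] exI[of _ "y - x"]) simp
next
  fix y assume "y \<in> {b + c | b c. b \<in> B \<and> c \<in> {c. infnorm c \<le> r}}"
  then obtain b c where "y = b + c" "b \<in> B" "infnorm c \<le> r" by blast
  then show "y \<in> linf_nbhd r B" unfolding mem_linf_nbhd by (intro bexI[of _ b]) auto
qed

lemma compact_linf_nbhd: "compact B \<Longrightarrow> compact (linf_nbhd r B)"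
  using compact_sums[OF _ compact_infnorm_cball] by (simp add: linf_nbhd_eq_sums)

lemma convex_linf_nbhd: "convex B \<Longrightarrow> convex (linf_nbhd r B)"
proof -
  assume "convex B"
  moreover have "linf_nbhd r B = (\<Union>b\<in>B. \<Union>c\<in>{c. infnorm c \<le> r}. {b + c})"
    unfolding linf_nbhd_eq_sums by blast
  ultimately show ?thesis using convex_sums[OF _ convex_infnorm_cball] by simp
qed

text \<open>This is the cancellation law for Minkowski sums.\<close>

lemma cube_cancel:
  fixes x :: "real^'n"
  assumes sub: "linf_nbhd s {x} \<subseteq> linf_nbhd r B" and rs: "0 \<le> s" "s \<le> r"
    and B: "compact B" "convex B"
  shows "x \<in> linf_nbhd (r - s) B"
proof (rule ccontr)
  assume "\<not> ?thesis"
  then obtain u b where u: "u \<bullet> x < b" "\<And>y. y \<in> linf_nbhd (r - s) B \<Longrightarrow> u \<bullet> y > b"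
    using separating_hyperplane_closed_point[OF convex_linf_nbhd[OF B(2)]
        compact_imp_closed[OF compact_linf_nbhd[OF B(1)]]] by metis
  define v :: "real^'n" where "v = (\<chi> i. sgn (u $ i))"
  have v: "infnorm v \<le> 1" by (auto simp: infnorm_le_iff v_def sgn_real_def)
  \<comment> \<open>\<open>u \<bullet> v\<close> is the sum of the absolute entries of
    \<open>u\<close>, the norm dual to the max norm; thus \<open>v\<close> maximizes
    \<open>u\<close> over the unit cube, and the support functions of all cubes are known.\<close>
  have dual: "u \<bullet> c \<le> t * (u \<bullet> v)" if "infnorm c \<le> t" for c t
  proof -
    have "u \<bullet> c \<le> (\<Sum>i\<in>UNIV. \<bar>u $ i\<bar> * t)"
      unfolding inner_vec_def
    proof (intro sum_mono)
      fix i
      have "\<bar>c $ i\<bar> \<le> t" using that by (simp add: infnorm_le_iff)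
      then have "\<bar>u $ i\<bar> * \<bar>c $ i\<bar> \<le> \<bar>u $ i\<bar> * t" by (intro mult_left_mono) auto
      then show "u $ i \<bullet> c $ i \<le> \<bar>u $ i\<bar> * t"
        using abs_ge_self[of "u $ i * c $ i"] by (simp add: abs_mult)
    qed
    also have "\<dots> = t * (u \<bullet> v)"
      unfolding inner_vec_def v_def
      by (auto simp: sum_distrib_left mult.commute abs_sgn intro!: sum.cong)
    finally show ?thesis .
  qed
  have scaled: "infnorm (t *\<^sub>R v) \<le> t" if "t \<ge> 0" for t
    using mult_left_mono[OF v that] that by (simp add: infnorm_mul)
  have "x - s *\<^sub>R v \<in> linf_nbhd s {x}"
    using scaled[OF rs(1)] by (simp add: mem_linf_nbhd infnorm_neg)
  then have "x - s *\<^sub>R v \<in> linf_nbhd r B" using sub by blast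
  then obtain b0 where b0: "b0 \<in> B" "infnorm (x - s *\<^sub>R v - b0) \<le> r"
    by (auto simp: mem_linf_nbhd)
  have "b0 - (r - s) *\<^sub>R v \<in> linf_nbhd (r - s) B"
    using scaled[of "r - s"] rs b0(1) by (auto simp: mem_linf_nbhd infnorm_neg intro!: bexI[of _ b0])
  then have "u \<bullet> (b0 - (r - s) *\<^sub>R v) > b" using u(2) by blast
  moreover have "u \<bullet> (b0 - (x - s *\<^sub>R v)) \<le> r * (u \<bullet> v)"
    using b0(2) by (intro dual) (simp add: infnorm_sub)
  ultimately show False using u(1) by (simp add: inner_diff_right algebra_simps)
qed

lemma closed_segment_infnorm_add:
  assumes "p \<in> closed_segment a (b :: real^'n)"
  shows "infnorm (a - p) + infnorm (p - b) = infnorm (a - b)"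
proof -
  obtain t where t: "0 \<le> t" "t \<le> 1" "p = (1 - t) *\<^sub>R a + t *\<^sub>R b"
    using assms in_segment(1) by blast
  have "a - p = t *\<^sub>R (a - b)" "p - b = (1 - t) *\<^sub>R (a - b)"
    unfolding t(3) by (simp_all add: algebra_simps)
  then have "infnorm (a - p) = t * infnorm (a - b)" "infnorm (p - b) = (1 - t) * infnorm (a - b)"
    using t(1,2) by (simp_all add: infnorm_mul)
  then show ?thesis by (simp add: left_diff_distrib)
qed

lemma closed_segment_meets_frontier:
  fixes a y :: "'a :: euclidean_space"
  assumes "a \<in> B" "y \<notin> interior B"
  obtains p where "p \<in> frontier B" "p \<in> closed_segment a y"
proof (cases "y \<in> B")
  case True
  then have "y \<in> frontier B" using assms closure_subset by (auto simp: frontier_def)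
  then show ?thesis using that by blast
next
  case False
  then have "closed_segment a y \<inter> frontier B \<noteq> {}"
    using assms by (intro connected_Int_frontier) auto
  then show ?thesis using that by blast
qed

lemma linf_nbhd_frontier_outside:
  assumes "x \<in> linf_nbhd r A" "x \<notin> interior A"
  shows "x \<in> linf_nbhd r (frontier A)"
proof -
  obtain a where a: "a \<in> A" "infnorm (x - a) \<le> r" using assms(1) by (auto simp: mem_linf_nbhd)
  obtain p where p: "p \<in> frontier A" "p \<in> closed_segment a x"
    using closed_segment_meets_frontier a(1) assms(2) by metis
  then show ?thesis
    using closed_segment_infnorm_add[OF p(2)] a(2) infnorm_pos_le[of "a - p"]
    by (auto simp: mem_linf_nbhd infnorm_sub intro!: bexI[of _ p])
qed

lemma linf_nbhd_frontier_inside: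
  assumes "x \<in> A" "y \<notin> interior A" "infnorm (x - y :: real^'n) \<le> r"
  shows "x \<in> linf_nbhd r (frontier A)"
proof -
  obtain p where p: "p \<in> frontier A" "p \<in> closed_segment x y"
    using closed_segment_meets_frontier assms(1,2) by metis
  then show ?thesis
    using closed_segment_infnorm_add[OF p(2)] assms(3) infnorm_pos_le[of "p - y"]
    by (auto simp: mem_linf_nbhd intro!: bexI[of _ p])
qed

text \<open>If a frontier point \<open>a\<close> of \<open>A\<close> had the whole cube of radius
  \<open>r\<close> around it in the interior of \<open>B\<close>, then so would all points near
  \<open>a\<close>. These cubes lie in the \<open>r\<close>-neighbourhood of \<open>A\<close>, and
  cancelling the cube puts a ball around \<open>a\<close> into \<open>A\<close>. Applied in both
  directions, taking frontiers of compact convex sets does not increase the Hausdorff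
  distance.\<close>

lemma frontier_subset_linf_nbhd_frontier:
  fixes A B :: "(real^'n) set"
  assumes A: "compact A" "convex A" and B: "compact B"
    and AB: "A \<subseteq> linf_nbhd r B" and BA: "B \<subseteq> linf_nbhd r A" and r: "r \<ge> 0"
  shows "frontier A \<subseteq> linf_nbhd r (frontier B)"
proof
  fix a assume a: "a \<in> frontier A"
  then have aA: "a \<in> A" using A(1) compact_imp_closed frontier_subset_closed by blast
  show "a \<in> linf_nbhd r (frontier B)"
  proof (cases "a \<in> interior B")
    case False
    then show ?thesis using linf_nbhd_frontier_outside AB aA by blast
  next
    case True
    have "\<not> linf_nbhd r {a} \<subseteq> interior B"
    proof
      assume sub: "linf_nbhd r {a} \<subseteq> interior B"
      obtain e where e: "e > 0" "(\<Union>x\<in>linf_nbhd r {a}. ball x e) \<subseteq> interior B"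
        using compact_subset_open_imp_ball_epsilon_subset[OF compact_linf_nbhd open_interior sub] by auto
      have "ball a e \<subseteq> A"
      proof
        fix a' assume a': "a' \<in> ball a e"
        have "linf_nbhd r {a'} \<subseteq> linf_nbhd r A"
        proof
          fix y assume y: "y \<in> linf_nbhd r {a'}"
          then have "y - a' + a \<in> linf_nbhd r {a}" by (simp add: mem_linf_nbhd)
          moreover have "y \<in> ball (y - a' + a) e" using a' by (simp add: dist_norm norm_minus_commute)
          ultimately have "y \<in> B" using e(2) interior_subset by blast
          then show "y \<in> linf_nbhd r A" using BA by blast
        qed
        then have "a' \<in> linf_nbhd (r - r) A" using A r by (intro cube_cancel) auto
        then obtain x where "x \<in> A" "infnorm (a' - x) \<le> 0" by (auto simp: mem_linf_nbhd)
        then show "a' \<in> A" using infnorm_eq_0[of "a' - x"] infnorm_pos_le[of "a' - x"] by auto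
      qed
      then have "a \<in> interior A" using e(1) by (meson mem_interior)
      then show False using a by (simp add: frontier_def)
    qed
    then obtain y where "y \<notin> interior B" "y \<in> linf_nbhd r {a}" by blast
    then have "y \<notin> interior B" "infnorm (a - y) \<le> r" by (simp_all add: mem_linf_nbhd infnorm_sub)
    then show ?thesis using linf_nbhd_frontier_inside True interior_subset by blast
  qed
qed

section \<open>Euler maps\<close>

locale euler_map =
  fixes F :: "real^'n \<Rightarrow> (real^'n) set" and L h :: real
  assumes F: "F x \<noteq> {} \<and> compact (F x) \<and> convex (F x)"
    and F_hausdist: "linf_hausdist (F x) (F y) \<le> ereal (L * infnorm (x - y))"
    and L_pos: "L > 0" and h_pos: "h > 0" and Lh: "L * h \<le> 1 / 4"
begin

lemma Lh_pos: "0 < L * h"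
  using L_pos h_pos by simp

text \<open>The Hausdorff distance controls only an infimum; compactness of \<open>F y\<close>
  provides a point that attains it, so the constant is not weakened.\<close>

lemma F_lipschitz:
  assumes "f \<in> F x"
  obtains g where "g \<in> F y" "infnorm (f - g) \<le> L * infnorm (x - y)"
proof -
  have "continuous_on (F y) (\<lambda>g. infnorm (f - g))" by (intro continuous_intros)
  then obtain g where g: "g \<in> F y" "\<And>g'. g' \<in> F y \<Longrightarrow> infnorm (f - g) \<le> infnorm (f - g')"
    using F[of y] continuous_attains_inf[of "F y" "\<lambda>g. infnorm (f - g)"] by blast
  have "ereal (infnorm (f - g)) \<le> linf_dist f (F y)"
    unfolding linf_dist_def using g(2) by (intro INF_greatest) simp
  also have "\<dots> \<le> (SUP a\<in>F x. linf_dist a (F y))" using assms by (intro SUP_upper)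
  also have "\<dots> \<le> linf_hausdist (F x) (F y)" unfolding linf_hausdist_def by simp
  also have "\<dots> \<le> ereal (L * infnorm (x - y))" by (rule F_hausdist)
  finally show ?thesis using that g(1) by simp
qed

abbreviation \<phi> :: "real^'n \<Rightarrow> (real^'n) set" where "\<phi> \<equiv> euler F h"

lemma euler_eq: "\<phi> x = (+) x ` ((*\<^sub>R) h ` F x)"
  unfolding euler_def by (auto simp: image_image)

lemma compact_euler: "compact (\<phi> x)"
  unfolding euler_eq using F[of x] by (intro compact_translation compact_scaling) auto

lemma convex_euler: "convex (\<phi> x)"
  unfolding euler_eq using F[of x] by (intro convex_translation convex_scaling) auto

lemma euler_nonempty: "\<phi> x \<noteq> {}"
  unfolding euler_def using F[of x] by auto

lemma frontier_euler_subset: "frontier (\<phi> x) \<subseteq> \<phi> x"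
  by (intro frontier_subset_closed compact_imp_closed compact_euler)

lemma frontier_euler_nonempty: "frontier (\<phi> x) \<noteq> {}"
  using compact_euler[of x] euler_nonempty[of x] frontier_eq_empty not_compact_UNIV by metis

lemma euler_lipschitz: "\<phi> x \<subseteq> linf_nbhd ((1 + L * h) * infnorm (x - y)) (\<phi> y)"
proof
  fix p assume "p \<in> \<phi> x"
  then obtain f where f: "f \<in> F x" "p = x + h *\<^sub>R f" by (auto simp: euler_def)
  obtain g where g: "g \<in> F y" "infnorm (f - g) \<le> L * infnorm (x - y)" using F_lipschitz f(1) .
  have "infnorm (p - (y + h *\<^sub>R g)) = infnorm ((x - y) + h *\<^sub>R (f - g))"
    by (simp add: f(2) algebra_simps)
  also have "\<dots> \<le> infnorm (x - y) + h * infnorm (f - g)"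
    using infnorm_triangle[of "x - y" "h *\<^sub>R (f - g)"] h_pos by (simp add: infnorm_mul)
  also have "\<dots> \<le> infnorm (x - y) + h * (L * infnorm (x - y))"
    using g(2) h_pos by (intro add_left_mono mult_left_mono) auto
  finally show "p \<in> linf_nbhd ((1 + L * h) * infnorm (x - y)) (\<phi> y)"
    using g(1) by (auto simp: mem_linf_nbhd euler_def algebra_simps intro!: bexI[of _ g])
qed

lemma euler_near:
  assumes "infnorm (x - y) \<le> r"
  shows "\<phi> x \<subseteq> linf_nbhd ((1 + L * h) * r) (\<phi> y)"
  by (rule subset_trans[OF euler_lipschitz[of x y] linf_nbhd_mono])
    (use assms Lh_pos in \<open>auto intro!: mult_left_mono\<close>)

lemma linf_nbhd_euler_near:
  assumes "q \<in> linf_nbhd s (\<phi> x)" "infnorm (x - y) \<le> r"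
  shows "q \<in> linf_nbhd (s + (1 + L * h) * r) (\<phi> y)"
  using linf_nbhd_linf_nbhd[OF assms(1) euler_near[OF assms(2)]] .

lemma frontier_euler_near:
  assumes "infnorm (x - y) \<le> r"
  shows "frontier (\<phi> x) \<subseteq> linf_nbhd ((1 + L * h) * r) (frontier (\<phi> y))"
  using euler_near[OF assms] euler_near[of y x r] assms compact_euler convex_euler Lh_pos
    infnorm_pos_le[of "x - y"]
  by (intro frontier_subset_linf_nbhd_frontier mult_nonneg_nonneg) (auto simp: infnorm_sub)

text \<open>Lipschitz continuity moves the second components into the fixed closed set
  \<open>\<phi> (fst l)\<close> at vanishing cost. Closedness is needed for the compact set on which
  \<open>euler_preimage\<close> minimizes.\<close>

lemma closed_euler_graph: "closed {z. snd z \<in> \<phi> (fst z)}"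
  unfolding closed_sequential_limits
proof (intro allI impI, elim conjE)
  fix z :: "nat \<Rightarrow> (real^'n) \<times> (real^'n)" and l
  assume z: "\<forall>n. z n \<in> {z. snd z \<in> \<phi> (fst z)}" and lim: "z \<longlonglongrightarrow> l"
  have fs: "(\<lambda>n. fst (z n)) \<longlonglongrightarrow> fst l" "(\<lambda>n. snd (z n)) \<longlonglongrightarrow> snd l"
    using lim by (rule tendsto_fst, rule tendsto_snd)
  have "\<exists>q\<in>\<phi> (fst l). infnorm (snd (z n) - q) \<le> (1 + L * h) * infnorm (fst (z n) - fst l)" for n
    using subsetD[OF euler_lipschitz, of "snd (z n)" "fst (z n)" "fst l"] z
    by (simp add: mem_linf_nbhd)
  then obtain q where q: "\<And>n. q n \<in> \<phi> (fst l)"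
    "\<And>n. infnorm (snd (z n) - q n) \<le> (1 + L * h) * infnorm (fst (z n) - fst l)" by metis
  let ?C = "sqrt DIM(real^'n) * (1 + L * h)"
  have "norm (snd (z n) - q n) \<le> ?C * norm (fst (z n) - fst l)" for n
  proof -
    have "norm (snd (z n) - q n) \<le> sqrt DIM(real^'n) * infnorm (snd (z n) - q n)"
      by (rule norm_le_infnorm)
    also have "\<dots> \<le> sqrt DIM(real^'n) * ((1 + L * h) * norm (fst (z n) - fst l))"
      using order_trans[OF q(2)[of n] mult_left_mono[OF infnorm_le_norm]] Lh_pos
      by (intro mult_left_mono) auto
    finally show ?thesis by (simp add: mult.assoc)
  qed
  then have bound: "\<forall>n. norm (snd (z n) - q n) \<le> ?C * norm (fst (z n) - fst l)" by blast
  have "(\<lambda>n. ?C * norm (fst (z n) - fst l)) \<longlonglongrightarrow> 0"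
    by (rule tendsto_mult_right_zero[OF tendsto_norm_zero[OF LIM_zero[OF fs(1)]]])
  then have "(\<lambda>n. snd (z n) - q n) \<longlonglongrightarrow> 0"
    by (rule Lim_null_comparison[OF always_eventually[OF bound]])
  then have "(\<lambda>n. snd (z n) - (snd (z n) - q n)) \<longlonglongrightarrow> snd l - 0"
    by (rule tendsto_diff[OF fs(2)])
  then have "q \<longlonglongrightarrow> snd l" by simp
  then have "snd l \<in> \<phi> (fst l)"
    using closed_sequentially[OF compact_imp_closed[OF compact_euler]] q(1) by blast
  then show "l \<in> {z. snd z \<in> \<phi> (fst z)}" by simp
qed

text \<open>Nadler's fixed point theorem for the contraction sending \<open>w\<close> to \<open>x - h F(w)\<close>. Instead of
  iterating, minimize the residual over a compact set that is stable under one iteration step.\<close>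

lemma euler_preimage:
  assumes "x \<in> linf_nbhd r (\<phi> y)"
  obtains w where "x \<in> \<phi> w" "(1 - L * h) * infnorm (w - y) \<le> r"
proof -
  \<comment> \<open>An iteration step moves \<open>w\<close> by the residual
    \<open>infnorm (x - p)\<close> and multiplies the residual by at most \<open>L * h\<close>. With
    the weight \<open>1 - L * h\<close> on the distance to \<open>y\<close>, the sum does not
    increase, so \<open>K\<close> is preserved.\<close>
  define K where "K = {z. snd z \<in> \<phi> (fst z)} \<inter>
    {z. infnorm (x - snd z) + (1 - L * h) * infnorm (fst z - y) \<le> r}"
  have "closed {z. infnorm (x - snd z) + (1 - L * h) * infnorm (fst z - y) \<le> r}"
    by (intro closed_Collect_le continuous_on_add continuous_on_infnorm continuous_on_diff
        continuous_on_mult continuous_on_const continuous_on_fst continuous_on_snd continuous_on_id)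
  then have "closed K" unfolding K_def by (intro closed_Int closed_euler_graph)
  moreover have "bounded K"
  proof -
    have "K \<subseteq> linf_nbhd (2 * r) {y} \<times> linf_nbhd r {x}"
    proof
      fix z assume "z \<in> K"
      then have z: "infnorm (x - snd z) + (1 - L * h) * infnorm (fst z - y) \<le> r"
        by (simp add: K_def)
      moreover have "1 / 2 * infnorm (fst z - y) \<le> (1 - L * h) * infnorm (fst z - y)"
        using Lh by (intro mult_right_mono infnorm_pos_le) auto
      moreover have "infnorm (x - snd z) \<ge> 0" "infnorm (fst z - y) \<ge> 0" by (rule infnorm_pos_le)+
      ultimately have "infnorm (x - snd z) \<le> r" "infnorm (fst z - y) \<le> 2 * r" by linarith+
      then show "z \<in> linf_nbhd (2 * r) {y} \<times> linf_nbhd r {x}"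
        by (auto simp: mem_linf_nbhd infnorm_sub mem_Times_iff)
    qed
    then show ?thesis
      by (rule bounded_subset[rotated]) (intro bounded_Times bounded_linf_nbhd bounded_insert[THEN iffD2] bounded_empty)
  qed
  moreover obtain p0 where "p0 \<in> \<phi> y" "infnorm (x - p0) \<le> r" using assms by (auto simp: mem_linf_nbhd)
  then have "(y, p0) \<in> K" by (simp add: K_def infnorm_0)
  moreover have "continuous_on K (\<lambda>z. infnorm (x - snd z))" by (intro continuous_intros)
  ultimately obtain z where z: "z \<in> K" "\<And>z'. z' \<in> K \<Longrightarrow> infnorm (x - snd z) \<le> infnorm (x - snd z')"
    using continuous_attains_inf[of K "\<lambda>z. infnorm (x - snd z)"]
    unfolding compact_eq_bounded_closed by blast
  obtain w p where wp: "z = (w, p)" by (cases z)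
  have p: "p \<in> \<phi> w" "infnorm (x - p) + (1 - L * h) * infnorm (w - y) \<le> r"
    using z(1) by (auto simp: K_def wp)
  then obtain f where f: "f \<in> F w" "p = w + h *\<^sub>R f" by (auto simp: euler_def)
  \<comment> \<open>Since \<open>p = w + h *\<^sub>R f\<close>, this is
    \<open>x - h *\<^sub>R f\<close>, a value of the contraction at \<open>w\<close>.\<close>
  define w1 where "w1 = w + (x - p)"
  obtain g where g: "g \<in> F w1" "infnorm (f - g) \<le> L * infnorm (w - w1)" using F_lipschitz f(1) .
  define p1 where "p1 = w1 + h *\<^sub>R g"
  have step: "infnorm (w1 - w) = infnorm (x - p)" by (simp add: w1_def)
  have "x - p1 = h *\<^sub>R (f - g)" by (simp add: p1_def w1_def f(2) algebra_simps)
  then have "infnorm (x - p1) = h * infnorm (f - g)" using h_pos by (simp add: infnorm_mul)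
  also have "\<dots> \<le> h * (L * infnorm (w - w1))" using g(2) h_pos by (intro mult_left_mono) auto
  finally have res: "infnorm (x - p1) \<le> L * h * infnorm (x - p)"
    using step by (simp add: infnorm_sub mult_ac)
  have "(1 - L * h) * infnorm (w1 - y) \<le> (1 - L * h) * (infnorm (w1 - w) + infnorm (w - y))"
    using Lh by (intro mult_left_mono infnorm_triangle_diff) auto
  then have "infnorm (x - p1) + (1 - L * h) * infnorm (w1 - y) \<le> r"
    using res p(2) step by (simp add: algebra_simps)
  then have "(w1, p1) \<in> K" using g(1) by (auto simp: K_def p1_def euler_def)
  then have "infnorm (x - p) \<le> L * h * infnorm (x - p)" using z(2) res by (fastforce simp: wp)
  also have "\<dots> \<le> 1 / 4 * infnorm (x - p)" using Lh by (intro mult_right_mono infnorm_pos_le) auto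
  finally have "infnorm (x - p) = 0" using infnorm_pos_le[of "x - p"] by linarith
  then have "x = p" by (simp add: infnorm_eq_0)
  then show ?thesis using that[of w] p infnorm_pos_le[of "x - p"] by (simp add: infnorm_0)
qed

section \<open>Connectedness of preimages under the Euler map\<close>

text \<open>The contraction whose fixed points are exactly the \<open>w\<close> with
  \<open>x \<in> \<phi> w\<close>. The set \<open>approx_preimage x r\<close> consists of its fixed
  points up to an error of \<open>r\<close>.\<close>

definition inv_euler :: "real^'n \<Rightarrow> real^'n \<Rightarrow> (real^'n) set" where
  "inv_euler x w = (\<lambda>f. x - h *\<^sub>R f) ` F w"

definition approx_preimage :: "real^'n \<Rightarrow> real \<Rightarrow> (real^'n) set" where
  "approx_preimage x r = {w. x \<in> linf_nbhd r (\<phi> w)}"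

lemma approx_preimage_iff: "w \<in> approx_preimage x r \<longleftrightarrow> (\<exists>b\<in>inv_euler x w. infnorm (b - w) \<le> r)"
proof -
  have "x - (w + h *\<^sub>R f) = x - h *\<^sub>R f - w" for f by simp
  then show ?thesis
    by (simp only: approx_preimage_def inv_euler_def euler_def mem_linf_nbhd mem_Collect_eq bex_simps)
qed

lemma inv_euler_lipschitz:
  assumes "b \<in> inv_euler x w"
  obtains c where "c \<in> inv_euler x w'" "infnorm (b - c) \<le> L * h * infnorm (w - w')"
proof -
  obtain f where f: "f \<in> F w" "b = x - h *\<^sub>R f" using assms by (auto simp: inv_euler_def)
  obtain g where g: "g \<in> F w'" "infnorm (f - g) \<le> L * infnorm (w - w')" using F_lipschitz f(1) .
  have "b - (x - h *\<^sub>R g) = (- h) *\<^sub>R (f - g)" by (simp add: f(2) algebra_simps)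
  then have "infnorm (b - (x - h *\<^sub>R g)) = h * infnorm (f - g)"
    using h_pos infnorm_mul[of "- h" "f - g"] by simp
  also have "\<dots> \<le> h * (L * infnorm (w - w'))" using g(2) h_pos by (intro mult_left_mono) auto
  finally have "infnorm (b - (x - h *\<^sub>R g)) \<le> L * h * infnorm (w - w')" by (simp add: mult_ac)
  moreover have "x - h *\<^sub>R g \<in> inv_euler x w'" using g(1) by (auto simp: inv_euler_def)
  ultimately show ?thesis using that by blast
qed

lemma convex_inv_euler: "convex (inv_euler x w)"
proof -
  have "inv_euler x w = (+) x ` ((*\<^sub>R) (- h) ` F w)" by (auto simp: inv_euler_def image_image)
  then show ?thesis using F[of w] by (simp only: convex_translation convex_scaling)
qed

text \<open>The point \<open>b'\<close> is moved to a value \<open>d\<close> at \<open>a\<close> at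
  a cost of \<open>r / 8\<close>. By convexity the point \<open>e\<close> of the segment from
  \<open>b\<close> to \<open>d\<close> that corresponds to \<open>c\<close> is a value at
  \<open>a\<close>. Since \<open>c\<close> is within \<open>3 * r / 2\<close> of \<open>a\<close>,
  some value at \<open>c\<close> is within \<open>3 * r / 8\<close> of \<open>e\<close>. The total
  \<open>r / 8 + 3 * r / 8 = r / 2\<close> is where the bound \<open>L * h \<le> 1 / 4\<close>
  enters.\<close>

lemma segment_approx_preimage:
  assumes a: "infnorm (a - a') \<le> r / 2"
    and b: "b \<in> inv_euler x a" "infnorm (b - a) \<le> r" and b': "b' \<in> inv_euler x a'" "infnorm (b' - a') \<le> r"
    and c: "c \<in> closed_segment b b'"
  shows "c \<in> approx_preimage x (r / 2)"
proof -
  obtain t where t: "0 \<le> t" "t \<le> 1" "c = (1 - t) *\<^sub>R b + t *\<^sub>R b'"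
    using c in_segment(1) by blast
  obtain d where d: "d \<in> inv_euler x a" "infnorm (b' - d) \<le> L * h * infnorm (a' - a)"
    using inv_euler_lipschitz b'(1) .
  define e where "e = (1 - t) *\<^sub>R b + t *\<^sub>R d"
  have "e \<in> inv_euler x a"
    using convex_inv_euler[of x a] b(1) d(1) t unfolding e_def convex_alt by blast
  then obtain k where k: "k \<in> inv_euler x c" "infnorm (e - k) \<le> L * h * infnorm (a - c)"
    using inv_euler_lipschitz by metis
  have r: "r \<ge> 0" using b(2) infnorm_pos_le[of "b - a"] by linarith
  have "infnorm (b' - a) \<le> 3 * r / 2"
    using infnorm_triangle_diff[of b' a a'] a b'(2) infnorm_sub[of a a'] by linarith
  then have "infnorm ((1 - t) *\<^sub>R (b - a) + t *\<^sub>R (b' - a)) \<le> 3 * r / 2"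
    using b(2) r t by (intro infnorm_convex_comb) auto
  moreover have "c - a = (1 - t) *\<^sub>R (b - a) + t *\<^sub>R (b' - a)"
    by (simp add: t(3) algebra_simps)
  ultimately have ca: "infnorm (a - c) \<le> 3 * r / 2" by (simp only: infnorm_sub[of a c])
  have le: "L * h * s \<le> 1 / 4 * s" if "s \<ge> 0" for s using Lh that by (intro mult_right_mono) auto
  have "infnorm (b' - d) \<le> r / 8"
    using d(2) le[of "infnorm (a' - a)"] a infnorm_sub[of a a'] infnorm_pos_le[of "a' - a"] by linarith
  moreover have "e - c = t *\<^sub>R (d - b')" by (simp add: e_def t(3) algebra_simps)
  then have "infnorm (e - c) = t * infnorm (d - b')" using t by (simp add: infnorm_mul)
  then have "infnorm (e - c) \<le> infnorm (b' - d)"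
    using t infnorm_pos_le[of "d - b'"] mult_right_mono[of t 1 "infnorm (d - b')"]
      infnorm_sub[of d b'] by simp
  moreover have "infnorm (e - k) \<le> 3 * r / 8"
    using k(2) le[of "infnorm (a - c)"] ca infnorm_pos_le[of "a - c"] by linarith
  ultimately have "infnorm (k - c) \<le> r / 2"
    using infnorm_triangle_diff[of k c e] infnorm_sub[of k e] by linarith
  then show ?thesis using k(1) by (auto simp: approx_preimage_iff)
qed

text \<open>Hop sizes and tolerance are independent: halving the tolerance \<open>r\<close> starts
  from hops of size \<open>r / 2\<close> and must again deliver arbitrarily small hops for the next
  round.\<close>

definition chain_linked :: "real^'n \<Rightarrow> real \<Rightarrow> real^'n \<Rightarrow> real^'n \<Rightarrow> bool" where
  "chain_linked x r u v \<longleftrightarrow> (\<forall>\<epsilon>>0. (hop \<epsilon> (approx_preimage x r))\<^sup>*\<^sup>* u v)"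

lemma chain_linked_segment:
  assumes "closed_segment u v \<subseteq> approx_preimage x r"
  shows "chain_linked x r u v"
  unfolding chain_linked_def
proof (intro allI impI)
  fix \<epsilon> :: real assume "\<epsilon> > 0"
  then have "(hop \<epsilon> (closed_segment u v))\<^sup>*\<^sup>* u v"
    using connected_imp_chain_connected[of "closed_segment u v" \<epsilon>] by (auto simp: chain_connected_def)
  then show "(hop \<epsilon> (approx_preimage x r))\<^sup>*\<^sup>* u v" using assms by (rule hop_mono) simp
qed

lemma chain_linked_trans: "chain_linked x r u v \<Longrightarrow> chain_linked x r v w \<Longrightarrow> chain_linked x r u w"
  unfolding chain_linked_def by (meson rtranclp_trans)

text \<open>Every chain point is replaced by a value of the contraction within \<open>r\<close> of
  it, and consecutive replacements are joined by segments. The ends \<open>u\<close> and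
  \<open>v\<close> are exact fixed points and may replace themselves, so they remain the ends of the
  chain.\<close>

lemma chain_linked_halve:
  assumes uv: "x \<in> \<phi> u" "x \<in> \<phi> v" and r: "r > 0" and linked: "chain_linked x r u v"
  shows "chain_linked x (r / 2) u v"
proof -
  have fixed: "w \<in> inv_euler x w" if "x \<in> \<phi> w" for w
    using that by (auto simp: inv_euler_def euler_def)
  have seg: "chain_linked x (r / 2) b b'"
    if "infnorm (a - a') \<le> r / 2" "b \<in> inv_euler x a" "infnorm (b - a) \<le> r"
      "b' \<in> inv_euler x a'" "infnorm (b' - a') \<le> r" for a a' b b'
    using segment_approx_preimage[OF that] by (intro chain_linked_segment) blast
  have "(hop (r / 2) (approx_preimage x r))\<^sup>*\<^sup>* u v"
    using linked r by (simp add: chain_linked_def)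
  then have "\<forall>b\<in>inv_euler x v. infnorm (b - v) \<le> r \<longrightarrow> chain_linked x (r / 2) u b"
  proof (induction rule: rtranclp_induct)
    case base
    then show ?case using seg[of u u u] fixed[OF uv(1)] r by (auto simp: infnorm_0)
  next
    case (step y z)
    then have yz: "y \<in> approx_preimage x r" "infnorm (y - z) \<le> r / 2" by (auto simp: hop_def)
    then obtain b where b: "b \<in> inv_euler x y" "infnorm (b - y) \<le> r"
      by (auto simp: approx_preimage_iff)
    then have "chain_linked x (r / 2) u b" using step.IH by blast
    then show ?case using seg[OF yz(2) b] chain_linked_trans by blast
  qed
  then show ?thesis using fixed[OF uv(2)] r by (auto simp: infnorm_0)
qed

text \<open>The straight segment is a chain for a large tolerance, because \<phi> is Lipschitz. The
  summand 1 keeps the tolerance positive for \<open>u = v\<close>, as the halving requires.\<close>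

lemma chain_linked_start:
  assumes "x \<in> \<phi> u"
  shows "chain_linked x (2 * infnorm (u - v) + 1) u v"
proof (intro chain_linked_segment subsetI)
  fix c assume "c \<in> closed_segment u v"
  then have c: "infnorm (u - c) \<le> infnorm (u - v)"
    using closed_segment_infnorm_add[of c u v] infnorm_pos_le[of "c - v"] by simp
  have "x \<in> linf_nbhd (0 + (1 + L * h) * infnorm (u - v)) (\<phi> c)"
    using c assms by (intro linf_nbhd_euler_near[of x 0 u c]) (auto simp: mem_linf_nbhd infnorm_0 intro!: bexI[of _ x])
  moreover have "0 + (1 + L * h) * infnorm (u - v) \<le> 2 * infnorm (u - v) + 1"
    using mult_right_mono[OF Lh infnorm_pos_le[of "u - v"]] infnorm_pos_le[of "u - v"]
    by (simp add: distrib_right)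
  ultimately show "c \<in> approx_preimage x (2 * infnorm (u - v) + 1)"
    unfolding approx_preimage_def using linf_nbhd_mono[OF subset_refl] by blast
qed

lemma chain_linked_all:
  assumes "x \<in> \<phi> u" "x \<in> \<phi> v" "\<delta> > 0"
  shows "\<exists>r\<le>\<delta>. chain_linked x r u v"
proof -
  define R where "R = 2 * infnorm (u - v) + 1"
  have R: "R > 0" using infnorm_pos_le[of "u - v"] by (simp add: R_def)
  have "chain_linked x (R / 2 ^ k) u v" for k
  proof (induction k)
    case 0 then show ?case using chain_linked_start[OF assms(1)] by (simp add: R_def)
  next
    case (Suc k)
    then have "chain_linked x (R / 2 ^ k / 2) u v"
      using R assms by (intro chain_linked_halve) auto
    then show ?case by (simp add: mult.commute)
  qed
  moreover obtain k where "R / \<delta> < 2 ^ k" using real_arch_pow[of 2 "R / \<delta>"] by auto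
  then have "R / 2 ^ k \<le> \<delta>" using assms(3) by (simp add: field_simps)
  ultimately show ?thesis by blast
qed

text \<open>The factor is \<open>1 / (1 - 1 / 4)\<close>, an upper bound for
  \<open>1 / (1 - L * h)\<close>.\<close>

lemma approx_preimage_near:
  assumes "w \<in> approx_preimage x r"
  obtains w' where "x \<in> \<phi> w'" "infnorm (w' - w) \<le> 4 / 3 * r"
proof -
  obtain w' where w': "x \<in> \<phi> w'" "(1 - L * h) * infnorm (w' - w) \<le> r"
    using assms euler_preimage unfolding approx_preimage_def by blast
  have "3 / 4 * infnorm (w' - w) \<le> (1 - L * h) * infnorm (w' - w)"
    using Lh by (intro mult_right_mono infnorm_pos_le) auto
  then show ?thesis using that w' by simp
qed

text \<open>The reason for the choice of \<open>alpha\<close>: rounding an exact preimage to the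
  grid moves it by at most \<open>\<rho> / 2\<close>, hence its image by at most
  \<open>(1 + L * h) * (\<rho> / 2)\<close>.\<close>

lemma grid_preimage:
  assumes "infnorm (g - w) \<le> \<rho> / 2" "x \<in> \<phi> w"
  shows "x \<in> linf_nbhd (alpha L h \<rho>) (\<phi> g)"
proof -
  have "x \<in> linf_nbhd 0 (\<phi> w)"
    using assms(2) by (auto simp: mem_linf_nbhd infnorm_0 intro!: bexI[of _ x])
  moreover have "infnorm (w - g) \<le> \<rho> / 2" using assms(1) by (simp only: infnorm_sub[of w g])
  ultimately have "x \<in> linf_nbhd (0 + (1 + L * h) * (\<rho> / 2)) (\<phi> g)" by (rule linf_nbhd_euler_near)
  then show ?thesis by (simp add: alpha_def)
qed

lemma alpha_bounds:
  assumes "\<rho> > 0"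
  shows "\<rho> / 2 \<le> alpha L h \<rho>" "alpha L h \<rho> \<le> 5 / 8 * \<rho>"
proof -
  have "1 * (\<rho> / 2) \<le> (1 + L * h) * (\<rho> / 2)" "(1 + L * h) * (\<rho> / 2) \<le> (5 / 4) * (\<rho> / 2)"
    using Lh Lh_pos assms by (intro mult_right_mono; simp)+
  then show "\<rho> / 2 \<le> alpha L h \<rho>" "alpha L h \<rho> \<le> 5 / 8 * \<rho>" by (simp_all add: alpha_def)
qed

definition grid_preimages :: "real \<Rightarrow> real^'n \<Rightarrow> (real^'n) set" where
  "grid_preimages \<rho> x = {w \<in> grid \<rho>. x \<in> linf_nbhd (alpha L h \<rho>) (\<phi> w)}"

text \<open>Both points are first replaced by grid roundings of exact preimages \<open>u\<close> and
  \<open>v\<close>. A chain of approximate preimages from \<open>u\<close> to \<open>v\<close> is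
  then rounded point by point. All grid points met consecutively are less than
  \<open>2 * \<rho>\<close> apart, and on the grid this means a single hop.\<close>

lemma chain_connected_grid_preimages:
  assumes \<rho>: "\<rho> > 0"
  shows "chain_connected \<rho> (grid_preimages \<rho> x)"
  unfolding chain_connected_def
proof (intro ballI)
  let ?G = "grid_preimages \<rho> x"
  fix y z assume yz: "y \<in> ?G" "z \<in> ?G"
  have hopI: "(hop \<rho> ?G)\<^sup>*\<^sup>* a b" if "a \<in> ?G" "b \<in> ?G" "infnorm (a - b) < 2 * \<rho>" for a b
    using that grid_infnorm_less[of a \<rho> b 1] \<rho>
    by (intro r_into_rtranclp[of "hop \<rho> ?G"]) (auto simp: hop_def grid_preimages_def)
  have rounded: "\<exists>w g. x \<in> \<phi> w \<and> g \<in> ?G \<and> infnorm (g - w) \<le> \<rho> / 2 \<and> (hop \<rho> ?G)\<^sup>*\<^sup>* a g" if "a \<in> ?G" for a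
  proof -
    have "a \<in> approx_preimage x (alpha L h \<rho>)"
      using that by (simp add: grid_preimages_def approx_preimage_def)
    then obtain w where w: "x \<in> \<phi> w" "infnorm (w - a) \<le> 4 / 3 * alpha L h \<rho>" by (rule approx_preimage_near)
    obtain g where g: "g \<in> grid \<rho>" "infnorm (g - w) \<le> \<rho> / 2" using nearest_grid_point[OF \<rho>] .
    have "g \<in> ?G" using g w grid_preimage by (simp add: grid_preimages_def)
    \<comment> \<open>The bound is
      \<open>4 / 3 * (5 / 8) * \<rho> + \<rho> / 2 = 4 / 3 * \<rho>\<close>.\<close>
    moreover have "infnorm (a - g) < 2 * \<rho>"
      using infnorm_triangle_diff[of a g w] w(2) g(2) alpha_bounds(2)[OF \<rho>] \<rho>
        infnorm_sub[of a w] infnorm_sub[of g w] by linarith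
    ultimately show ?thesis using w(1) g(2) hopI that by blast
  qed
  obtain u g where u: "x \<in> \<phi> u" "g \<in> ?G" "infnorm (g - u) \<le> \<rho> / 2" "(hop \<rho> ?G)\<^sup>*\<^sup>* y g"
    using rounded[OF yz(1)] by blast
  obtain v k where v: "x \<in> \<phi> v" "k \<in> ?G" "infnorm (k - v) \<le> \<rho> / 2" "(hop \<rho> ?G)\<^sup>*\<^sup>* z k"
    using rounded[OF yz(2)] by blast
  obtain r where r: "r \<le> \<rho> / 16" "chain_linked x r u v"
    using chain_linked_all[OF u(1) v(1), of "\<rho> / 16"] \<rho> by auto
  \<comment> \<open>A grid rounding of an exact preimage close to \<open>w\<close>. The tolerance
    \<open>\<rho> / 16\<close> gives \<open>4 / 3 * (\<rho> / 16) = \<rho> / 12\<close>; two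
    roundings along a hop of size \<open>\<rho> / 4\<close> then differ by at most
    \<open>2 * (7 / 12 * \<rho>) + \<rho> / 4 < 2 * \<rho>\<close>.\<close>
  define near where
    "near w g \<longleftrightarrow> g \<in> grid \<rho> \<and> (\<exists>w'. x \<in> \<phi> w' \<and> infnorm (w' - w) \<le> \<rho> / 12 \<and> infnorm (g - w') \<le> \<rho> / 2)"
    for w g
  have near_G: "g \<in> ?G" if "near w g" for w g
    using that grid_preimage unfolding near_def grid_preimages_def by blast
  have near_close: "infnorm (g - w) \<le> 7 / 12 * \<rho>" if near: "near w g" for w g
  proof -
    obtain w' where "infnorm (w' - w) \<le> \<rho> / 12" "infnorm (g - w') \<le> \<rho> / 2"
      using near unfolding near_def by blast
    then show ?thesis using infnorm_triangle_diff[of g w w'] by linarith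
  qed
  have near_exists: "\<exists>g. near w g" if w: "w \<in> approx_preimage x r" for w
  proof -
    obtain w' where "x \<in> \<phi> w'" "infnorm (w' - w) \<le> 4 / 3 * r" using approx_preimage_near[OF w] .
    moreover obtain g where "g \<in> grid \<rho>" "infnorm (g - w') \<le> \<rho> / 2" using nearest_grid_point[OF \<rho>] .
    ultimately show ?thesis using r(1) unfolding near_def by (intro exI[of _ g]) auto
  qed
  have near_link: "(hop \<rho> ?G)\<^sup>*\<^sup>* a b" if "near w a" "near w' b" "infnorm (w - w') \<le> \<rho> / 4" for w w' a b
  proof -
    have "infnorm (a - b) < 2 * \<rho>"
      using near_close[OF that(1)] near_close[OF that(2)] infnorm_triangle_diff[of a b w]
        infnorm_triangle_diff[of w b w'] infnorm_sub[of w' b] that(3) \<rho> by linarith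
    then show ?thesis using hopI near_G that by blast
  qed
  have "near u g" unfolding near_def
    using u \<rho> by (intro conjI exI[of _ u]) (auto simp: grid_preimages_def infnorm_0)
  have "near v k" unfolding near_def
    using v \<rho> by (intro conjI exI[of _ v]) (auto simp: grid_preimages_def infnorm_0)
  have "(hop (\<rho> / 4) (approx_preimage x r))\<^sup>*\<^sup>* u v"
    using r(2) \<rho> by (simp add: chain_linked_def)
  then have "\<forall>b. near v b \<longrightarrow> (hop \<rho> ?G)\<^sup>*\<^sup>* g b"
  proof (induction rule: rtranclp_induct)
    case base
    then show ?case using near_link[OF \<open>near u g\<close>] \<rho> by (auto simp: infnorm_0)
  next
    case (step w w')
    then have w: "w \<in> approx_preimage x r" "infnorm (w - w') \<le> \<rho> / 4" by (auto simp: hop_def)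
    then obtain b where b: "near w b" using near_exists by blast
    then have "(hop \<rho> ?G)\<^sup>*\<^sup>* g b" using step.IH by blast
    then show ?case using near_link[OF b _ w(2)] by (meson rtranclp_trans)
  qed
  then have "(hop \<rho> ?G)\<^sup>*\<^sup>* g k" using \<open>near v k\<close> by blast
  then show "(hop \<rho> ?G)\<^sup>*\<^sup>* y z" using u(4) hop_sym[OF v(4)] by (meson rtranclp_trans)
qed

section \<open>Correctness of the step procedure\<close>

lemma grid_midpoint:
  assumes "y \<in> grid \<rho>" "w \<in> grid \<rho>" "infnorm (w - y :: real^'n) \<le> 2 * \<rho>" "\<rho> > 0"
  obtains u where "u \<in> grid \<rho>" "infnorm (u - y) \<le> \<rho>" "infnorm (u - w) \<le> \<rho>"
proof -
  obtain m n :: "'n \<Rightarrow> int" where mn: "\<And>i. y $ i = \<rho> * of_int (m i)" "\<And>i. w $ i = \<rho> * of_int (n i)"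
    using assms(1,2) unfolding grid_def by (auto, metis)
  define u :: "real^'n" where "u = (\<chi> i. \<rho> * of_int ((m i + n i) div 2))"
  have scale: "\<bar>\<rho> * of_int a - \<rho> * of_int b\<bar> = \<rho> * of_int \<bar>a - b\<bar>" for a b
    using assms(4) by (simp add: right_diff_distrib[symmetric] abs_mult)
  have "\<bar>n i - m i\<bar> \<le> 2" for i
  proof -
    have "\<bar>w $ i - y $ i\<bar> \<le> 2 * \<rho>" using assms(3) by (simp add: infnorm_le_iff)
    then have "\<rho> * of_int \<bar>n i - m i\<bar> \<le> \<rho> * 2" using mn scale by simp
    then have "of_int \<bar>n i - m i\<bar> \<le> (2 :: real)" using assms(4) mult_le_cancel_left_pos by blast
    then show ?thesis by linarith
  qed
  then have "\<bar>(m i + n i) div 2 - m i\<bar> \<le> 1 \<and> \<bar>(m i + n i) div 2 - n i\<bar> \<le> 1" for i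
  proof -
    have "\<bar>(a + b) div 2 - a\<bar> \<le> 1 \<and> \<bar>(a + b) div 2 - b\<bar> \<le> 1" if "\<bar>b - a\<bar> \<le> 2" for a b :: int
      using that unfolding abs_le_iff by presburger
    then show ?thesis using \<open>\<And>i. \<bar>n i - m i\<bar> \<le> 2\<close> by blast
  qed
  then have "of_int \<bar>(m i + n i) div 2 - m i\<bar> \<le> (1 :: real)" "of_int \<bar>(m i + n i) div 2 - n i\<bar> \<le> (1 :: real)" for i
    by (simp_all only: of_int_le_1_iff simp_thms)
  then have "\<rho> * of_int \<bar>(m i + n i) div 2 - m i\<bar> \<le> \<rho> * 1" "\<rho> * of_int \<bar>(m i + n i) div 2 - n i\<bar> \<le> \<rho> * 1" for i
    using assms(4) by (intro mult_left_mono; simp)+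
  then have "infnorm (u - y) \<le> \<rho>" "infnorm (u - w) \<le> \<rho>"
    using mn scale by (simp_all add: infnorm_le_iff u_def)
  moreover have "u \<in> grid \<rho>" by (auto simp: grid_def u_def)
  ultimately show ?thesis using that by blast
qed

lemma layer_minus1I:
  assumes "\<rho> > 0" "M \<subseteq> grid \<rho>" "y \<in> M" "d \<in> layer0 \<rho> M" "infnorm (y - d) \<le> \<rho>"
  shows "y \<in> layer0 \<rho> M \<union> layer \<rho> (-1) M"
proof (cases "y \<in> layer0 \<rho> M")
  case False
  have sub: "layer0 \<rho> M \<subseteq> grid \<rho>" using assms by (auto simp: layer0_def)
  have "infnorm (y - e) = \<rho>" if "e \<in> layer0 \<rho> M" "infnorm (y - e) \<le> \<rho>" for e
    using that assms False sub by (intro grid_infnorm_eq_step) auto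
  then have "\<forall>e\<in>layer0 \<rho> M. infnorm (y - e) \<ge> \<rho>" by force
  moreover have "infnorm (y - d) = \<rho>" using \<open>\<And>e. \<lbrakk>e \<in> layer0 \<rho> M; _\<rbrakk> \<Longrightarrow> _\<close> assms by blast
  ultimately have "linf_dist y (layer0 \<rho> M) = ereal (real 1 * \<rho>)"
    using assms sub by (subst linf_dist_grid_iff) auto
  then show ?thesis using assms(3) by (simp add: layer_def)
qed simp

lemma layer12_iff:
  assumes "\<rho> > 0" "M \<subseteq> grid \<rho>"
  shows "w \<in> layer \<rho> 1 M \<union> layer \<rho> 2 M \<longleftrightarrow>
    w \<in> grid \<rho> - M \<and> (\<exists>d\<in>layer0 \<rho> M. infnorm (w - d) \<le> 2 * \<rho>)" (is "?L \<longleftrightarrow> ?R")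
proof -
  have sub: "layer0 \<rho> M \<subseteq> grid \<rho>" using assms by (auto simp: layer0_def)
  have two: "w \<in> layer \<rho> 2 M \<longleftrightarrow> w \<in> grid \<rho> - M \<and>
    (\<exists>d\<in>layer0 \<rho> M. infnorm (w - d) = 2 * \<rho>) \<and> (\<forall>d\<in>layer0 \<rho> M. infnorm (w - d) \<ge> 2 * \<rho>)"
    using linf_dist_grid_iff[of w \<rho> "layer0 \<rho> M" 2] sub assms(1) by (auto simp: layer_def)
  show ?thesis
  proof
    assume ?L then show ?R using two layer1_iff[OF assms, of w] assms(1) by force
  next
    assume R: ?R
    show ?L
    proof (cases "\<exists>d\<in>layer0 \<rho> M. infnorm (w - d) \<le> \<rho>")
      case True then show ?thesis using R layer1_iff[OF assms, of w] by blast
    next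
      case False
      have "infnorm (w - d) \<ge> 2 * \<rho>" if "d \<in> layer0 \<rho> M" for d
        using grid_infnorm_less[of w \<rho> d 1] R False that sub assms(1) by force
      then show ?thesis using R two by (force intro: antisym)
    qed
  qed
qed

text \<open>Points of layers 1 and 2 are within \<open>2 * \<rho>\<close> of layer 0, and replacing
  one by the other moves the frontier of the Euler image by at most
  \<open>(1 + L * h) * (2 * \<rho>)\<close>. The widening \<open>kappa\<close> of the procedure
  absorbs this.\<close>

lemma kappa_ge:
  assumes "\<rho> > 0"
  shows "(1 + L * h) * (2 * \<rho>) \<le> kappa L h \<rho>"
proof -
  have "0 \<le> alpha L h \<rho> / (1 - L * h)" using alpha_bounds[OF assms] assms Lh by simp
  then have "2 * (1 + L * h) * \<rho> \<le> 2 * (1 + L * h) * (alpha L h \<rho> / (1 - L * h) + \<rho>)"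
    using Lh_pos by (intro mult_left_mono) auto
  then show ?thesis by (simp add: kappa_def mult_ac)
qed

text \<open>An exact preimage of \<open>x\<close> lies within
  \<open>4 / 3 * (13 / 8) * \<rho> = 13 / 6 * \<rho>\<close> of \<open>y\<close>; its rounding
  \<open>w\<close> is less than \<open>3 * \<rho>\<close> away, hence at most
  \<open>2 * \<rho>\<close>. The midpoint \<open>u\<close> locates the boundary of \<open>M\<close>
  between \<open>y\<close> and \<open>w\<close>: if \<open>u \<in> M\<close> then \<open>u\<close>
  is in layer 0, otherwise \<open>y\<close> is.\<close>

lemma near_boundary:
  assumes \<rho>: "\<rho> > 0" and M: "M \<subseteq> grid \<rho>" and y: "y \<in> M" and x: "x \<in> linf_nbhd (alpha L h \<rho> + \<rho>) (\<phi> y)"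
    and out: "\<And>w. w \<in> M \<Longrightarrow> x \<notin> linf_nbhd (alpha L h \<rho>) (\<phi> w)"
  obtains w u where "w \<in> grid \<rho> - M" "x \<in> linf_nbhd (alpha L h \<rho>) (\<phi> w)"
    "u \<in> grid \<rho>" "infnorm (u - y) \<le> \<rho>" "infnorm (u - w) \<le> \<rho>" "infnorm (w - y) \<le> 2 * \<rho>"
proof -
  have "y \<in> approx_preimage x (alpha L h \<rho> + \<rho>)" using x by (simp add: approx_preimage_def)
  then obtain v where v: "x \<in> \<phi> v" "infnorm (v - y) \<le> 4 / 3 * (alpha L h \<rho> + \<rho>)"
    by (rule approx_preimage_near)
  obtain w where w: "w \<in> grid \<rho>" "infnorm (w - v) \<le> \<rho> / 2" using nearest_grid_point[OF \<rho>] .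
  have xw: "x \<in> linf_nbhd (alpha L h \<rho>) (\<phi> w)" using grid_preimage w(2) v(1) .
  then have "w \<notin> M" using out by blast
  have "infnorm (v - y) \<le> 13 / 6 * \<rho>" using v(2) alpha_bounds(2)[OF \<rho>] by simp
  then have "infnorm (w - y) < 3 * \<rho>"
    using infnorm_triangle_diff[of w y v] w(2) \<rho> by simp
  then have wy: "infnorm (w - y) \<le> 2 * \<rho>"
    using grid_infnorm_less[of w \<rho> y 2] w(1) y M \<rho> by auto
  obtain u where "u \<in> grid \<rho>" "infnorm (u - y) \<le> \<rho>" "infnorm (u - w) \<le> \<rho>"
    using grid_midpoint[OF _ w(1) wy \<rho>] y M by blast
  then show ?thesis using that w(1) \<open>w \<notin> M\<close> xw wy by blast
qed

section \<open>The image of a grid set and the candidates for its boundary layers\<close>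

definition image_grid :: "real \<Rightarrow> real \<Rightarrow> (real^'n) set \<Rightarrow> (real^'n) set" where
  "image_grid \<rho> \<eta> M = (\<Union>x\<in>M. Phi F (alpha L h \<rho>) h \<eta> x)"

text \<open>For the input \<open>tr \<rho> M\<close> of \<open>step_procedure\<close>, this is its
  set \<open>W1\<close>, and \<open>inner_candidates\<close> is
  \<open>W00 \<union> W0m1\<close>.\<close>

definition outer_candidates :: "real \<Rightarrow> real \<Rightarrow> (real^'n) set \<Rightarrow> (real^'n) set" where
  "outer_candidates \<rho> \<eta> M = (\<Union>x\<in>layer \<rho> 1 M \<union> layer \<rho> 2 M. Phi_bd F (alpha L h \<rho>) h \<eta> x)"

definition inner_candidates :: "real \<Rightarrow> real \<Rightarrow> (real^'n) set \<Rightarrow> (real^'n) set" where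
  "inner_candidates \<rho> \<eta> M =
    (\<Union>x\<in>layer0 \<rho> M. Phi_bd F (alpha L h \<rho> + kappa L h \<rho>) h \<eta> x) \<inter>
      (\<Union>x\<in>layer0 \<rho> M. Phi F (alpha L h \<rho>) h \<eta> x)
    \<union> (\<Union>x\<in>layer \<rho> (-1) M. Phi_bd F (alpha L h \<rho>) h \<eta> x)"

context
  fixes \<rho> \<eta> :: real and M :: "(real^'n) set"
  assumes \<rho>: "\<rho> > 0" and M: "M \<subseteq> grid \<rho>" and \<eta>: "\<eta> > 0" "\<eta> \<le> \<rho>"
begin

abbreviation (input) "N \<equiv> image_grid \<rho> \<eta> M"
abbreviation (input) "W1 \<equiv> outer_candidates \<rho> \<eta> M"
abbreviation (input) "W0 \<equiv> inner_candidates \<rho> \<eta> M"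
abbreviation (input) "\<alpha> \<equiv> alpha L h \<rho>"
abbreviation (input) "\<kappa> \<equiv> kappa L h \<rho>"

lemma image_grid_iff:
  "x \<in> N \<longleftrightarrow> x \<in> grid \<eta> \<and> (\<exists>y\<in>M. x \<in> linf_nbhd \<alpha> (\<phi> y))"
  by (auto simp: image_grid_def Phi_def grid_proj_def)

lemma image_grid_subset: "N \<subseteq> grid \<eta>"
  by (auto simp: image_grid_iff)

lemma W0_subset: "W0 \<subseteq> N"
proof -
  have "Phi_bd F \<alpha> h \<eta> x \<subseteq> Phi F \<alpha> h \<eta> x" for x
    unfolding Phi_bd_def Phi_def grid_proj_def using linf_nbhd_mono[OF frontier_euler_subset] by blast
  moreover have "layer0 \<rho> M \<subseteq> M" "layer \<rho> (-1) M \<subseteq> M" by (auto simp: layer0_def layer_def)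
  ultimately show ?thesis unfolding inner_candidates_def image_grid_def by blast
qed

lemma W1_subset: "W1 \<subseteq> grid \<eta>"
  by (auto simp: outer_candidates_def Phi_bd_def grid_proj_def)

lemma kappa_nonneg: "\<kappa> \<ge> 0"
  using kappa_ge[OF \<rho>] Lh_pos \<rho> mult_nonneg_nonneg[of "1 + L * h" "2 * \<rho>"] by linarith

text \<open>Two facts are combined for an arbitrary \<open>y \<in> M\<close> that reaches
  \<open>x\<close>: the frontier of \<open>\<phi> y\<close> is within \<alpha> of \<open>x\<close>,
  and, by \<open>near_boundary\<close> for the outside neighbour \<open>z\<close>, the point
  \<open>y\<close> lies in layer 0 or -1.\<close>

lemma layer0_image_subset: "layer0 \<eta> N \<subseteq> W0"
proof
  fix x assume "x \<in> layer0 \<eta> N"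
  then obtain z where x: "x \<in> N" and z: "z \<in> grid \<eta> - N" "infnorm (x - z) = \<eta>"
    by (auto simp: layer0_def)
  obtain y where y: "y \<in> M" "x \<in> linf_nbhd \<alpha> (\<phi> y)" using x by (auto simp: image_grid_iff)
  have z_out: "z \<notin> linf_nbhd \<alpha> (\<phi> w)" if "w \<in> M" for w using z(1) that by (auto simp: image_grid_iff)
  have bd: "x \<in> linf_nbhd \<alpha> (frontier (\<phi> y))"
  proof (cases "x \<in> \<phi> y")
    case False
    then show ?thesis using linf_nbhd_frontier_outside[OF y(2)] interior_subset by blast
  next
    case True
    have "z \<notin> \<phi> y" using z_out[OF y(1)] alpha_bounds[OF \<rho>] \<rho> by (auto simp: mem_linf_nbhd infnorm_0)
    then obtain p where p: "p \<in> frontier (\<phi> y)" "p \<in> closed_segment x z"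
      using closed_segment_meets_frontier[OF True] interior_subset by blast
    \<comment> \<open>The segment from \<open>x\<close> to \<open>z\<close> has length
      \<open>\<eta> \<le> \<rho> \<le> 2 * \<alpha>\<close>. Its frontier point \<open>p\<close> is
      farther than \<alpha> from \<open>z\<close>, so it is within \<alpha> of
      \<open>x\<close>.\<close>
    have "infnorm (z - p) > \<alpha>"
      using z_out[OF y(1)] p(1) frontier_euler_subset by (force simp: mem_linf_nbhd)
    then have "infnorm (x - p) \<le> \<alpha>"
      using closed_segment_infnorm_add[OF p(2)] z(2) infnorm_sub[of z p] \<eta> alpha_bounds(1)[OF \<rho>]
      by linarith
    then show ?thesis using p(1) by (auto simp: mem_linf_nbhd)
  qed
  have zy: "z \<in> linf_nbhd (\<alpha> + \<rho>) (\<phi> y)"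
  proof -
    obtain p where "p \<in> \<phi> y" "infnorm (x - p) \<le> \<alpha>" using y(2) by (auto simp: mem_linf_nbhd)
    then show ?thesis
      using infnorm_triangle_diff[of z p x] z(2) \<eta>(2) infnorm_sub[of z x]
      by (force simp: mem_linf_nbhd)
  qed
  obtain w u where w: "w \<in> grid \<rho> - M" and u: "u \<in> grid \<rho>" "infnorm (u - y) \<le> \<rho>" "infnorm (u - w) \<le> \<rho>"
    using near_boundary[OF \<rho> M y(1) zy z_out] by metis
  have "\<exists>d\<in>layer0 \<rho> M. infnorm (y - d) \<le> \<rho>"
  proof (cases "u \<in> M")
    case True
    then have "u \<in> layer0 \<rho> M" using layer0_iff'[OF \<rho> M] w u(3) by blast
    then show ?thesis using u(2) infnorm_sub[of u y] by auto
  next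
    case False
    then have "y \<in> layer0 \<rho> M" using layer0_iff'[OF \<rho> M] u y(1) infnorm_sub[of u y] by auto
    then show ?thesis using \<rho> by (auto simp: infnorm_0 intro!: bexI[of _ y])
  qed
  then have "y \<in> layer0 \<rho> M \<union> layer \<rho> (-1) M" using layer_minus1I[OF \<rho> M y(1)] by blast
  moreover have "x \<in> grid \<eta>" using x image_grid_subset by blast
  moreover have "x \<in> linf_nbhd (\<alpha> + \<kappa>) (frontier (\<phi> y))"
    using bd linf_nbhd_mono[OF subset_refl, of \<alpha> "\<alpha> + \<kappa>"] kappa_nonneg by auto
  ultimately show "x \<in> W0"
    using bd y(2) unfolding inner_candidates_def Phi_def Phi_bd_def grid_proj_def by blast
qed

text \<open>On the grid path from \<open>y\<close> over \<open>u\<close> to \<open>w\<close>, the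
  start does not reach \<open>x\<close> and the end does. A path point that reaches \<open>x\<close>
  while its predecessor does not has its image frontier within \<alpha> of \<open>x\<close>, and it
  lies in layer 1 or 2.\<close>

lemma layer1_image_subset: "layer \<eta> 1 N \<subseteq> W1"
proof
  fix x assume "x \<in> layer \<eta> 1 N"
  then obtain x0 where x: "x \<in> grid \<eta> - N" and x0: "x0 \<in> N" "infnorm (x - x0) \<le> \<eta>"
    using layer1_iff'[OF \<eta>(1) image_grid_subset] by blast
  obtain y where y: "y \<in> M" "x0 \<in> linf_nbhd \<alpha> (\<phi> y)" using x0(1) by (auto simp: image_grid_iff)
  have x_out: "x \<notin> linf_nbhd \<alpha> (\<phi> w)" if "w \<in> M" for w using x that by (auto simp: image_grid_iff)
  have xy: "x \<in> linf_nbhd (\<alpha> + \<rho>) (\<phi> y)"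
  proof -
    obtain p where "p \<in> \<phi> y" "infnorm (x0 - p) \<le> \<alpha>" using y(2) by (auto simp: mem_linf_nbhd)
    then show ?thesis
      using infnorm_triangle_diff[of x p x0] x0(2) \<eta>(2) by (force simp: mem_linf_nbhd)
  qed
  obtain w u where w: "w \<in> grid \<rho> - M" "x \<in> linf_nbhd \<alpha> (\<phi> w)" "infnorm (w - y) \<le> 2 * \<rho>"
    and u: "u \<in> grid \<rho>" "infnorm (u - y) \<le> \<rho>" "infnorm (u - w) \<le> \<rho>"
    using near_boundary[OF \<rho> M y(1) xy x_out] by metis
  \<comment> \<open>If the cube of radius \<alpha> around \<open>x\<close> were contained in
    \<open>\<phi> g\<close>, it would be contained in the \<open>2 * \<alpha>\<close>-neighbourhood
    of \<open>\<phi> g'\<close>, since \<open>(1 + L * h) * \<rho> = 2 * \<alpha>\<close>.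
    Cancelling the cube would let \<open>g'\<close> reach \<open>x\<close>.\<close>
  have last: "x \<in> linf_nbhd \<alpha> (frontier (\<phi> g))"
    if g: "x \<in> linf_nbhd \<alpha> (\<phi> g)" and g': "x \<notin> linf_nbhd \<alpha> (\<phi> g')" and gg': "infnorm (g - g') \<le> \<rho>" for g g'
  proof (cases "x \<in> interior (\<phi> g)")
    case False
    then show ?thesis using linf_nbhd_frontier_outside[OF g] by blast
  next
    case True
    have near: "\<phi> g \<subseteq> linf_nbhd (2 * \<alpha>) (\<phi> g')"
      using euler_near[OF gg'] by (simp add: alpha_def)
    have "\<not> linf_nbhd \<alpha> {x} \<subseteq> \<phi> g"
    proof
      assume "linf_nbhd \<alpha> {x} \<subseteq> \<phi> g"
      then have "x \<in> linf_nbhd (2 * \<alpha> - \<alpha>) (\<phi> g')"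
        using near alpha_bounds[OF \<rho>] \<rho> compact_euler convex_euler
        by (intro cube_cancel) auto
      then show False using g' by simp
    qed
    then obtain q where "q \<notin> \<phi> g" "q \<in> linf_nbhd \<alpha> {x}" by blast
    then have "q \<notin> interior (\<phi> g)" "infnorm (x - q) \<le> \<alpha>"
      using interior_subset by (auto simp: mem_linf_nbhd infnorm_sub)
    then show ?thesis using linf_nbhd_frontier_inside True interior_subset by blast
  qed
  have "\<exists>g\<in>layer \<rho> 1 M \<union> layer \<rho> 2 M. x \<in> linf_nbhd \<alpha> (frontier (\<phi> g))"
  proof (cases "x \<in> linf_nbhd \<alpha> (\<phi> u)")
    case True
    then have "u \<notin> M" using x_out by blast
    then have "u \<in> layer \<rho> 1 M" using layer1_iff'[OF \<rho> M] u y(1) by blast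
    then show ?thesis using last[OF True x_out[OF y(1)] u(2)] by blast
  next
    case False
    have "\<exists>d\<in>layer0 \<rho> M. infnorm (w - d) \<le> 2 * \<rho>"
    proof (cases "u \<in> M")
      case True
      then have "u \<in> layer0 \<rho> M" using layer0_iff'[OF \<rho> M] w u(3) by blast
      then show ?thesis using u(3) infnorm_sub[of u w] \<rho> by force
    next
      case False
      then have "y \<in> layer0 \<rho> M" using layer0_iff'[OF \<rho> M] u y(1) infnorm_sub[of u y] by auto
      then show ?thesis using w(3) by blast
    qed
    then have "w \<in> layer \<rho> 1 M \<union> layer \<rho> 2 M" using layer12_iff[OF \<rho> M] w(1) by blast
    moreover have "x \<in> linf_nbhd \<alpha> (frontier (\<phi> w))"
      using last[OF w(2) False] u(3) infnorm_sub[of u w] by simp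
    ultimately show ?thesis by blast
  qed
  then show "x \<in> W1" using x unfolding outer_candidates_def Phi_bd_def grid_proj_def by blast
qed

text \<open>\<open>W00\<close> is an intersection of two unions, so its conditions may be witnessed
  by different points of layer 0: \<open>d\<close>, close to \<open>z\<close>, for the distance to
  the frontier, and \<open>e\<close>, where a chain of grid preimages from \<open>z\<close> to
  \<open>y\<close> enters \<open>M\<close>, for the reach condition.\<close>

lemma W1_image_subset: "W1 \<inter> N \<subseteq> W0"
proof
  fix x assume "x \<in> W1 \<inter> N"
  then obtain z y where z: "z \<in> layer \<rho> 1 M \<union> layer \<rho> 2 M" "x \<in> linf_nbhd \<alpha> (frontier (\<phi> z))"
    and x: "x \<in> grid \<eta>" and y: "y \<in> M" "x \<in> linf_nbhd \<alpha> (\<phi> y)"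
    unfolding outer_candidates_def Phi_bd_def grid_proj_def by (auto simp: image_grid_iff)
  obtain d where d: "d \<in> layer0 \<rho> M" "infnorm (z - d) \<le> 2 * \<rho>" and zM: "z \<in> grid \<rho> - M"
    using z(1) layer12_iff[OF \<rho> M] by blast
  have "x \<in> linf_nbhd (\<alpha> + (1 + L * h) * (2 * \<rho>)) (frontier (\<phi> d))"
    by (rule linf_nbhd_linf_nbhd[OF z(2) frontier_euler_near[OF d(2)]])
  then have bd: "x \<in> linf_nbhd (\<alpha> + \<kappa>) (frontier (\<phi> d))"
    using linf_nbhd_mono[OF subset_refl, of "\<alpha> + (1 + L * h) * (2 * \<rho>)" "\<alpha> + \<kappa>"] kappa_ge[OF \<rho>] by auto
  have "x \<in> linf_nbhd \<alpha> (\<phi> z)" using z(2) linf_nbhd_mono[OF frontier_euler_subset] by blast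
  then have "(hop \<rho> (grid_preimages \<rho> x))\<^sup>*\<^sup>* z y"
    using chain_connected_grid_preimages[OF \<rho>] y M zM
    by (auto simp: chain_connected_def grid_preimages_def)
  then have "y \<in> M \<longrightarrow> (\<exists>e\<in>layer0 \<rho> M. x \<in> linf_nbhd \<alpha> (\<phi> e))"
  proof (induction rule: rtranclp_induct)
    case base then show ?case using zM by blast
  next
    case (step a b)
    show ?case
    proof
      assume "b \<in> M"
      show "\<exists>e\<in>layer0 \<rho> M. x \<in> linf_nbhd \<alpha> (\<phi> e)"
      proof (cases "a \<in> M")
        case True then show ?thesis using step.IH by blast
      next
        case False
        have ab: "a \<in> grid \<rho>" "x \<in> linf_nbhd \<alpha> (\<phi> b)" "infnorm (b - a) \<le> \<rho>"
          using step.hyps(2) by (auto simp: hop_def grid_preimages_def infnorm_sub)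
        then have "b \<in> layer0 \<rho> M" using layer0_iff'[OF \<rho> M, of b] \<open>b \<in> M\<close> False by blast
        then show ?thesis using ab(2) by blast
      qed
    qed
  qed
  then obtain e where "e \<in> layer0 \<rho> M" "x \<in> linf_nbhd \<alpha> (\<phi> e)" using y(1) by blast
  then show "x \<in> W0" using bd d(1) x unfolding inner_candidates_def Phi_def Phi_bd_def grid_proj_def by blast
qed

lemma linf_dist_eq_mesh_iff:
  assumes "x \<in> grid \<eta>" "A \<subseteq> grid \<eta>"
  shows "linf_dist x A = ereal \<eta> \<longleftrightarrow> x \<notin> A \<and> (\<exists>a\<in>A. infnorm (x - a :: real^'n) \<le> \<eta>)"
proof -
  have "infnorm (x - a) \<ge> \<eta>" if "x \<notin> A" "a \<in> A" for a
    using grid_infnorm_eq_step[of x \<eta> a] that assms \<eta>(1) by force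
  moreover have "linf_dist x A = ereal \<eta> \<longleftrightarrow>
    (\<exists>y\<in>A. infnorm (x - y) = \<eta>) \<and> (\<forall>y\<in>A. infnorm (x - y) \<ge> \<eta>)"
    using linf_dist_grid_iff[OF assms \<eta>(1), of 1] by simp
  moreover have "x \<notin> A" if "\<forall>y\<in>A. infnorm (x - y) \<ge> \<eta>"
    using that \<eta>(1) by (auto simp: infnorm_0)
  ultimately show ?thesis using order_eq_refl antisym by metis
qed

text \<open>The candidates contain the two layers, and \<open>W0\<close> lies in \<open>N\<close>.
  An outer candidate adjacent to \<open>W0\<close> but not in it cannot be in \<open>N\<close> by
  \<open>W1_image_subset\<close>, so it is in layer 1; adjacency to layer 1 then singles out layer
  0.\<close>

lemma boundary_image:
  "layer \<eta> 1 N = {x \<in> W1. linf_dist x W0 = ereal \<eta>}" (is ?one)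
  "layer0 \<eta> N = {x \<in> W0. linf_dist x (layer \<eta> 1 N) = ereal \<eta>}" (is ?zero)
proof -
  have sub: "W0 \<subseteq> grid \<eta>" "layer \<eta> 1 N \<subseteq> grid \<eta>"
    using W0_subset image_grid_subset layer1_iff[OF \<eta>(1) image_grid_subset] by blast+
  show ?one
  proof (intro equalityI subsetI)
    fix x assume x: "x \<in> layer \<eta> 1 N"
    then obtain a where a: "x \<in> grid \<eta> - N" "a \<in> layer0 \<eta> N" "infnorm (x - a) \<le> \<eta>"
      using layer1_iff[OF \<eta>(1) image_grid_subset] by blast
    then have "linf_dist x W0 = ereal \<eta>"
      using layer0_image_subset W0_subset by (subst linf_dist_eq_mesh_iff[OF _ sub(1)]) auto
    then show "x \<in> {x \<in> W1. linf_dist x W0 = ereal \<eta>}" using layer1_image_subset x by blast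
  next
    fix x assume "x \<in> {x \<in> W1. linf_dist x W0 = ereal \<eta>}"
    then have x: "x \<in> W1" "linf_dist x W0 = ereal \<eta>" by auto
    then have "x \<notin> W0" "\<exists>a\<in>W0. infnorm (x - a) \<le> \<eta>"
      using linf_dist_eq_mesh_iff[OF _ sub(1)] W1_subset by blast+
    moreover have "x \<notin> N" using \<open>x \<notin> W0\<close> x(1) W1_image_subset by blast
    ultimately show "x \<in> layer \<eta> 1 N"
      using layer1_iff'[OF \<eta>(1) image_grid_subset] W0_subset x(1) W1_subset by blast
  qed
  show ?zero
  proof (intro equalityI subsetI)
    fix x assume x: "x \<in> layer0 \<eta> N"
    then obtain z where z: "z \<in> grid \<eta> - N" "infnorm (x - z) \<le> \<eta>" and xN: "x \<in> N"
      using layer0_iff'[OF \<eta>(1) image_grid_subset] by blast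
    have "z \<in> layer \<eta> 1 N"
      using layer1_iff'[OF \<eta>(1) image_grid_subset] z xN infnorm_sub[of x z] by auto
    moreover have "x \<notin> layer \<eta> 1 N"
      using xN layer1_iff[OF \<eta>(1) image_grid_subset] by blast
    ultimately have "linf_dist x (layer \<eta> 1 N) = ereal \<eta>"
      using linf_dist_eq_mesh_iff[OF _ sub(2)] z(2) xN image_grid_subset by blast
    then show "x \<in> {x \<in> W0. linf_dist x (layer \<eta> 1 N) = ereal \<eta>}"
      using layer0_image_subset x by blast
  next
    fix x assume "x \<in> {x \<in> W0. linf_dist x (layer \<eta> 1 N) = ereal \<eta>}"
    then have x: "x \<in> W0" "linf_dist x (layer \<eta> 1 N) = ereal \<eta>" by auto
    then obtain z where "z \<in> layer \<eta> 1 N" "infnorm (x - z) \<le> \<eta>"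
      using linf_dist_eq_mesh_iff[OF _ sub(2)] sub(1) by blast
    then show "x \<in> layer0 \<eta> N"
      using layer0_iff'[OF \<eta>(1) image_grid_subset] layer1_iff[OF \<eta>(1) image_grid_subset]
        W0_subset x(1) by blast
  qed
qed

end

lemma image_grid_eq: "image_grid \<rho> \<eta> M = grid_proj (alpha L h \<rho>) \<eta> (\<Union>x\<in>M. \<phi> x)"
  by (auto simp: image_grid_def Phi_def grid_proj_def linf_nbhd_UN)

text \<open>Images of neighbouring grid points have points within
  \<open>(1 + L * h) * \<rho> = 2 * \<alpha>\<close> of each other, which is the gap that projection
  with radius \<alpha> bridges.\<close>

lemma image_grid_conn:
  assumes M: "M \<in> conn_grid_sets \<rho>" and "\<rho> > 0" "\<eta> > 0" "\<eta> \<le> \<rho>"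
  shows "image_grid \<rho> \<eta> M \<in> conn_grid_sets \<eta>"
proof -
  let ?\<alpha> = "alpha L h \<rho>"
  have \<alpha>: "\<rho> \<le> 2 * ?\<alpha>" using alpha_bounds(1)[of \<rho>] assms by simp
  have "chain_connected (2 * ?\<alpha>) (\<Union>x\<in>M. \<phi> x)"
  proof (rule chain_connected_UN[OF conn_grid_sets_chain_connected[OF M]])
    show "chain_connected (2 * ?\<alpha>) (\<phi> x)" for x
      using \<alpha> assms(2) by (intro connected_imp_chain_connected convex_connected convex_euler) simp
    fix x y :: "real^'n" assume xy: "infnorm (x - y) \<le> \<rho>"
    obtain a :: "real^'n" where "a \<in> \<phi> x" using euler_nonempty by blast
    then have "a \<in> linf_nbhd ((1 + L * h) * \<rho>) (\<phi> y)" using euler_near[OF xy] by blast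
    then show "\<exists>a\<in>\<phi> x. \<exists>b\<in>\<phi> y. infnorm (a - b) \<le> 2 * ?\<alpha>"
      using \<open>a \<in> \<phi> x\<close> by (auto simp: mem_linf_nbhd alpha_def)
  qed
  moreover have "(\<Union>x\<in>M. \<phi> x) \<noteq> {}"
    using M euler_nonempty by (auto simp: conn_grid_sets_def grid_sets_def)
  ultimately show ?thesis
    unfolding image_grid_eq using assms \<alpha> by (intro grid_proj_conn_grid_sets) auto
qed

lemma coarsen_conn:
  assumes M: "M \<in> conn_grid_sets \<rho>" and "\<rho> > 0" "\<rho> \<le> \<rho>'"
  shows "coarsen \<rho>' M \<in> conn_grid_sets \<rho>'"
proof -
  have "chain_connected (2 * (\<rho>' / 2)) M"
    unfolding chain_connected_def
  proof (intro ballI)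
    fix x y assume "x \<in> M" "y \<in> M"
    then have "(hop \<rho> M)\<^sup>*\<^sup>* x y"
      using conn_grid_sets_chain_connected[OF M] by (simp add: chain_connected_def)
    then show "(hop (2 * (\<rho>' / 2)) M)\<^sup>*\<^sup>* x y" by (rule hop_mono) (use assms(3) in auto)
  qed
  then have "grid_proj (\<rho>' / 2) \<rho>' M \<in> conn_grid_sets \<rho>'"
    using assms by (intro grid_proj_conn_grid_sets) (auto simp: conn_grid_sets_def grid_sets_def)
  then show ?thesis by (simp add: coarsen_def grid_proj_def)
qed

lemma UN_Phi2:
  "(\<Union>x\<in>M. Phi2 F (alpha L h \<rho>) h \<rho> \<rho>' x) =
    (if \<rho> < \<rho>' then coarsen \<rho>' (image_grid \<rho> \<rho> M) else image_grid \<rho> \<rho>' M)"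
  by (auto simp: Phi2_def image_grid_def coarsen_def linf_nbhd_UN)

lemma UN_Phi2_conn:
  assumes "M \<in> conn_grid_sets \<rho>" "\<rho> > 0" "\<rho>' > 0"
  shows "(\<Union>x\<in>M. Phi2 F (alpha L h \<rho>) h \<rho> \<rho>' x) \<in> conn_grid_sets \<rho>'"
proof (cases "\<rho> < \<rho>'")
  case True
  then show ?thesis
    unfolding UN_Phi2 using coarsen_conn[OF image_grid_conn[OF assms(1,2,2)]] assms by simp
next
  case False
  then show ?thesis unfolding UN_Phi2 using image_grid_conn[OF assms] by simp
qed

lemma finite_grid_proj_compact: "\<rho> > 0 \<Longrightarrow> compact A \<Longrightarrow> finite (grid_proj r \<rho> A :: (real^'n) set)"
  unfolding grid_proj_def by (intro finite_grid_bounded bounded_linf_nbhd compact_imp_bounded)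

lemma finite_Phi_bd: "\<rho> > 0 \<Longrightarrow> finite (Phi_bd F r h \<rho> x)"
  unfolding Phi_bd_def by (intro finite_grid_proj_compact compact_frontier compact_euler)

lemma finite_UN_Phi2:
  assumes "finite M" "\<rho> > 0" "\<rho>' > 0"
  shows "finite (\<Union>x\<in>M. Phi2 F (alpha L h \<rho>) h \<rho> \<rho>' x)"
proof -
  have "finite (Phi F (alpha L h \<rho>) h r x)" if "r > 0" for r x
    unfolding Phi_def using that by (intro finite_grid_proj_compact compact_euler)
  moreover have "finite (coarsen \<rho>' A :: (real^'n) set)" if "finite A" for A
    using finite_grid_proj_compact[of \<rho>' A "\<rho>' / 2"] that assms(3)
    by (simp add: coarsen_def grid_proj_def finite_imp_compact)
  ultimately show ?thesis using assms by (auto simp: Phi2_def)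
qed

lemma fst_step_procedure:
  assumes M: "M \<in> conn_grid_sets \<rho>" and \<rho>: "\<rho> > 0" "\<rho>' > 0"
  shows "fst (step_procedure L F h \<rho> \<rho>' (tr \<rho> M)) = tr \<rho>' (\<Union>x\<in>M. Phi2 F (alpha L h \<rho>) h \<rho> \<rho>' x)"
proof -
  define \<eta> where "\<eta> = min \<rho> \<rho>'"
  have \<eta>: "\<eta> > 0" "\<eta> \<le> \<rho>" using \<rho> by (auto simp: \<eta>_def)
  have Mg: "M \<subseteq> grid \<rho>" using M by (auto simp: conn_grid_sets_def grid_sets_def)
  let ?N = "image_grid \<rho> \<eta> M"
  define E1 where "E1 = {x \<in> outer_candidates \<rho> \<eta> M. linf_dist x (inner_candidates \<rho> \<eta> M) = ereal \<eta>}"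
  define E0 where "E0 = {x \<in> inner_candidates \<rho> \<eta> M. linf_dist x E1 = ereal \<eta>}"
  have tr_N: "(E0, E1) = tr \<eta> ?N"
    using boundary_image[OF \<rho>(1) Mg \<eta>]
    by (simp only: tr_def layer_def[of \<eta> 0] E0_def E1_def simp_thms if_True)
  have "fst (step_procedure L F h \<rho> \<rho>' (tr \<rho> M)) =
    (if \<rho>' > \<rho> then coarsen_bd \<eta> \<rho>' (E0, E1) else (E0, E1))"
    unfolding step_procedure_def Let_def tr_inv_tr[OF \<rho>(1) conn_grid_sets_grid_sets[OF M]] fst_conv
    by (simp only: tr_def fst_conv snd_conv layer_def[of \<rho> 0] simp_thms if_True
        E0_def E1_def inner_candidates_def outer_candidates_def \<eta>_def[symmetric])
  also have "\<dots> = (if \<rho>' > \<rho> then tr \<rho>' (coarsen \<rho>' ?N) else tr \<rho>' ?N)"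
    unfolding tr_N coarsen_bd_def
    using tr_inv_tr[OF \<eta>(1) conn_grid_sets_grid_sets[OF image_grid_conn[OF M \<rho>(1) \<eta>]]]
    by (cases "\<rho> < \<rho>'") (simp_all add: \<eta>_def)
  also have "\<dots> = tr \<rho>' (\<Union>x\<in>M. Phi2 F (alpha L h \<rho>) h \<rho> \<rho>' x)"
    unfolding UN_Phi2 by (simp add: \<eta>_def)
  finally show ?thesis .
qed

end

text \<open>A point with maximal \<open>i\<close>-th coordinate has its neighbour in direction
  \<open>i\<close> outside the finite set.\<close>

lemma layer_nonempty:
  assumes "finite M" "M \<noteq> {}" "M \<subseteq> grid \<rho>" "\<rho> > 0"
  shows "layer0 \<rho> M \<noteq> {}" "layer \<rho> 1 (M :: (real^'n) set) \<noteq> {}"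
proof -
  fix i :: 'n
  have "Max ((\<lambda>x. x $ i) ` M) \<in> (\<lambda>x. x $ i) ` M" using assms by (intro Max_in) auto
  then obtain x where x: "x \<in> M" "x $ i = Max ((\<lambda>x. x $ i) ` M)" by auto
  define z where "z = x + axis i \<rho>"
  have "z $ i = x $ i + \<rho>" by (simp add: z_def)
  then have "z \<notin> M" using assms(1,4) x(2) Max_ge[of "(\<lambda>x. x $ i) ` M" "z $ i"] by fastforce
  moreover have "z \<in> grid \<rho>"
  proof -
    have "\<exists>m::int. z $ j = \<rho> * of_int m" for j
    proof -
      obtain m :: int where m: "x $ j = \<rho> * of_int m" using x(1) assms(3) unfolding grid_def by blast
      have "z $ j = \<rho> * of_int (if j = i then m + 1 else m)"
        using m by (simp add: z_def axis_def distrib_left)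
      then show ?thesis by blast
    qed
    then show ?thesis by (simp add: grid_def)
  qed
  moreover have "infnorm (x - z) \<le> \<rho>"
    using assms(4) by (simp add: z_def infnorm_le_iff axis_def)
  ultimately show "layer0 \<rho> M \<noteq> {}" "layer \<rho> 1 M \<noteq> {}"
    using layer0_iff'[OF assms(4,3)] layer1_iff'[OF assms(4,3)] x(1) infnorm_sub[of x z] by fastforce+
qed

context euler_map
begin

text \<open>The interpolated weights are built from these counts and their quotient, and must be
  positive. Layers 0 and 1 are nonempty, and every frontier point has a grid point within
  \<open>\<eta> / 2 \<le> \<alpha>\<close>.\<close>

lemma step_procedure_counts_pos:
  assumes M: "finite M" "M \<in> conn_grid_sets \<rho>" and \<rho>: "\<rho> > 0" "\<rho>' > 0"
  shows "fst (snd (step_procedure L F h \<rho> \<rho>' (tr \<rho> M))) > 0"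
    "snd (snd (step_procedure L F h \<rho> \<rho>' (tr \<rho> M))) > 0"
proof -
  define \<eta> where "\<eta> = min \<rho> \<rho>'"
  have \<eta>: "\<eta> > 0" "\<eta> \<le> \<rho>" using \<rho> by (auto simp: \<eta>_def)
  have Mg: "M \<noteq> {}" "M \<subseteq> grid \<rho>" using M by (auto simp: conn_grid_sets_def grid_sets_def)
  note fin = finite_layer[OF \<rho>(1) Mg(2) M(1)]
  have "finite (layer0 \<rho> M)" using fin[of 0] by (simp add: layer_def)
  then have "card (layer0 \<rho> M) > 0"
    using layer_nonempty(1)[OF M(1) Mg \<rho>(1)] by (simp add: card_gt_0_iff)
  then show "fst (snd (step_procedure L F h \<rho> \<rho>' (tr \<rho> M))) > 0"
    by (simp add: step_procedure_def Let_def tr_def layer_def[of \<rho> 0])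
  have "card (Phi_bd F (alpha L h \<rho>) h \<eta> x) > 0" for x
  proof -
    obtain p where p: "p \<in> frontier (\<phi> x)" using frontier_euler_nonempty by blast
    obtain g where "g \<in> grid \<eta>" "infnorm (g - p) \<le> \<eta> / 2" using nearest_grid_point[OF \<eta>(1)] .
    then have "g \<in> Phi_bd F (alpha L h \<rho>) h \<eta> x"
      using p alpha_bounds(1)[OF \<rho>(1)] \<eta>(2)
      by (auto simp: Phi_bd_def grid_proj_def mem_linf_nbhd intro!: bexI[of _ p])
    then show ?thesis using finite_Phi_bd[OF \<eta>(1)] by (auto simp: card_gt_0_iff)
  qed
  then have "(\<Sum>x\<in>layer \<rho> 1 M. card (Phi_bd F (alpha L h \<rho>) h \<eta> x)) > 0"
    using layer_nonempty(2)[OF M(1) Mg \<rho>(1)] fin[of 1] by (intro sum_pos) auto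
  then show "snd (snd (step_procedure L F h \<rho> \<rho>' (tr \<rho> M))) > 0"
    by (simp add: step_procedure_def Let_def tr_def \<eta>_def)
qed

end

section \<open>Tracking along a discretization\<close>

lemma aleph_nD:
  assumes "\<delta> \<in> aleph_n T L P n"
  shows "nsteps \<delta> = n" "length (step_sizes \<delta>) = n" "length (nodes \<delta>) = Suc n" "length (meshes \<delta>) = Suc n"
    "\<And>j. 1 \<le> j \<Longrightarrow> j \<le> n \<Longrightarrow> hh \<delta> j > 0" "\<And>j. 1 \<le> j \<Longrightarrow> j \<le> n \<Longrightarrow> hh \<delta> j \<le> 1 / (4 * L)"
    "\<And>k. k \<le> n \<Longrightarrow> rr \<delta> k > 0" "\<And>k. k \<le> n \<Longrightarrow> rr \<delta> k \<le> P / (8 * L)"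
    "tt \<delta> 0 = 0" "tt \<delta> n = T" "\<And>k. k < n \<Longrightarrow> tt \<delta> (Suc k) = tt \<delta> k + hh \<delta> (Suc k)"
    "\<And>j k. j \<le> n \<Longrightarrow> k \<le> n \<Longrightarrow> \<exists>l::int. rr \<delta> j / rr \<delta> k = 4 powi l"
    "\<And>j. 1 \<le> j \<Longrightarrow> j \<le> n \<Longrightarrow> rr \<delta> j = 2 * L * P * (hh \<delta> j)\<^sup>2"
proof -
  have a: "length (step_sizes \<delta>) = n \<and> length (nodes \<delta>) = Suc n \<and> length (meshes \<delta>) = Suc n \<and>
         (\<forall>j\<in>{1..n}. hh \<delta> j > 0) \<and>
         (\<forall>k\<in>{0..n}. rr \<delta> k > 0) \<and>
         (\<forall>k\<in>{0..n}. tt \<delta> k = (\<Sum>j=1..k. hh \<delta> j)) \<and>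
         tt \<delta> n = T \<and>
         (\<forall>j\<in>{1..n}. \<bar>hh \<delta> j\<bar> \<le> 1 / (4 * L)) \<and>
         (\<forall>k\<in>{0..n}. \<bar>rr \<delta> k\<bar> \<le> P / (8 * L)) \<and>
         (\<forall>j\<in>{0..n}. \<forall>k\<in>{0..n}. \<exists>l::int. rr \<delta> j / rr \<delta> k = 4 powi l) \<and>
         (\<forall>j\<in>{1..n}. rr \<delta> j = 2 * L * P * (hh \<delta> j)^2)"
    using assms unfolding aleph_n_def by simp
  then show "nsteps \<delta> = n" "length (step_sizes \<delta>) = n" "length (nodes \<delta>) = Suc n" "length (meshes \<delta>) = Suc n"
    "\<And>j. 1 \<le> j \<Longrightarrow> j \<le> n \<Longrightarrow> hh \<delta> j > 0" "\<And>j. 1 \<le> j \<Longrightarrow> j \<le> n \<Longrightarrow> hh \<delta> j \<le> 1 / (4 * L)"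
    "\<And>k. k \<le> n \<Longrightarrow> rr \<delta> k > 0" "\<And>k. k \<le> n \<Longrightarrow> rr \<delta> k \<le> P / (8 * L)"
    "tt \<delta> 0 = 0" "tt \<delta> n = T"
    "\<And>j k. j \<le> n \<Longrightarrow> k \<le> n \<Longrightarrow> \<exists>l::int. rr \<delta> j / rr \<delta> k = 4 powi l"
    "\<And>j. 1 \<le> j \<Longrightarrow> j \<le> n \<Longrightarrow> rr \<delta> j = 2 * L * P * (hh \<delta> j)\<^sup>2"
    by (auto simp: nsteps_def abs_le_iff)
  show "tt \<delta> (Suc k) = tt \<delta> k + hh \<delta> (Suc k)" if "k < n" for k
    using a that by simp
qed

lemma alephE:
  assumes "\<delta> \<in> aleph T L P"
  obtains "1 \<le> nsteps \<delta>" "\<delta> \<in> aleph_n T L P (nsteps \<delta>)"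
  using assms aleph_nD(1) unfolding aleph_def by blast

locale tracking_data =
  fixes T L P :: real and X0 :: "(real^'n) set" and F :: "real^'n \<Rightarrow> (real^'n) set"
  assumes T_pos: "T > 0" and L_pos: "L > 0" and P_pos: "P > 0"
    and X0: "X0 \<noteq> {}" "compact X0" "path_connected X0"
    and F: "F x \<noteq> {} \<and> compact (F x) \<and> convex (F x)"
    and F_hausdist: "linf_hausdist (F x) (F y) \<le> ereal (L * infnorm (x - y))"
begin

lemma step_size_bound: "hh \<delta> j \<le> 1 / (4 * L) \<Longrightarrow> L * hh \<delta> j \<le> 1 / 4"
  using L_pos by (simp add: field_simps)

lemma euler_map_step: "\<delta> \<in> aleph_n T L P n \<Longrightarrow> k < n \<Longrightarrow> euler_map F L (hh \<delta> (Suc k))"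
  using F F_hausdist L_pos aleph_nD(5)[of \<delta> T L P n "Suc k"] aleph_nD(6)[of \<delta> T L P n "Suc k"]
    step_size_bound by unfold_locales auto

lemma discrete_reach_conn:
  assumes \<delta>: "\<delta> \<in> aleph_n T L P n" and "k \<le> n"
  shows "finite (discrete_reach L X0 F \<delta> k)" "discrete_reach L X0 F \<delta> k \<in> conn_grid_sets (rr \<delta> k)"
  using assms(2)
proof (induction k)
  case 0
  have r: "rr \<delta> 0 > 0" using aleph_nD(7)[OF \<delta>] by simp
  {
    case 1 then show ?case
      using r X0(2) by (simp add: grid_proj_def finite_grid_bounded bounded_linf_nbhd compact_imp_bounded)
  next
    case 2
    have "chain_connected (2 * (rr \<delta> 0 / 2)) X0"
      using r X0(3) by (intro connected_imp_chain_connected path_connected_imp_connected) auto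
    then show ?case using r X0(1) by (auto intro!: grid_proj_conn_grid_sets)
  }
next
  case (Suc k)
  {
    case 1
    then interpret euler_map F L "hh \<delta> (Suc k)" using euler_map_step[OF \<delta>] by simp
    have "k \<le> n" using 1 by simp
    show ?case unfolding discrete_reach.simps
      using Suc(1)[OF \<open>k \<le> n\<close>] aleph_nD(7)[OF \<delta> \<open>k \<le> n\<close>] aleph_nD(7)[OF \<delta> 1] by (rule finite_UN_Phi2)
  next
    case 2
    then interpret euler_map F L "hh \<delta> (Suc k)" using euler_map_step[OF \<delta>] by simp
    show ?case using 2 Suc aleph_nD(7)[OF \<delta>] by (simp add: UN_Phi2_conn)
  }
qed

lemma track_pair_eq:
  assumes \<delta>: "\<delta> \<in> aleph_n T L P n" and "k \<le> n"
  shows "track_pair L F \<delta> (initial_pair X0 \<delta>) k = tr (rr \<delta> k) (discrete_reach L X0 F \<delta> k)"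
  using assms(2)
proof (induction k)
  case 0 then show ?case by (simp add: initial_pair_def)
next
  case (Suc k)
  then interpret euler_map F L "hh \<delta> (Suc k)" using euler_map_step[OF \<delta>] by simp
  show ?case using Suc discrete_reach_conn[OF \<delta>, of k] aleph_nD(7)[OF \<delta>]
    by (simp add: fst_step_procedure)
qed

lemma tr_inv_discrete_reach:
  assumes \<delta>: "\<delta> \<in> aleph_n T L P n" and "k \<le> n"
  shows "tr_inv (rr \<delta> k) (tr (rr \<delta> k) (discrete_reach L X0 F \<delta> k)) = discrete_reach L X0 F \<delta> k"
  using tr_inv_tr conn_grid_sets_grid_sets[OF discrete_reach_conn(2)[OF assms]] aleph_nD(7)[OF assms] by blast

lemma tracking_ok_initial_pair:
  assumes \<delta>: "\<delta> \<in> aleph T L P"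
  shows "tracking_ok T L P F \<delta> (initial_pair X0 \<delta>)"
proof -
  obtain n where n: "n = nsteps \<delta>" "\<delta> \<in> aleph_n T L P n" using \<delta> alephE by metis
  have "track_pair L F \<delta> (initial_pair X0 \<delta>) k \<in> bdc (rr \<delta> k) \<and>
        (\<forall>j\<in>{-1..2}. finite (layer (rr \<delta> k) j (tr_inv (rr \<delta> k) (track_pair L F \<delta> (initial_pair X0 \<delta>) k))))"
    if "k \<le> n" for k
    unfolding track_pair_eq[OF n(2) that] tr_inv_discrete_reach[OF n(2) that]
    using discrete_reach_conn[OF n(2) that] aleph_nD(7)[OF n(2) that]
    by (auto simp: bdc_def conn_grid_sets_def grid_sets_def intro!: finite_layer)
  then show ?thesis using \<delta> n(1) by (auto simp: tracking_ok_def)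
qed

lemma Psi_discrete_reach:
  assumes \<delta>: "\<delta> \<in> aleph_n T L P n" and "1 \<le> k" "k \<le> n"
  shows "tr (rr \<delta> k) (discrete_reach L X0 F \<delta> k) = Psi L F (hh \<delta> k) (rr \<delta> (k - 1)) (rr \<delta> k)
           (tr (rr \<delta> (k - 1)) (discrete_reach L X0 F \<delta> (k - 1)))"
proof -
  obtain m where m: "k = Suc m" using assms(2) by (cases k) auto
  then show ?thesis using tr_inv_discrete_reach[OF \<delta>, of m] assms(3) by (simp add: Psi_def)
qed

end

section \<open>The weight function\<close>

text \<open>With \<open>x = L * h\<close>, the factor of \<open>\<rho> / 4\<close> increases from 7
  at \<open>x = 0\<close> to \<open>115 / 12 < 10\<close> at \<open>x = 1 / 4\<close>.\<close>

lemma sigma_bounds: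
  assumes "L * h \<le> 1 / 4" "0 \<le> L * h" "\<rho> > 0"
  shows "7 / 4 * \<rho> \<le> sigma L h \<rho>" "sigma L h \<rho> \<le> 10 / 4 * \<rho>"
proof -
  define x where "x = L * h"
  have x: "0 \<le> x" "x \<le> 1 / 4" using assms by (auto simp: x_def)
  have q: "1 \<le> (1 + x) / (1 - x)" "(1 + x) / (1 - x) \<le> 5 / 3" using x by (auto simp: field_simps)
  have "1 * (1 + 6) \<le> (1 + x) * ((1 + x) / (1 - x) + 6)" using x q by (intro mult_mono) auto
  then have "\<rho> / 4 * (1 * (1 + 6)) \<le> \<rho> / 4 * ((1 + x) * ((1 + x) / (1 - x) + 6))"
    using assms(3) by (intro mult_left_mono) auto
  then show "7 / 4 * \<rho> \<le> sigma L h \<rho>" by (simp add: sigma_def x_def mult.assoc)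
  have "(1 + x) * ((1 + x) / (1 - x) + 6) \<le> (5 / 4) * (5 / 3 + 6)" using x q by (intro mult_mono) auto
  then have "\<rho> / 4 * ((1 + x) * ((1 + x) / (1 - x) + 6)) \<le> \<rho> / 4 * ((5 / 4) * (5 / 3 + 6))"
    using assms(3) by (intro mult_left_mono) auto
  moreover have "\<rho> / 4 * ((5 / 4) * (5 / 3 + 6)) \<le> 10 / 4 * \<rho>" using assms(3) by simp
  ultimately show "sigma L h \<rho> \<le> 10 / 4 * \<rho>" unfolding sigma_def x_def mult.assoc by linarith
qed

lemma tt_mono:
  assumes \<delta>: "\<delta> \<in> aleph_n T L P n" and "j \<le> k" "k \<le> n"
  shows "tt \<delta> j \<le> tt \<delta> k"
  using assms(2,3)
proof (induction k rule: dec_induct)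
  case (step m)
  then show ?case using aleph_nD(5)[OF \<delta>, of "Suc m"] aleph_nD(11)[OF \<delta>, of m] by simp
qed simp

lemma tt_range:
  assumes \<delta>: "\<delta> \<in> aleph_n T L P n" and "k \<le> n"
  shows "0 \<le> tt \<delta> k" "tt \<delta> k \<le> T"
  using tt_mono[OF \<delta>, of 0 k] tt_mono[OF \<delta>, of k n] assms aleph_nD(9,10)[OF \<delta>] by auto

text \<open>At an inner node \<open>GREATEST\<close> already selects the next piece, but both
  formulas give \<open>v (Suc k)\<close> there. At the last node the restriction to indices below
  \<open>n\<close> keeps the last piece.\<close>

lemma pl_interp_piece:
  assumes \<delta>: "\<delta> \<in> aleph_n T L P n" and k: "k < n" and s: "tt \<delta> k \<le> s" "s \<le> tt \<delta> (Suc k)"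
  shows "pl_interp \<delta> v s = v k + (s - tt \<delta> k) / hh \<delta> (Suc k) * (v (Suc k) - v k)"
proof -
  note D = aleph_nD[OF \<delta>]
  have greatest: "(GREATEST i. i < n \<and> tt \<delta> i \<le> s) = i"
    if "i < n" "tt \<delta> i \<le> s" "Suc i < n \<Longrightarrow> s < tt \<delta> (Suc i)" for i
  proof (rule Greatest_equality)
    fix j assume j: "j < n \<and> tt \<delta> j \<le> s"
    show "j \<le> i"
    proof (rule ccontr)
      assume "\<not> j \<le> i"
      then show False using tt_mono[OF \<delta>, of "Suc i" j] that(3) j by simp
    qed
  qed (use that in auto)
  have h: "hh \<delta> (Suc k) > 0" "tt \<delta> (Suc k) = tt \<delta> k + hh \<delta> (Suc k)" using D(5) D(11) k by simp_all
  show ?thesis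
  proof (cases "Suc k < n \<and> s = tt \<delta> (Suc k)")
    case True
    then have "hh \<delta> (Suc (Suc k)) > 0" "tt \<delta> (Suc (Suc k)) = tt \<delta> (Suc k) + hh \<delta> (Suc (Suc k))"
      using D(5) D(11) by simp_all
    then have "(GREATEST i. i < n \<and> tt \<delta> i \<le> s) = Suc k" using True by (intro greatest) auto
    then show ?thesis using True h by (simp add: pl_interp_def D(1))
  next
    case False
    then have "(GREATEST i. i < n \<and> tt \<delta> i \<le> s) = k" using s k by (intro greatest) auto
    then show ?thesis using h by (simp add: pl_interp_def D(1))
  qed
qed

lemma tt_piece:
  assumes \<delta>: "\<delta> \<in> aleph_n T L P n" and "k \<le> n" "0 \<le> s" "s \<le> tt \<delta> k" "1 \<le> k"
  shows "\<exists>i<k. tt \<delta> i \<le> s \<and> s \<le> tt \<delta> (Suc i)"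
  using assms(2-)
proof (induction k)
  case (Suc k)
  show ?case
  proof (cases "s \<le> tt \<delta> k \<and> 1 \<le> k")
    case True then show ?thesis using Suc by (auto intro: less_SucI)
  next
    case False
    then have "tt \<delta> k \<le> s" using Suc.prems aleph_nD(9)[OF \<delta>] by (cases k) auto
    then show ?thesis using Suc.prems by auto
  qed
qed simp

lemma pl_interp_continuous_pos:
  assumes \<delta>: "\<delta> \<in> aleph_n T L P n" and n: "1 \<le> n" and v: "\<And>k. k \<le> n \<Longrightarrow> v k > 0"
  shows "continuous_on {0..T} (pl_interp \<delta> v)" "\<And>s. s \<in> {0..T} \<Longrightarrow> pl_interp \<delta> v s > 0"
proof -
  note D = aleph_nD[OF \<delta>]
  have piece: "continuous_on {tt \<delta> k..tt \<delta> (Suc k)} (pl_interp \<delta> v)" if k: "k < n" for k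
  proof -
    have "continuous_on {tt \<delta> k..tt \<delta> (Suc k)}
        (\<lambda>s. v k + (s - tt \<delta> k) / hh \<delta> (Suc k) * (v (Suc k) - v k))"
      using D(5)[of "Suc k"] k by (intro continuous_intros) auto
    moreover have "pl_interp \<delta> v s = v k + (s - tt \<delta> k) / hh \<delta> (Suc k) * (v (Suc k) - v k)"
      if "s \<in> {tt \<delta> k..tt \<delta> (Suc k)}" for s
      using pl_interp_piece[OF \<delta> k] that by simp
    ultimately show ?thesis by (simp cong: continuous_on_cong_simp)
  qed
  have "continuous_on {0..tt \<delta> k} (pl_interp \<delta> v)" if "k \<le> n" for k
    using that
  proof (induction k)
    case 0 then show ?case by (simp add: D(9))
  next
    case (Suc k)
    have "{0..tt \<delta> (Suc k)} = {0..tt \<delta> k} \<union> {tt \<delta> k..tt \<delta> (Suc k)}"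
      using tt_range[OF \<delta>, of k] tt_mono[OF \<delta>, of k "Suc k"] Suc.prems by auto
    then show ?case using Suc piece[of k] by (auto intro!: continuous_on_closed_Un)
  qed
  then show "continuous_on {0..T} (pl_interp \<delta> v)" using D(10) by force
  fix s assume "s \<in> {0..T}"
  then obtain k where k: "k < n" "tt \<delta> k \<le> s" "s \<le> tt \<delta> (Suc k)"
    using tt_piece[OF \<delta>, of n s] n D(10) by auto
  define q where "q = (s - tt \<delta> k) / hh \<delta> (Suc k)"
  have q: "0 \<le> q" "q \<le> 1" using k D(5)[of "Suc k"] D(11)[of k] by (auto simp: q_def field_simps)
  have "pl_interp \<delta> v s = (1 - q) * v k + q * v (Suc k)"
    using pl_interp_piece[OF \<delta> k] by (simp add: q_def[symmetric] algebra_simps)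
  also have "\<dots> > 0"
  proof (cases "q = 0")
    case False
    then show ?thesis using q v[of k] v[of "Suc k"] k(1) by (intro add_nonneg_pos mult_pos_pos) auto
  qed (use v k(1) in auto)
  finally show "pl_interp \<delta> v s > 0" .
qed

context tracking_data
begin

lemma vhat_pos:
  assumes \<delta>: "\<delta> \<in> aleph_n T L P n" and n: "1 \<le> n" and k: "k \<le> n"
  shows "vhat_R L F dR \<delta> (initial_pair X0 \<delta>) k > 0" "vhat_F L F dF \<delta> (initial_pair X0 \<delta>) k > 0"
proof -
  note D = aleph_nD[OF \<delta>]
  let ?D = "initial_pair X0 \<delta>"
  have counts: "fst (track_counts L F \<delta> ?D i) > 0" "snd (track_counts L F \<delta> ?D i) > 0" if "i < n" for i
  proof -
    interpret euler_map F L "hh \<delta> (Suc i)" using euler_map_step[OF \<delta>] that by simp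
    show "fst (track_counts L F \<delta> ?D i) > 0" "snd (track_counts L F \<delta> ?D i) > 0"
      using step_procedure_counts_pos[OF discrete_reach_conn[OF \<delta>, of i]] D(7) that
      by (simp_all add: track_counts_def track_pair_eq[OF \<delta>])
  qed
  have "track_cR L F \<delta> ?D k > 0"
  proof (cases "k < n")
    case True then show ?thesis using counts by (simp add: track_cR_def D(1))
  next
    case False
    let ?M = "discrete_reach L X0 F \<delta> k"
    have M: "finite ?M" "?M \<noteq> {}" "?M \<subseteq> grid (rr \<delta> k)"
      using discrete_reach_conn[OF \<delta> k] by (auto simp: conn_grid_sets_def grid_sets_def)
    have "card (layer (rr \<delta> k) 0 ?M) > 0"
      using layer_nonempty(1)[OF M] finite_layer[of "rr \<delta> k" ?M 0] M D(7)[OF k]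
      by (simp add: layer_def card_gt_0_iff)
    moreover have "card (layer (rr \<delta> k) 0 ?M) \<le> (\<Sum>j\<in>{-1..2}. card (layer (rr \<delta> k) j ?M))"
      by (rule member_le_sum) auto
    ultimately show ?thesis
      using False by (simp add: track_cR_def D(1) track_pair_eq[OF \<delta> k] tr_inv_discrete_reach[OF \<delta> k])
  qed
  then show "vhat_R L F dR \<delta> ?D k > 0" using D(7)[OF k] by (simp add: vhat_R_def)
  define i where "i = (if k < n then k else n - 1)"
  have i: "i < n" using n by (auto simp: i_def)
  have "sigma L (hh \<delta> (Suc i)) (rr \<delta> i) > 0"
    using sigma_bounds(1)[of L "hh \<delta> (Suc i)" "rr \<delta> i"] D(5)[of "Suc i"] D(6)[of "Suc i"] D(7)[of i] i
      L_pos step_size_bound[of \<delta> "Suc i"] by simp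
  moreover have "min (rr \<delta> i) (rr \<delta> (Suc i)) > 0" "hh \<delta> (Suc i) > 0"
    using D(5)[of "Suc i"] D(7)[of i] D(7)[of "Suc i"] i by simp_all
  ultimately show "vhat_F L F dF \<delta> ?D k > 0"
    unfolding vhat_F_def Let_def D(1) i_def[symmetric] using counts[OF i]
    by (intro mult_pos_pos divide_pos_pos zero_less_power) simp_all
qed

end

section \<open>Subdivision\<close>

lemma nth_replace_two:
  assumes "j < length xs" "i \<le> length xs"
  shows "(take j xs @ [a, b] @ drop (Suc j) xs) ! i =
    (if i < j then xs ! i else if i = j then a else if i = Suc j then b else xs ! (i - 1))"
proof -
  consider "i < j" | "i = j" | "i = Suc j" | m where "i = Suc (Suc (j + m))"
    by (metis add_Suc_right less_iff_Suc_add linorder_neqE_nat not_less_eq)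
  then show ?thesis using assms by cases (auto simp: nth_append)
qed

lemma nth_insert_one:
  assumes "j < length xs" "i \<le> length xs"
  shows "(take j xs @ [a] @ drop j xs) ! i = (if i < j then xs ! i else if i = j then a else xs ! (i - 1))"
proof -
  consider "i < j" | "i = j" | m where "i = Suc (j + m)"
    by (metis less_iff_Suc_add linorder_neqE_nat)
  then show ?thesis using assms by cases (auto simp: nth_append)
qed

context
  fixes \<delta> :: discretization and T L P :: real and n :: nat
  assumes \<delta>: "\<delta> \<in> aleph_n T L P n"
begin

lemma rr_subdivide_0: "k \<le> n \<Longrightarrow> rr (subdivide \<delta> 0) k = (if k = 0 then rr \<delta> 0 / 4 else rr \<delta> k)"
  using aleph_nD(4)[OF \<delta>] by (simp add: rr_def subdivide_def nth_list_update)

lemma hh_subdivide_0: "hh (subdivide \<delta> 0) = hh \<delta>"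
  by (rule ext) (simp add: hh_def subdivide_def)

lemma tt_subdivide_0: "tt (subdivide \<delta> 0) = tt \<delta>"
  by (rule ext) (simp add: tt_def subdivide_def)

lemma nsteps_subdivide: "j \<le> n \<Longrightarrow> nsteps (subdivide \<delta> j) = (if j = 0 then n else Suc n)"
  using aleph_nD(2)[OF \<delta>] by (auto simp: nsteps_def subdivide_def)

context
  fixes j :: nat
  assumes j: "1 \<le> j" "j \<le> n"
begin

lemma hh_subdivide:
  assumes "1 \<le> i" "i \<le> Suc n"
  shows "hh (subdivide \<delta> j) i =
    (if i < j then hh \<delta> i else if i \<le> Suc j then hh \<delta> j / 2 else hh \<delta> (i - 1))"
proof -
  have "hh (subdivide \<delta> j) i = (take (j - 1) (step_sizes \<delta>) @ [hh \<delta> j / 2, hh \<delta> j / 2]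
      @ drop (Suc (j - 1)) (step_sizes \<delta>)) ! (i - 1)"
    using j by (simp add: hh_def[of "subdivide \<delta> j"]) (simp add: subdivide_def)
  also have "\<dots> = (if i - 1 < j - 1 then step_sizes \<delta> ! (i - 1) else if i - 1 = j - 1 then hh \<delta> j / 2
      else if i - 1 = Suc (j - 1) then hh \<delta> j / 2 else step_sizes \<delta> ! (i - 1 - 1))"
    using j assms aleph_nD(2)[OF \<delta>] by (intro nth_replace_two) auto
  also have "\<dots> = (if i < j then hh \<delta> i else if i \<le> Suc j then hh \<delta> j / 2 else hh \<delta> (i - 1))"
    using j assms by (auto simp: hh_def)
  finally show ?thesis .
qed

lemma rr_subdivide:
  assumes "i \<le> Suc n"
  shows "rr (subdivide \<delta> j) i =
    (if i < j then rr \<delta> i else if i \<le> Suc j then rr \<delta> j / 4 else rr \<delta> (i - 1))"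
proof -
  have "rr (subdivide \<delta> j) i = (take j (meshes \<delta>) @ [rr \<delta> j / 4, rr \<delta> j / 4] @ drop (Suc j) (meshes \<delta>)) ! i"
    using j by (simp add: rr_def[of "subdivide \<delta> j"]) (simp add: subdivide_def)
  also have "\<dots> = (if i < j then meshes \<delta> ! i else if i = j then rr \<delta> j / 4
      else if i = Suc j then rr \<delta> j / 4 else meshes \<delta> ! (i - 1))"
    using j assms aleph_nD(4)[OF \<delta>] by (intro nth_replace_two) auto
  also have "\<dots> = (if i < j then rr \<delta> i else if i \<le> Suc j then rr \<delta> j / 4 else rr \<delta> (i - 1))"
    by (auto simp: rr_def)
  finally show ?thesis .
qed

lemma tt_subdivide:
  assumes "i \<le> Suc n"
  shows "tt (subdivide \<delta> j) i =
    (if i < j then tt \<delta> i else if i = j then tt \<delta> j - hh \<delta> j / 2 else tt \<delta> (i - 1))"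
proof -
  have "tt (subdivide \<delta> j) i = (take j (nodes \<delta>) @ [tt \<delta> j - hh \<delta> j / 2] @ drop j (nodes \<delta>)) ! i"
    using j by (simp add: tt_def[of "subdivide \<delta> j"]) (simp add: subdivide_def)
  also have "\<dots> = (if i < j then nodes \<delta> ! i else if i = j then tt \<delta> j - hh \<delta> j / 2 else nodes \<delta> ! (i - 1))"
    using j assms aleph_nD(3)[OF \<delta>] by (intro nth_insert_one) auto
  finally show ?thesis by (simp add: tt_def)
qed

end

end

lemma subdivide_values:
  assumes \<delta>: "\<delta> \<in> aleph_n T L P n" and j: "1 \<le> j" "j \<le> n"
  shows "hh (subdivide \<delta> j) j = hh \<delta> j / 2" "hh (subdivide \<delta> j) (Suc j) = hh \<delta> j / 2"
    "rr (subdivide \<delta> j) (j - 1) = rr \<delta> (j - 1)" "rr (subdivide \<delta> j) j = rr \<delta> j / 4"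
    "rr (subdivide \<delta> j) (Suc j) = rr \<delta> j / 4"
    "tt (subdivide \<delta> j) (j - 1) = tt \<delta> (j - 1)" "tt (subdivide \<delta> j) j = tt \<delta> j - hh \<delta> j / 2"
    "tt (subdivide \<delta> j) (Suc j) = tt \<delta> j"
    "j < n \<Longrightarrow> hh (subdivide \<delta> j) (Suc (Suc j)) = hh \<delta> (Suc j)"
    "j < n \<Longrightarrow> rr (subdivide \<delta> j) (Suc (Suc j)) = rr \<delta> (Suc j)"
    "j < n \<Longrightarrow> tt (subdivide \<delta> j) (Suc (Suc j)) = tt \<delta> (Suc j)"
  using j by (simp_all add: hh_subdivide[OF \<delta> j] rr_subdivide[OF \<delta> j] tt_subdivide[OF \<delta> j])

text \<open>A common reference mesh \<open>c\<close> replaces the condition on all pairs of meshes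
  by one condition on each mesh.\<close>

lemma aleph_nI:
  assumes "length (step_sizes \<delta>) = n" "length (nodes \<delta>) = Suc n" "length (meshes \<delta>) = Suc n"
    "\<And>j. 1 \<le> j \<Longrightarrow> j \<le> n \<Longrightarrow> 0 < hh \<delta> j \<and> hh \<delta> j \<le> 1 / (4 * L) \<and> rr \<delta> j = 2 * L * P * (hh \<delta> j)\<^sup>2"
    "\<And>k. k \<le> n \<Longrightarrow> 0 < rr \<delta> k \<and> rr \<delta> k \<le> P / (8 * L) \<and> (\<exists>l::int. rr \<delta> k = c * 4 powi l)"
    "tt \<delta> 0 = 0" "\<And>k. k < n \<Longrightarrow> tt \<delta> (Suc k) = tt \<delta> k + hh \<delta> (Suc k)" "tt \<delta> n = T" "c > 0"
  shows "\<delta> \<in> aleph_n T L P n"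
proof -
  have "tt \<delta> k = (\<Sum>j=1..k. hh \<delta> j)" if "k \<le> n" for k
    using that by (induction k) (use assms(6,7) in auto)
  moreover have "\<exists>l::int. rr \<delta> j / rr \<delta> k = 4 powi l" if "j \<le> n" "k \<le> n" for j k
  proof -
    obtain l m :: int where "rr \<delta> j = c * 4 powi l" "rr \<delta> k = c * 4 powi m"
      using assms(5)[OF \<open>j \<le> n\<close>] assms(5)[OF \<open>k \<le> n\<close>] by blast
    then have "rr \<delta> j / rr \<delta> k = 4 powi (l - m)" using assms(9) by (simp add: power_int_diff)
    then show ?thesis by blast
  qed
  moreover have "\<bar>hh \<delta> j\<bar> \<le> 1 / (4 * L)" if "1 \<le> j" "j \<le> n" for j
    using assms(4)[OF that] by simp
  moreover have "\<bar>rr \<delta> k\<bar> \<le> P / (8 * L)" if "k \<le> n" for k using assms(5)[OF that] by simp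
  ultimately show ?thesis using assms unfolding aleph_n_def by simp
qed

text \<open>Halving a step and quartering its mesh preserves
  \<open>\<rho> = 2 * L * P * h\<^sup>2\<close>, and quartering stays within the powers of
  4.\<close>

lemma subdivide_aleph_n:
  assumes \<delta>: "\<delta> \<in> aleph_n T L P n" and j: "j \<le> n" and pos: "L > 0" "P > 0"
  shows "subdivide \<delta> j \<in> aleph_n T L P (if j = 0 then n else Suc n)"
proof -
  note D = aleph_nD[OF \<delta>]
  have pow4: "\<exists>l::int. rr \<delta> k = rr \<delta> 0 * 4 powi l" "\<exists>l::int. rr \<delta> k / 4 = rr \<delta> 0 * 4 powi l" if k: "k \<le> n" for k
  proof -
    obtain l :: int where "rr \<delta> k / rr \<delta> 0 = 4 powi l" using D(12)[OF k le0] by blast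
    then have l: "rr \<delta> k = rr \<delta> 0 * 4 powi l" using D(7)[of 0] by (simp add: field_simps)
    then show "\<exists>l::int. rr \<delta> k = rr \<delta> 0 * 4 powi l" by blast
    have "rr \<delta> k / 4 = rr \<delta> 0 * 4 powi (l - 1)" using l by (simp add: power_int_diff)
    then show "\<exists>l::int. rr \<delta> k / 4 = rr \<delta> 0 * 4 powi l" by blast
  qed
  show ?thesis
  proof (cases "j = 0")
    case True
    show ?thesis
      unfolding True if_P[OF refl]
    proof (rule aleph_nI[where c = "rr \<delta> 0"])
      fix k assume "k \<le> n"
      then show "0 < rr (subdivide \<delta> 0) k \<and> rr (subdivide \<delta> 0) k \<le> P / (8 * L) \<and>
          (\<exists>l::int. rr (subdivide \<delta> 0) k = rr \<delta> 0 * 4 powi l)"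
        using D(7)[of k] D(8)[of k] pow4[of k] by (auto simp: rr_subdivide_0[OF \<delta>])
    next
      show "length (step_sizes (subdivide \<delta> 0)) = n" "length (nodes (subdivide \<delta> 0)) = Suc n"
        "length (meshes (subdivide \<delta> 0)) = Suc n"
        using D(2,3,4) by (simp_all add: subdivide_def)
    qed (use D in \<open>simp_all add: rr_subdivide_0[OF \<delta>] hh_subdivide_0[OF \<delta>] tt_subdivide_0[OF \<delta>]\<close>)
  next
    case False
    then have j1: "1 \<le> j" by simp
    note H = hh_subdivide[OF \<delta> j1 j] and R = rr_subdivide[OF \<delta> j1 j] and S = tt_subdivide[OF \<delta> j1 j]
    show ?thesis
      unfolding if_not_P[OF False]
    proof (rule aleph_nI[where c = "rr \<delta> 0"])
      show "length (step_sizes (subdivide \<delta> j)) = Suc n" "length (nodes (subdivide \<delta> j)) = Suc (Suc n)"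
        "length (meshes (subdivide \<delta> j)) = Suc (Suc n)"
        using D(2,3,4) j j1 by (auto simp: subdivide_def)
      fix i assume i: "1 \<le> i" "i \<le> Suc n"
      have base: "0 < hh \<delta> m \<and> hh \<delta> m \<le> 1 / (4 * L) \<and> rr \<delta> m = 2 * L * P * (hh \<delta> m)\<^sup>2"
        if "1 \<le> m" "m \<le> n" for m
        using D(5,6,13) that by blast
      have "0 < hh \<delta> j / 2 \<and> hh \<delta> j / 2 \<le> 1 / (4 * L) \<and> rr \<delta> j / 4 = 2 * L * P * (hh \<delta> j / 2)\<^sup>2"
        using base[OF j1 j] by (auto simp: power_divide)
      then show "0 < hh (subdivide \<delta> j) i \<and> hh (subdivide \<delta> j) i \<le> 1 / (4 * L) \<and>
          rr (subdivide \<delta> j) i = 2 * L * P * (hh (subdivide \<delta> j) i)\<^sup>2"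
        using H[OF i] R[OF i(2)] base[of i] base[of "i - 1"] i j by auto
    next
      fix i assume i: "i \<le> Suc n"
      have "0 < rr \<delta> j / 4" "rr \<delta> j / 4 \<le> P / (8 * L)" using D(7)[OF j] D(8)[OF j] by linarith+
      then show "0 < rr (subdivide \<delta> j) i \<and> rr (subdivide \<delta> j) i \<le> P / (8 * L) \<and>
          (\<exists>l::int. rr (subdivide \<delta> j) i = rr \<delta> 0 * 4 powi l)"
        unfolding R[OF i] using i j D(7)[of i] D(8)[of i] D(7)[of "i - 1"] D(8)[of "i - 1"]
          pow4[of i] pow4[of j] pow4[of "i - 1"] by auto
    next
      show "tt (subdivide \<delta> j) 0 = 0" using S[of 0] j1 D(9) by simp
      show "tt (subdivide \<delta> j) (Suc n) = T" using S[of "Suc n"] j D(10) by simp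
      show "rr \<delta> 0 > 0" using D(7) by simp
      fix k assume k: "k < Suc n"
      consider "Suc k < j" | "Suc k = j" | "k = j" | "k > j" by linarith
      then show "tt (subdivide \<delta> j) (Suc k) = tt (subdivide \<delta> j) k + hh (subdivide \<delta> j) (Suc k)"
      proof cases
        case 4
        then obtain m where "k = Suc m" by (cases k) auto
        then show ?thesis using 4 k S[of k] S[of "Suc k"] H[of "Suc k"] D(11)[of m] by auto
      qed (use k j S[of k] S[of "Suc k"] H[of "Suc k"] D(11)[of k] in auto)
    qed
  qed
qed

text \<open>For sums whose summand at \<open>i\<close> depends on the cells \<open>i - 1\<close> and
  \<open>i\<close>: the summand of cell \<open>j\<close> splits, that of its right neighbour
  changes, and all others at most shift. Used for the error, the cost and the potential that counts
  large picks.\<close>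

lemma sum_subdivide:
  fixes f g :: "nat \<Rightarrow> real"
  assumes j: "1 \<le> j" "j \<le> n" and lo: "\<And>i. i < j \<Longrightarrow> g i = f i"
    and hi: "\<And>i. Suc j < i \<Longrightarrow> i \<le> n \<Longrightarrow> g (Suc i) = f i"
  shows "(\<Sum>i=0..Suc n. g i) - (\<Sum>i=0..n. f i) =
    g j + g (Suc j) - f j + (if j < n then g (Suc (Suc j)) - f (Suc j) else 0)"
proof -
  have "(\<Sum>i=0..Suc n. g i) - (\<Sum>i=0..n. f i) =
    (\<Sum>i<j. g i) + (\<Sum>i\<in>{j..<n}. g (Suc (Suc i))) + g j + g (Suc j) - ((\<Sum>i<j. f i) + f j + (\<Sum>i\<in>{j..<n}. f (Suc i)))"
  proof -
    have "{0..Suc n} = {..<j} \<union> {j, Suc j} \<union> (\<lambda>i. Suc (Suc i)) ` {j..<n}"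
    proof (intro equalityI subsetI)
      fix i assume "i \<in> {0..Suc n}"
      then have "i < j \<or> i = j \<or> i = Suc j \<or> (\<exists>m\<in>{j..<n}. i = Suc (Suc m))"
        by (cases i; cases "i - 1") (auto intro: bexI[of _ "i - 2"])
      then show "i \<in> {..<j} \<union> {j, Suc j} \<union> (\<lambda>i. Suc (Suc i)) ` {j..<n}" by auto
    qed (use j in auto)
    then have "(\<Sum>i=0..Suc n. g i) = (\<Sum>i\<in>{..<j} \<union> {j, Suc j}. g i) + (\<Sum>i\<in>(\<lambda>i. Suc (Suc i)) ` {j..<n}. g i)"
      by (simp only:) (intro sum.union_disjoint, auto)
    also have "(\<Sum>i\<in>{..<j} \<union> {j, Suc j}. g i) = (\<Sum>i<j. g i) + (g j + g (Suc j))"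
      by (subst sum.union_disjoint) auto
    also have "(\<Sum>i\<in>(\<lambda>i. Suc (Suc i)) ` {j..<n}. g i) = (\<Sum>i\<in>{j..<n}. g (Suc (Suc i)))"
      by (subst sum.reindex) (auto simp: inj_on_def)
    finally have g: "(\<Sum>i=0..Suc n. g i) = (\<Sum>i<j. g i) + (g j + g (Suc j)) + (\<Sum>i\<in>{j..<n}. g (Suc (Suc i)))" .
    have "{0..n} = {..<j} \<union> {j} \<union> Suc ` {j..<n}"
    proof (intro equalityI subsetI)
      fix i assume "i \<in> {0..n}"
      then have "i < j \<or> i = j \<or> (\<exists>m\<in>{j..<n}. i = Suc m)"
        by (cases i) (auto intro: bexI[of _ "i - 1"])
      then show "i \<in> {..<j} \<union> {j} \<union> Suc ` {j..<n}" by auto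
    qed (use j in auto)
    then have "(\<Sum>i=0..n. f i) = (\<Sum>i\<in>{..<j} \<union> {j}. f i) + (\<Sum>i\<in>Suc ` {j..<n}. f i)"
      by (simp only:) (intro sum.union_disjoint, auto)
    also have "(\<Sum>i\<in>{..<j} \<union> {j}. f i) = (\<Sum>i<j. f i) + f j"
      by (subst sum.union_disjoint) auto
    also have "(\<Sum>i\<in>Suc ` {j..<n}. f i) = (\<Sum>i\<in>{j..<n}. f (Suc i))"
      by (subst sum.reindex) auto
    finally show ?thesis using g by simp
  qed
  moreover have "(\<Sum>i<j. g i) = (\<Sum>i<j. f i)" using lo by (intro sum.cong) auto
  moreover have "(\<Sum>i\<in>{j..<n}. g (Suc (Suc i))) - (\<Sum>i\<in>{j..<n}. f (Suc i)) =
      (if j < n then g (Suc (Suc j)) - f (Suc j) else 0)"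
  proof (cases "j < n")
    case True
    then have "(\<Sum>i\<in>{j..<n}. g (Suc (Suc i))) = g (Suc (Suc j)) + (\<Sum>i\<in>{Suc j..<n}. g (Suc (Suc i)))"
      "(\<Sum>i\<in>{j..<n}. f (Suc i)) = f (Suc j) + (\<Sum>i\<in>{Suc j..<n}. f (Suc i))"
      by (simp_all add: sum.atLeast_Suc_lessThan)
    moreover have "(\<Sum>i\<in>{Suc j..<n}. g (Suc (Suc i))) = (\<Sum>i\<in>{Suc j..<n}. f (Suc i))"
      using hi by (intro sum.cong) auto
    ultimately show ?thesis using True by simp
  qed simp
  ultimately show ?thesis by simp
qed

locale rates =
  fixes T L P :: real
  assumes T_pos: "T > 0" and L_pos: "L > 0" and P_pos: "P > 0"
begin

text \<open>The mesh size \<open>\<rho>\<^sub>0\<close> is not tied to a step; \<open>eff_step \<delta> 0\<close> is the step size that it would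
  correspond to, so that \<open>\<rho>\<^sub>k = 2LPh\<^sub>k\<^sup>2\<close> holds for all \<open>k\<close>.\<close>

definition eff_step :: "discretization \<Rightarrow> nat \<Rightarrow> real" where
  "eff_step \<delta> k = sqrt (rr \<delta> k / (2 * L * P))"

lemma eff_step_eq_iff: "h \<ge> 0 \<Longrightarrow> rr \<delta> k = 2 * L * P * h\<^sup>2 \<Longrightarrow> eff_step \<delta> k = h"
  using L_pos P_pos by (simp add: eff_step_def)

lemma eff_step_hh:
  assumes "\<delta> \<in> aleph_n T L P n" "1 \<le> k" "k \<le> n"
  shows "eff_step \<delta> k = hh \<delta> k"
  using aleph_nD(5)[OF assms] aleph_nD(13)[OF assms] by (intro eff_step_eq_iff) auto

lemma eff_step:
  assumes \<delta>: "\<delta> \<in> aleph_n T L P n" and "k \<le> n"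
  shows "eff_step \<delta> k > 0" "rr \<delta> k = 2 * L * P * (eff_step \<delta> k)\<^sup>2" "eff_step \<delta> k \<le> 1 / (4 * L)"
proof -
  have r: "rr \<delta> k > 0" "rr \<delta> k \<le> P / (8 * L)" using aleph_nD(7,8)[OF assms] by auto
  then show "eff_step \<delta> k > 0" "rr \<delta> k = 2 * L * P * (eff_step \<delta> k)\<^sup>2"
    using L_pos P_pos by (simp_all add: eff_step_def)
  have "rr \<delta> k / (2 * L * P) \<le> (P / (8 * L)) / (2 * L * P)"
    using r L_pos P_pos by (intro divide_right_mono) auto
  also have "\<dots> = (1 / (4 * L))\<^sup>2" using L_pos P_pos by (simp add: field_simps power2_eq_square)
  finally show "eff_step \<delta> k \<le> 1 / (4 * L)"
    using L_pos unfolding eff_step_def by (intro real_le_lsqrt) auto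
qed

lemma eff_step_subdivide_0:
  assumes \<delta>: "\<delta> \<in> aleph_n T L P n" and "k \<le> n"
  shows "eff_step (subdivide \<delta> 0) k = (if k = 0 then eff_step \<delta> 0 / 2 else eff_step \<delta> k)"
proof (cases "k = 0")
  case True
  have "eff_step (subdivide \<delta> 0) 0 = eff_step \<delta> 0 / 2"
    using eff_step(1,2)[OF \<delta>, of 0] rr_subdivide_0[OF \<delta>, of 0]
    by (intro eff_step_eq_iff) (auto simp: power_divide)
  then show ?thesis using True by simp
qed (simp add: eff_step_def rr_subdivide_0[OF assms])

lemma eff_step_subdivide:
  assumes \<delta>: "\<delta> \<in> aleph_n T L P n" and j: "1 \<le> j" "j \<le> n" and "i \<le> Suc n"
  shows "eff_step (subdivide \<delta> j) i =
    (if i < j then eff_step \<delta> i else if i \<le> Suc j then eff_step \<delta> j / 2 else eff_step \<delta> (i - 1))"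
proof (cases "j \<le> i \<and> i \<le> Suc j")
  case True
  then have "eff_step (subdivide \<delta> j) i = eff_step \<delta> j / 2"
    using eff_step(1,2)[OF \<delta> j(2)] rr_subdivide[OF \<delta> j assms(4)]
    by (intro eff_step_eq_iff) (auto simp: power_divide)
  then show ?thesis using True by simp
qed (simp add: eff_step_def rr_subdivide[OF \<delta> j assms(4)])

section \<open>Error increments\<close>

definition err_term :: "real \<Rightarrow> real \<Rightarrow> real \<Rightarrow> real \<Rightarrow> real" where
  "err_term t h \<rho> \<rho>' = exp (L * (T - t)) * ((exp (L * h) - 1) *
     (P * h + (1 + L * h)\<^sup>2 / (L * h) * (\<rho> / 2)) + (if \<rho> < \<rho>' then \<rho>' / 2 else 0))"

lemma local_error_Suc:
  "local_error T L P \<delta> (Suc k) = err_term (tt \<delta> (Suc k)) (hh \<delta> (Suc k)) (rr \<delta> k) (rr \<delta> (Suc k))"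
  by (simp add: local_error_def err_term_def chi_def)

text \<open>The coefficient of half the left mesh in a local error, as a function of
  \<open>L * h\<close>; it tends to 1 at 0.\<close>

definition growth :: "real \<Rightarrow> real" where
  "growth x = (exp x - 1) * (1 + x)\<^sup>2 / x"

lemma err_term_growth:
  "err_term t h \<rho> \<rho>' = exp (L * (T - t)) * ((exp (L * h) - 1) * P * h + growth (L * h) * (\<rho> / 2) +
     (if \<rho> < \<rho>' then \<rho>' / 2 else 0))"
  by (simp add: err_term_def growth_def distrib_left mult.assoc)

lemma exp_bounds:
  assumes "0 \<le> x" "x \<le> (1::real)"
  shows "1 + x + x\<^sup>2 / 2 \<le> exp x" "exp x \<le> 1 + x + x\<^sup>2"
  using exp_lower_Taylor_quadratic[OF assms(1)] exp_bound[OF assms] by auto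

text \<open>The lower bound keeps the exact first order term \<open>5 / 2 * x\<close>, which the
  second order analysis needs; for the upper bound a crude constant suffices.\<close>

lemma growth_bounds:
  assumes x: "0 < x" "x \<le> 1 / 4"
  shows "(1 + x / 2) * (1 + x)\<^sup>2 \<le> growth x" "growth x \<le> 1 + 7 * x"
proof -
  have e: "1 + x / 2 \<le> (exp x - 1) / x" "(exp x - 1) / x \<le> 1 + x"
    using exp_bounds[of x] x by (auto simp: field_simps power2_eq_square)
  have eq: "growth x = (exp x - 1) / x * (1 + x)\<^sup>2" by (simp add: growth_def)
  show "(1 + x / 2) * (1 + x)\<^sup>2 \<le> growth x" unfolding eq using e(1) by (rule mult_right_mono) simp
  have "x\<^sup>2 \<le> 1 / 4 * x" using x by (simp add: power2_eq_square)
  then have "(1 + x)\<^sup>2 \<le> 1 + 3 * x" using x by (simp add: power2_sum)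
  then have "growth x \<le> (1 + x) * (1 + 3 * x)" unfolding eq using e x by (intro mult_mono) auto
  also have "\<dots> \<le> 1 + 7 * x" using \<open>x\<^sup>2 \<le> 1 / 4 * x\<close> x by (simp add: algebra_simps power2_eq_square)
  finally show "growth x \<le> 1 + 7 * x" .
qed

lemma local_error_err_term:
  "1 \<le> k \<Longrightarrow> local_error T L P \<delta> k = err_term (tt \<delta> k) (hh \<delta> k) (rr \<delta> (k - 1)) (rr \<delta> k)"
  using local_error_Suc[of \<delta> "k - 1"] by simp

text \<open>The change in the right neighbour when its left mesh is quartered. It may be positive,
  since \<open>chi\<close> becomes active if \<open>\<rho> / 4 < \<rho>'\<close> and
  \<open>\<rho>' \<le> \<rho>\<close>.\<close>

definition err_drop :: "real \<Rightarrow> real \<Rightarrow> real \<Rightarrow> real \<Rightarrow> real" where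
  "err_drop t h \<rho> \<rho>' = err_term t h (\<rho> / 4) \<rho>' - err_term t h \<rho> \<rho>'"

lemma err_diff_0:
  assumes \<delta>: "\<delta> \<in> aleph_n T L P n" and n: "1 \<le> n"
  shows "err T L P (subdivide \<delta> 0) - err T L P \<delta> =
    err_drop (tt \<delta> 1) (hh \<delta> 1) (rr \<delta> 0) (rr \<delta> 1) - 3 / 8 * rr \<delta> 0 * exp (L * T)"
proof -
  let ?f = "local_error T L P \<delta>" and ?g = "local_error T L P (subdivide \<delta> 0)"
  have split: "(\<Sum>k=0..n. f k) = f 0 + f 1 + (\<Sum>k=2..n. f k)" for f :: "nat \<Rightarrow> real"
    using n by (simp add: sum.atLeast_Suc_atMost numeral_2_eq_2)
  have "?g k = ?f k" if "k \<in> {2..n}" for k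
    using that rr_subdivide_0[OF \<delta>, of k] rr_subdivide_0[OF \<delta>, of "k - 1"]
      hh_subdivide_0[OF \<delta>] tt_subdivide_0[OF \<delta>]
    by (auto simp: local_error_err_term)
  then have "(\<Sum>k=2..n. ?g k) = (\<Sum>k=2..n. ?f k)" by (rule sum.cong[OF refl])
  moreover have "nsteps (subdivide \<delta> 0) = n" "nsteps \<delta> = n"
    using nsteps_subdivide[OF \<delta>, of 0] aleph_nD(1)[OF \<delta>] by simp_all
  ultimately have "err T L P (subdivide \<delta> 0) - err T L P \<delta> = (?g 0 + ?g 1) - (?f 0 + ?f 1)"
    unfolding err_def by (simp only: split)
  also have "\<dots> = err_drop (tt \<delta> 1) (hh \<delta> 1) (rr \<delta> 0) (rr \<delta> 1) - 3 / 8 * rr \<delta> 0 * exp (L * T)"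
    using n rr_subdivide_0[OF \<delta>] hh_subdivide_0[OF \<delta>] tt_subdivide_0[OF \<delta>]
    by (simp add: local_error_err_term err_drop_def) (simp add: local_error_def field_simps)
  finally show ?thesis .
qed

lemma err_diff:
  assumes \<delta>: "\<delta> \<in> aleph_n T L P n" and j: "1 \<le> j" "j \<le> n"
  shows "err T L P (subdivide \<delta> j) - err T L P \<delta> =
    err_term (tt \<delta> j - hh \<delta> j / 2) (hh \<delta> j / 2) (rr \<delta> (j - 1)) (rr \<delta> j / 4)
    + err_term (tt \<delta> j) (hh \<delta> j / 2) (rr \<delta> j / 4) (rr \<delta> j / 4)
    - err_term (tt \<delta> j) (hh \<delta> j) (rr \<delta> (j - 1)) (rr \<delta> j)
    + (if j < n then err_drop (tt \<delta> (Suc j)) (hh \<delta> (Suc j)) (rr \<delta> j) (rr \<delta> (Suc j)) else 0)"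
proof -
  let ?f = "local_error T L P \<delta>" and ?g = "local_error T L P (subdivide \<delta> j)"
  note H = hh_subdivide[OF \<delta> j] and R = rr_subdivide[OF \<delta> j] and S = tt_subdivide[OF \<delta> j]
  have "err T L P (subdivide \<delta> j) - err T L P \<delta> = (\<Sum>k=0..Suc n. ?g k) - (\<Sum>k=0..n. ?f k)"
    using nsteps_subdivide[OF \<delta> j(2)] aleph_nD(1)[OF \<delta>] j(1) by (simp add: err_def)
  also have "\<dots> = ?g j + ?g (Suc j) - ?f j + (if j < n then ?g (Suc (Suc j)) - ?f (Suc j) else 0)"
  proof (rule sum_subdivide[OF j])
    fix i assume i: "i < j"
    show "?g i = ?f i"
    proof (cases "i = 0")
      case True
      then show ?thesis using R[of 0] i by (simp add: local_error_def)
    next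
      case False
      then obtain m where "i = Suc m" by (cases i) auto
      then show ?thesis using R[of m] R[of "Suc m"] H[of "Suc m"] S[of "Suc m"] i j
        by (simp add: local_error_err_term)
    qed
  next
    fix i assume "Suc j < i" "i \<le> n"
    then show "?g (Suc i) = ?f i"
      using R[of "Suc i"] R[of i] H[of "Suc i"] S[of "Suc i"] by (simp add: local_error_err_term)
  qed
  also have "?g j = err_term (tt \<delta> j - hh \<delta> j / 2) (hh \<delta> j / 2) (rr \<delta> (j - 1)) (rr \<delta> j / 4)"
    unfolding local_error_err_term[OF j(1)] subdivide_values[OF \<delta> j] ..
  also have "?g (Suc j) = err_term (tt \<delta> j) (hh \<delta> j / 2) (rr \<delta> j / 4) (rr \<delta> j / 4)"
    unfolding local_error_Suc subdivide_values[OF \<delta> j] ..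
  also have "?f j = err_term (tt \<delta> j) (hh \<delta> j) (rr \<delta> (j - 1)) (rr \<delta> j)"
    by (rule local_error_err_term[OF j(1)])
  also have "(if j < n then ?g (Suc (Suc j)) - ?f (Suc j) else 0) =
      (if j < n then err_drop (tt \<delta> (Suc j)) (hh \<delta> (Suc j)) (rr \<delta> j) (rr \<delta> (Suc j)) else 0)"
    by (intro if_cong refl) (simp only: local_error_Suc err_drop_def subdivide_values[OF \<delta> j])
  finally show ?thesis .
qed

lemma growth_ge_1:
  assumes x: "0 < x" "x \<le> 1 / 4"
  shows "1 \<le> growth x"
proof -
  have "1 * 1 \<le> (1 + x / 2) * (1 + x)\<^sup>2" using x by (intro mult_mono) auto
  then show ?thesis using growth_bounds(1)[OF x] by simp
qed

lemma err_drop_eq: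
  "\<rho> > 0 \<Longrightarrow> err_drop t h \<rho> \<rho>' = exp (L * (T - t)) *
     ((if \<rho> / 4 < \<rho>' \<and> \<rho>' \<le> \<rho> then \<rho>' / 2 else 0) - 3 / 8 * growth (L * h) * \<rho>)"
  by (auto simp: err_drop_def err_term_growth algebra_simps)

text \<open>The values of \<open>growth\<close> lie between 1 and \<open>11 / 4\<close>, which gives
  \<open>1 / 2 - 3 / 8 = 1 / 8\<close> above and \<open>- 3 / 8 * (11 / 4) \<ge> - 3 / 2\<close>
  below.\<close>

lemma err_drop_bounds:
  assumes "0 \<le> t" "t \<le> T" "0 < L * h" "L * h \<le> 1 / 4" "0 < \<rho>"
  shows "- 3 / 2 * \<rho> * exp (L * T) \<le> err_drop t h \<rho> \<rho>'" "err_drop t h \<rho> \<rho>' \<le> 1 / 8 * \<rho> * exp (L * T)"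
proof -
  have g: "1 \<le> growth (L * h)" "growth (L * h) \<le> 11 / 4"
    using growth_ge_1 growth_bounds(2)[of "L * h"] assms by auto
  define b where "b = (if \<rho> / 4 < \<rho>' \<and> \<rho>' \<le> \<rho> then \<rho>' / 2 else 0) - 3 / 8 * growth (L * h) * \<rho>"
  have "growth (L * h) * \<rho> \<le> 11 / 4 * \<rho>" "1 * \<rho> \<le> growth (L * h) * \<rho>"
    using g assms by (intro mult_right_mono; simp)+
  moreover define c where "c = (if \<rho> / 4 < \<rho>' \<and> \<rho>' \<le> \<rho> then \<rho>' / 2 else 0)"
  have "b = c - 3 / 8 * (growth (L * h) * \<rho>)" by (simp add: b_def c_def)
  moreover have "0 \<le> c" "c \<le> \<rho> / 2" using assms(5) by (auto simp: c_def)
  ultimately have b: "- 3 / 2 * \<rho> \<le> b" "b \<le> 1 / 8 * \<rho>" using assms(5) by linarith+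
  have e: "0 < exp (L * (T - t))" "exp (L * (T - t)) \<le> exp (L * T)" using assms L_pos by auto
  have "exp (L * (T - t)) * (3 / 2 * \<rho>) \<le> exp (L * T) * (3 / 2 * \<rho>)"
    "exp (L * (T - t)) * (1 / 8 * \<rho>) \<le> exp (L * T) * (1 / 8 * \<rho>)"
    using e assms by (intro mult_right_mono; simp)+
  moreover have "exp (L * (T - t)) * (- 3 / 2 * \<rho>) \<le> exp (L * (T - t)) * b"
    "exp (L * (T - t)) * b \<le> exp (L * (T - t)) * (1 / 8 * \<rho>)"
    using e b by (intro mult_left_mono; simp)+
  moreover have "- 3 / 2 * \<rho> * exp (L * T) = - (exp (L * T) * (3 / 2 * \<rho>))"
    "1 / 8 * \<rho> * exp (L * T) = exp (L * T) * (1 / 8 * \<rho>)"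
    "exp (L * (T - t)) * (- 3 / 2 * \<rho>) = - (exp (L * (T - t)) * (3 / 2 * \<rho>))" by simp_all
  ultimately show "- 3 / 2 * \<rho> * exp (L * T) \<le> err_drop t h \<rho> \<rho>'"
    "err_drop t h \<rho> \<rho>' \<le> 1 / 8 * \<rho> * exp (L * T)"
    unfolding err_drop_eq[OF assms(5)] b_def[symmetric] by linarith+
qed

lemma step_facts:
  assumes \<delta>: "\<delta> \<in> aleph_n T L P n" and j: "1 \<le> j" "j \<le> n"
  shows "0 < L * hh \<delta> j" "L * hh \<delta> j \<le> 1 / 4" "0 < hh \<delta> j" "0 \<le> tt \<delta> j" "tt \<delta> j \<le> T"
    "rr \<delta> j = 2 * (L * hh \<delta> j) * (P * hh \<delta> j)" "0 < P * hh \<delta> j"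
  using aleph_nD(5)[OF \<delta> j] aleph_nD(6)[OF \<delta> j] aleph_nD(13)[OF \<delta> j] tt_range[OF \<delta> j(2)] L_pos P_pos
  by (auto simp: field_simps power2_eq_square)

text \<open>The left mesh may be large compared with the picked step, so terms proportional to it
  must cancel: the old term is at most \<open>E * (\<rho> / 2 + P * h)\<close>, while the first new
  term is at least \<open>E * (\<rho> / 2)\<close>. Everything else is of the order of the picked
  step.\<close>

lemma err_diff_lower:
  assumes \<delta>: "\<delta> \<in> aleph_n T L P n" and n: "1 \<le> n" and j: "j \<le> n"
  shows "- (2 * exp (L * T) * P) * eff_step \<delta> j \<le> err T L P (subdivide \<delta> j) - err T L P \<delta>"
proof (cases "j = 0")
  case True
  have e: "eff_step \<delta> 0 > 0" "rr \<delta> 0 = 2 * L * P * (eff_step \<delta> 0)\<^sup>2" "eff_step \<delta> 0 \<le> 1 / (4 * L)"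
    using eff_step[OF \<delta>, of 0] by auto
  have "L * eff_step \<delta> 0 \<le> 1 / 4" using e(3) L_pos by (simp add: field_simps)
  then have "2 * P * eff_step \<delta> 0 * (L * eff_step \<delta> 0) \<le> 2 * P * eff_step \<delta> 0 * (1 / 4)"
    using e(1) P_pos by (intro mult_left_mono) auto
  then have "rr \<delta> 0 \<le> P * eff_step \<delta> 0 / 2" using e(2) by (simp add: power2_eq_square mult_ac)
  then have "rr \<delta> 0 * exp (L * T) \<le> P * eff_step \<delta> 0 / 2 * exp (L * T)" by (rule mult_right_mono) simp
  moreover have "0 < P * eff_step \<delta> 0 * exp (L * T)" using e(1) P_pos by simp
  moreover have "- 3 / 2 * rr \<delta> 0 * exp (L * T) \<le> err_drop (tt \<delta> 1) (hh \<delta> 1) (rr \<delta> 0) (rr \<delta> 1)"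
    using step_facts[OF \<delta> _ n] aleph_nD(7)[OF \<delta>, of 0] by (intro err_drop_bounds(1)) auto
  moreover have "- (2 * exp (L * T) * P) * eff_step \<delta> 0 = - 2 * (P * eff_step \<delta> 0 * exp (L * T))"
    "P * eff_step \<delta> 0 / 2 * exp (L * T) = 1 / 2 * (P * eff_step \<delta> 0 * exp (L * T))"
    "- 3 / 2 * rr \<delta> 0 * exp (L * T) = - 3 / 2 * (rr \<delta> 0 * exp (L * T))"
    "3 / 8 * rr \<delta> 0 * exp (L * T) = 3 / 8 * (rr \<delta> 0 * exp (L * T))" by simp_all
  ultimately show ?thesis unfolding True err_diff_0[OF \<delta> n] by linarith
next
  case False
  then have j1: "1 \<le> j" by simp
  define h where "h = hh \<delta> j"
  define x where "x = L * h"
  define E where "E = exp (L * (T - tt \<delta> j))"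
  define \<rho> where "\<rho> = rr \<delta> (j - 1)"
  have x: "0 < x" "x \<le> 1 / 4" and h: "0 < h" and t: "0 \<le> tt \<delta> j" "tt \<delta> j \<le> T"
    and r: "rr \<delta> j = 2 * x * (P * h)" and Ph: "0 < P * h"
    using step_facts[OF \<delta> j1 j] by (auto simp: x_def h_def)
  have \<rho>: "0 < \<rho>" "\<rho> \<le> P / (8 * L)" using aleph_nD(7,8)[OF \<delta>, of "j - 1"] j by (auto simp: \<rho>_def)
  have E: "0 < E" "E \<le> exp (L * T)" using t L_pos by (auto simp: E_def)
  have "exp (L * (T - (tt \<delta> j - h / 2))) = exp (L * (T - tt \<delta> j) + L * (h / 2))"
    by (simp add: algebra_simps)
  then have E': "exp (L * (T - (tt \<delta> j - h / 2))) = E * exp (x / 2)"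
    unfolding exp_add by (simp add: E_def x_def)
  have half: "L * (h / 2) = x / 2" by (simp add: x_def)
  have pos: "0 \<le> (exp (x / 2) - 1) * P * (h / 2)" using x h P_pos by simp
  have g: "1 \<le> growth (x / 2)" using growth_ge_1[of "x / 2"] x by simp
  have low: "E * 1 * (1 * (\<rho> / 2)) \<le> E * exp (x / 2) * ((exp (x / 2) - 1) * P * (h / 2) + growth (x / 2) * (\<rho> / 2) + c)"
    if "c \<ge> 0" for c
  proof (intro mult_mono)
    have "1 * (\<rho> / 2) \<le> growth (x / 2) * (\<rho> / 2)" using g \<rho> by (intro mult_right_mono) auto
    then show "1 * (\<rho> / 2) \<le> (exp (x / 2) - 1) * P * (h / 2) + growth (x / 2) * (\<rho> / 2) + c"
      using pos that by linarith
  qed (use E x \<rho> in auto)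
  have one: "E * (\<rho> / 2) \<le> err_term (tt \<delta> j - h / 2) (h / 2) \<rho> (rr \<delta> j / 4)"
    using low[of "if \<rho> < rr \<delta> j / 4 then rr \<delta> j / 4 / 2 else 0"] aleph_nD(7)[OF \<delta> j]
    unfolding err_term_growth E' half by auto
  have two: "0 \<le> err_term (tt \<delta> j) (h / 2) (rr \<delta> j / 4) (rr \<delta> j / 4)"
    using x h P_pos g aleph_nD(7)[OF \<delta> j] unfolding err_term_growth half
    by (intro mult_nonneg_nonneg add_nonneg_nonneg) auto
  have "exp x - 1 \<le> x + x\<^sup>2" using exp_bounds(2)[of x] x by simp
  also have "\<dots> \<le> 5 / 16" using x mult_mono[of x "1 / 4" x "1 / 4"] by (simp add: power2_eq_square)
  finally have a: "(exp x - 1) * (P * h) \<le> 5 / 16 * (P * h)" using Ph by (intro mult_right_mono) auto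
  \<comment> \<open>The general bound on the meshes makes the deviation of \<open>growth x\<close>
    from 1 a contribution of order \<open>h\<close>, whatever the left mesh is.\<close>
  have "x * \<rho> \<le> x * (P / (8 * L))" using \<rho> x by (intro mult_left_mono) auto
  then have b: "x * \<rho> \<le> P * h / 8" using L_pos by (simp add: x_def field_simps)
  have "growth x * (\<rho> / 2) \<le> (1 + 7 * x) * (\<rho> / 2)" using growth_bounds(2)[OF x] \<rho> by (intro mult_right_mono) auto
  then have c: "growth x * (\<rho> / 2) \<le> \<rho> / 2 + 7 / 16 * (P * h)" using b by (simp add: algebra_simps)
  have d: "rr \<delta> j \<le> P * h / 2" using r x mult_right_mono[OF x(2), of "P * h"] Ph by simp
  \<comment> \<open>The coefficients of \<open>P * h\<close> sum up to
    \<open>5 / 16 + 7 / 16 + 1 / 4 = 1\<close>, the last one from \<open>chi\<close>.\<close>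
  have "err_term (tt \<delta> j) h \<rho> (rr \<delta> j) \<le> E * (\<rho> / 2 + P * h)"
    unfolding err_term_growth E_def[symmetric] x_def[symmetric]
    using a c d Ph r x E(1) by (intro mult_left_mono) (auto simp: mult.assoc)
  moreover define W where "W = exp (L * T) * (P * h)"
  have "E * (P * h) \<le> W" unfolding W_def using E Ph by (intro mult_right_mono) auto
  moreover have "- (3 / 4) * W \<le>
    (if j < n then err_drop (tt \<delta> (Suc j)) (hh \<delta> (Suc j)) (rr \<delta> j) (rr \<delta> (Suc j)) else 0)"
  proof (cases "j < n")
    case True
    have "- 3 / 2 * rr \<delta> j * exp (L * T) \<le> err_drop (tt \<delta> (Suc j)) (hh \<delta> (Suc j)) (rr \<delta> j) (rr \<delta> (Suc j))"
      using step_facts[OF \<delta>, of "Suc j"] aleph_nD(7)[OF \<delta> j] True by (intro err_drop_bounds(1)) auto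
    moreover have "rr \<delta> j * exp (L * T) \<le> P * h / 2 * exp (L * T)" using d by (rule mult_right_mono) simp
    moreover have "P * h / 2 * exp (L * T) = 1 / 2 * W" by (simp add: W_def)
    ultimately have "- 3 / 2 * (1 / 2 * W) \<le> err_drop (tt \<delta> (Suc j)) (hh \<delta> (Suc j)) (rr \<delta> j) (rr \<delta> (Suc j))"
      unfolding mult.assoc by linarith
    then show ?thesis unfolding if_P[OF True] by simp
  next
    case False
    then show ?thesis using Ph by (simp add: W_def)
  qed
  moreover have "0 < W" using Ph by (simp add: W_def)
  moreover have "E * (\<rho> / 2 + P * h) = E * (\<rho> / 2) + E * (P * h)" by (simp add: distrib_left)
  ultimately have "- 2 * W \<le> err T L P (subdivide \<delta> j) - err T L P \<delta>"
    using one two unfolding err_diff[OF \<delta> j1 j] h_def[symmetric] \<rho>_def[symmetric] by linarith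
  moreover have "- 2 * W = - (2 * exp (L * T) * P) * h" by (simp add: W_def)
  ultimately show ?thesis unfolding eff_step_hh[OF \<delta> j1 j] h_def[symmetric] by simp
qed

text \<open>The left mesh error is propagated no worse by two half steps than by one full step. In
  terms of \<open>u = exp (x / 2)\<close>, where \<open>exp x - 1 = (u - 1) * (u + 1)\<close>, the
  claim reduces to
  \<open>2 * u * (1 + x / 2)\<^sup>2 \<le> (u + 1) * (1 + x)\<^sup>2\<close>.\<close>

lemma growth_halved:
  assumes x: "0 < x" "x \<le> 1 / 4"
  shows "exp (x / 2) * growth (x / 2) \<le> growth x"
proof -
  define u where "u = exp (x / 2)"
  have u: "1 \<le> u" "u \<le> 1 + x / 2 + x\<^sup>2 / 4"
    using exp_bounds(2)[of "x / 2"] x by (auto simp: u_def power_divide)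
  have xx: "exp x = u\<^sup>2" by (simp add: u_def power2_eq_square flip: exp_add)
  have x2: "0 \<le> x\<^sup>2" "x\<^sup>2 \<le> 1 / 4 * x" "0 \<le> x ^ 3" "x ^ 3 \<le> 1 / 4 * x" "x ^ 4 \<le> 1 / 4 * x"
  proof -
    have x1: "x * y \<le> 1 / 4 * x" if "0 \<le> y" "y \<le> 1 / 4" for y
      using mult_left_mono[OF that(2), of x] x by simp
    have p: "x\<^sup>2 \<le> 1 / 4" "x ^ 3 \<le> 1 / 4"
      using power_decreasing[of 1 2 x] power_decreasing[of 1 3 x] x by auto
    show "x\<^sup>2 \<le> 1 / 4 * x" "x ^ 3 \<le> 1 / 4 * x" "x ^ 4 \<le> 1 / 4 * x"
      using x1[of x] x1[of "x\<^sup>2"] x1[of "x ^ 3"] x p by (simp_all add: power2_eq_square power3_eq_cube power4_eq_xxxx mult_ac)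
  qed (use x in auto)
  have "u * (2 * (1 + x / 2)\<^sup>2) \<le> (u + 1) * (1 + x)\<^sup>2"
  proof -
    define w where "w = u - 1"
    have w: "0 \<le> w" "w \<le> x / 2 + x\<^sup>2 / 4" using u by (auto simp: w_def)
    \<comment> \<open>After collecting the terms with \<open>w\<close>, this is its coefficient; it
      equals \<open>1 - x\<^sup>2 / 2\<close>.\<close>
    have coeff: "2 * (1 + x / 2)\<^sup>2 - (1 + x)\<^sup>2 \<le> 1"
      using x2 by (simp add: power2_eq_square field_simps)
    have "w * (2 * (1 + x / 2)\<^sup>2 - (1 + x)\<^sup>2) \<le> w * 1" using coeff w(1) by (rule mult_left_mono)
    then have "w * (2 * (1 + x / 2)\<^sup>2 - (1 + x)\<^sup>2) \<le> x / 2 + x\<^sup>2 / 4" using w(2) by simp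
    also have "\<dots> \<le> 2 * (1 + x)\<^sup>2 - 2 * (1 + x / 2)\<^sup>2"
      using x by (simp add: power2_eq_square field_simps)
    finally show ?thesis by (simp add: w_def algebra_simps)
  qed
  then have "(u - 1) * (u * (2 * (1 + x / 2)\<^sup>2)) \<le> (u - 1) * ((u + 1) * (1 + x)\<^sup>2)"
    using u by (intro mult_left_mono) auto
  then have "(u - 1) * (u * (2 * (1 + x / 2)\<^sup>2)) / x \<le> (u - 1) * ((u + 1) * (1 + x)\<^sup>2) / x"
    using x by (intro divide_right_mono) auto
  moreover have "exp (x / 2) * growth (x / 2) = (u - 1) * (u * (2 * (1 + x / 2)\<^sup>2)) / x"
    by (simp add: growth_def u_def)
  moreover have "growth x = (u - 1) * ((u + 1) * (1 + x)\<^sup>2) / x"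
    unfolding growth_def xx by (simp add: power2_eq_square algebra_simps)
  ultimately show ?thesis by simp
qed

text \<open>The gain inside a subdivided step and a possible loss in the following step (which occurs only if
  both steps have equal size) cancel to first order in \<open>x = Lh\<close>; the second order decides.\<close>

lemma second_order_gain:
  assumes x: "0 < x" "x \<le> 1 / 4"
  shows "- (exp x - 1) / 2 + growth (x / 2) * x / 4 \<le> - x\<^sup>2 / 4"
    "- (exp x - 1) / 2 + growth (x / 2) * x / 4 + x * exp (- x) * (1 - 3 / 4 * growth x) \<le> - x\<^sup>2 / 4"
proof -
  define u where "u = exp (x / 2)"
  have u: "1 + x / 2 + x\<^sup>2 / 8 \<le> u"
    using exp_bounds(1)[of "x / 2"] x by (auto simp: u_def power_divide)
  have xx: "exp x = u\<^sup>2" by (simp add: u_def power2_eq_square flip: exp_add)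
  have x2: "0 \<le> x\<^sup>2" "x\<^sup>2 \<le> x / 4" "x ^ 3 \<le> x\<^sup>2 / 4" "0 \<le> x ^ 3"
    using x mult_left_mono[OF x(2), of x] mult_left_mono[OF x(2), of "x\<^sup>2"]
    by (auto simp: power2_eq_square power3_eq_cube mult_ac)
  have g: "growth (x / 2) * x / 4 = (u - 1) * (1 + x / 2)\<^sup>2 / 2"
    using x by (simp add: growth_def u_def)
  have eq: "- (exp x - 1) / 2 + growth (x / 2) * x / 4 = - ((u - 1) * ((u + 1) - (1 + x / 2)\<^sup>2)) / 2"
    unfolding g xx by (simp add: power2_eq_square field_simps)
  have A: "x / 2 * (1 + x / 4) * (1 - x / 2 - x\<^sup>2 / 8) \<le> (u - 1) * ((u + 1) - (1 + x / 2)\<^sup>2)"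
  proof (rule mult_mono)
    show "x / 2 * (1 + x / 4) \<le> u - 1" using u by (simp add: power2_eq_square field_simps)
    show "1 - x / 2 - x\<^sup>2 / 8 \<le> u + 1 - (1 + x / 2)\<^sup>2" using u by (simp add: power2_eq_square field_simps)
    show "0 \<le> u - 1" using u x2 x by linarith
    show "0 \<le> 1 - x / 2 - x\<^sup>2 / 8" using x x2 by linarith
  qed
  have "1 - x / 2 \<le> (1 + x / 4) * (1 - x / 2 - x\<^sup>2 / 8)"
  proof -
    have "(1 + x / 4) * (1 - x / 2 - x\<^sup>2 / 8) = 1 - x / 4 - x\<^sup>2 / 4 - x ^ 3 / 32"
      by (simp add: power2_eq_square power3_eq_cube field_simps)
    then show ?thesis using x2 x by linarith
  qed
  then have "x / 2 * (1 - x / 2) \<le> x / 2 * ((1 + x / 4) * (1 - x / 2 - x\<^sup>2 / 8))"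
    using x by (intro mult_left_mono) auto
  then have "x / 2 * (1 - x / 2) \<le> (u - 1) * ((u + 1) - (1 + x / 2)\<^sup>2)"
    using A unfolding mult.assoc by linarith
  moreover have "x / 4 * (1 - x / 2) = x / 2 * (1 - x / 2) / 2" by simp
  ultimately have main: "- (exp x - 1) / 2 + growth (x / 2) * x / 4 \<le> - (x / 4 * (1 - x / 2))"
    unfolding eq by linarith
  have "x / 4 * (1 - x / 2) = x / 4 - x\<^sup>2 / 8" by (simp add: power2_eq_square field_simps)
  then show "- (exp x - 1) / 2 + growth (x / 2) * x / 4 \<le> - x\<^sup>2 / 4"
    using main x x2 by linarith
  have "(1 + x / 2) * (1 + x)\<^sup>2 \<le> growth x" by (rule growth_bounds(1)[OF x])
  moreover have "1 + 5 / 2 * x \<le> (1 + x / 2) * (1 + x)\<^sup>2"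
    using x by (simp add: power2_eq_square field_simps)
  ultimately have "1 - 3 / 4 * growth x \<le> 1 / 4 - 15 / 8 * x" by simp
  \<comment> \<open>The bound changes sign at \<open>x = 2 / 15\<close>; truncation at 0 permits
    replacing \<open>exp (- x)\<close> by 1.\<close>
  also have "\<dots> \<le> max 0 (1 / 4 - 15 / 8 * x)" by simp
  finally have "x * exp (- x) * (1 - 3 / 4 * growth x) \<le> x * exp (- x) * max 0 (1 / 4 - 15 / 8 * x)"
    using x by (intro mult_left_mono) auto
  also have "\<dots> \<le> x * 1 * max 0 (1 / 4 - 15 / 8 * x)"
    using x by (intro mult_right_mono mult_left_mono) auto
  also have "\<dots> \<le> x / 4 * (1 - x / 2) - x\<^sup>2 / 4"
  proof (cases "1 / 4 - 15 / 8 * x \<ge> 0")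
    case True
    then show ?thesis using x2 by (simp add: power2_eq_square algebra_simps)
  next
    case False
    then show ?thesis using x x2 by (simp add: power2_eq_square algebra_simps)
  qed
  finally show "- (exp x - 1) / 2 + growth (x / 2) * x / 4 + x * exp (- x) * (1 - 3 / 4 * growth x) \<le> - x\<^sup>2 / 4"
    using main by linarith
qed

text \<open>The ratio is a power of 4 in the interval from \<open>1 / 4\<close> (excluded) to 1.
  Hence quartering a mesh activates \<open>chi\<close> of the right neighbour only if the two meshes
  were equal.\<close>

lemma rr_within_factor_4:
  assumes \<delta>: "\<delta> \<in> aleph_n T L P n" and ij: "i \<le> n" "j \<le> n" and "rr \<delta> i / 4 < rr \<delta> j" "rr \<delta> j \<le> rr \<delta> i"
  shows "rr \<delta> j = rr \<delta> i"
proof -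
  obtain l :: int where l: "rr \<delta> j / rr \<delta> i = 4 powi l" using aleph_nD(12)[OF \<delta>] ij by blast
  have r: "rr \<delta> i > 0" using aleph_nD(7)[OF \<delta> ij(1)] .
  have q: "1 / 4 < rr \<delta> j / rr \<delta> i" "rr \<delta> j / rr \<delta> i \<le> 1"
    using r assms(4,5) by (simp_all add: field_simps)
  have "\<not> l \<le> -1" using power_int_increasing[of l "-1" "4::real"] q(1) l by (auto simp: power_int_minus)
  moreover have "\<not> 1 \<le> l" using power_int_increasing[of 1 l "4::real"] q(2) l by auto
  ultimately have "l = 0" by simp
  then show ?thesis using l r by simp
qed

lemma rr_less_imp_quarter:
  assumes \<delta>: "\<delta> \<in> aleph_n T L P n" and ij: "i \<le> n" "j \<le> n" and "rr \<delta> j < rr \<delta> i"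
  shows "rr \<delta> j \<le> rr \<delta> i / 4"
  using rr_within_factor_4[OF \<delta> ij] assms(4) by fastforce

text \<open>The parts stemming from the left mesh and from the own \<open>chi\<close> do not
  increase and are discarded. What remains is \<open>P * h\<close> times the expression of
  \<open>second_order_gain\<close>, without or with the loss of the right neighbour.\<close>

lemma err_diff_upper:
  assumes \<delta>: "\<delta> \<in> aleph_n T L P n" and n: "1 \<le> n" and p: "p \<le> n"
  shows "err T L P (subdivide \<delta> p) - err T L P \<delta> \<le> - (P * L\<^sup>2 / 4) * eff_step \<delta> p ^ 3"
proof (cases "p = 0")
  case True
  have e: "eff_step \<delta> 0 > 0" "rr \<delta> 0 = 2 * L * P * (eff_step \<delta> 0)\<^sup>2" "eff_step \<delta> 0 \<le> 1 / (4 * L)"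
    using eff_step[OF \<delta>, of 0] by auto
  have r: "rr \<delta> 0 > 0" using aleph_nD(7)[OF \<delta>] by simp
  have "err_drop (tt \<delta> 1) (hh \<delta> 1) (rr \<delta> 0) (rr \<delta> 1) \<le> 1 / 8 * rr \<delta> 0 * exp (L * T)"
    using step_facts[OF \<delta> _ n] r by (intro err_drop_bounds(2)) auto
  moreover have "rr \<delta> 0 * 1 \<le> rr \<delta> 0 * exp (L * T)" using r L_pos T_pos by (intro mult_left_mono) auto
  ultimately have "err T L P (subdivide \<delta> 0) - err T L P \<delta> \<le> - (1 / 4) * rr \<delta> 0"
    unfolding err_diff_0[OF \<delta> n] by simp
  also have "\<dots> \<le> - (P * L\<^sup>2 / 4) * eff_step \<delta> 0 ^ 3"
  proof -
    have "L * eff_step \<delta> 0 \<le> 2" using e(3) L_pos by (simp add: field_simps)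
    then have "P * L * (eff_step \<delta> 0)\<^sup>2 * (L * eff_step \<delta> 0) \<le> P * L * (eff_step \<delta> 0)\<^sup>2 * 2"
      using L_pos P_pos by (intro mult_left_mono) auto
    then show ?thesis unfolding e(2) by (simp add: power2_eq_square power3_eq_cube mult_ac)
  qed
  finally show ?thesis unfolding True .
next
  case False
  then have p1: "1 \<le> p" by simp
  define h where "h = hh \<delta> p"
  define x where "x = L * h"
  define E where "E = exp (L * (T - tt \<delta> p))"
  define \<rho> where "\<rho> = rr \<delta> (p - 1)"
  define r where "r = rr \<delta> p"
  have x: "0 < x" "x \<le> 1 / 4" and h: "0 < h" and t: "0 \<le> tt \<delta> p" "tt \<delta> p \<le> T"
    and r: "r = 2 * x * (P * h)" and Ph: "0 < P * h"
    using step_facts[OF \<delta> p1 p] by (auto simp: x_def h_def r_def)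
  have \<rho>: "0 < \<rho>" using aleph_nD(7)[OF \<delta>, of "p - 1"] p by (auto simp: \<rho>_def)
  have E: "1 \<le> E" using t L_pos by (auto simp: E_def)
  have "exp (L * (T - (tt \<delta> p - h / 2))) = exp (L * (T - tt \<delta> p) + L * (h / 2))"
    by (simp add: algebra_simps)
  then have E': "exp (L * (T - (tt \<delta> p - h / 2))) = E * exp (x / 2)"
    unfolding exp_add by (simp add: E_def x_def)
  have half: "L * (h / 2) = x / 2" by (simp add: x_def)
  define u where "u = exp (x / 2)"
  have u: "1 \<le> u" "u \<le> 2"
    using exp_bounds(2)[of "x / 2"] x mult_mono[of x 1 x 1] by (auto simp: u_def power_divide power2_eq_square)
  have xx: "exp x = u * u" by (simp add: u_def flip: exp_add)
  define c c' where "c = (if \<rho> < r then r / 2 else 0)" and "c' = (if \<rho> < r / 4 then r / 4 / 2 else 0)"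
  have r0: "0 < r" using r x Ph by simp
  \<comment> \<open>If \<open>chi\<close> is active after the subdivision, it was active before with
    four times the value, which outweighs the factor \<open>u \<le> 2\<close> due to the earlier
    node.\<close>
  have "u * c' \<le> 2 * c'" using u r0 by (intro mult_right_mono) (auto simp: c'_def)
  then have chi: "u * c' \<le> c" using r0 by (auto simp: c_def c'_def split: if_splits)
  have gr: "u * growth (x / 2) * (\<rho> / 2) \<le> growth x * (\<rho> / 2)"
    using growth_halved[OF x] \<rho> unfolding u_def by (intro mult_right_mono) auto
  define S where "S = - (exp x - 1) / 2 + growth (x / 2) * x / 4"
  have "err_term (tt \<delta> p - h / 2) (h / 2) \<rho> (r / 4) + err_term (tt \<delta> p) (h / 2) (r / 4) (r / 4)
      - err_term (tt \<delta> p) h \<rho> r =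
    E * (u * ((u - 1) * P * (h / 2) + growth (x / 2) * (\<rho> / 2) + c')
      + ((u - 1) * P * (h / 2) + growth (x / 2) * (r / 4 / 2)) - ((u * u - 1) * P * h + growth x * (\<rho> / 2) + c))"
    unfolding err_term_growth E' half E_def[symmetric] x_def[symmetric] u_def[symmetric] xx c_def c'_def
    by (simp add: algebra_simps)
  also have "\<dots> = E * ((P * h) * S + (u * growth (x / 2) * (\<rho> / 2) - growth x * (\<rho> / 2)) + (u * c' - c))"
    unfolding S_def xx r by (simp add: field_simps)
  also have "\<dots> \<le> E * ((P * h) * S)" using E chi gr by (intro mult_left_mono) auto
  finally have inner: "err_term (tt \<delta> p - h / 2) (h / 2) \<rho> (r / 4) + err_term (tt \<delta> p) (h / 2) (r / 4) (r / 4)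
      - err_term (tt \<delta> p) h \<rho> r \<le> E * ((P * h) * S)" .
  have final: "E * ((P * h) * b) \<le> - (P * L\<^sup>2 / 4) * h ^ 3" if "b \<le> - x\<^sup>2 / 4" for b
  proof -
    have "(P * h) * b \<le> (P * h) * (- x\<^sup>2 / 4)" using that Ph by (intro mult_left_mono) auto
    then have "E * ((P * h) * b) \<le> E * ((P * h) * (- x\<^sup>2 / 4))"
      by (rule mult_left_mono) (use E in simp)
    also have "\<dots> \<le> 1 * ((P * h) * (- x\<^sup>2 / 4))"
    proof (rule mult_right_mono_neg[OF E])
      show "(P * h) * (- x\<^sup>2 / 4) \<le> 0" using Ph by (intro mult_nonneg_nonpos) auto
    qed
    also have "\<dots> = - (P * L\<^sup>2 / 4) * h ^ 3" by (simp add: x_def power2_eq_square power3_eq_cube)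
    finally show ?thesis .
  qed
  define D where "D = (if p < n then err_drop (tt \<delta> (Suc p)) (hh \<delta> (Suc p)) (rr \<delta> p) (rr \<delta> (Suc p)) else 0)"
  \<comment> \<open>Without an activated \<open>chi\<close> the neighbour only gains. With it the
    meshes are equal, so the neighbour also has step size \<open>h\<close> and its exponential
    weight is \<open>E * exp (- x)\<close>.\<close>
  have "D \<le> 0 \<or> D = E * ((P * h) * (x * exp (- x) * (1 - 3 / 4 * growth x)))"
  proof (cases "p < n \<and> r / 4 < rr \<delta> (Suc p) \<and> rr \<delta> (Suc p) \<le> r")
    case False
    have "exp (L * (T - tt \<delta> (Suc p))) * (0 - 3 / 8 * growth (L * hh \<delta> (Suc p)) * r) \<le> 0" if "p < n"
      using growth_ge_1[of "L * hh \<delta> (Suc p)"] step_facts[OF \<delta>, of "Suc p"] that r0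
      by (intro mult_nonneg_nonpos) auto
    then show ?thesis using False err_drop_eq[OF r0] by (auto simp: D_def r_def)
  next
    case True
    then have eq: "rr \<delta> (Suc p) = r" using rr_within_factor_4[OF \<delta> p, of "Suc p"] by (auto simp: r_def)
    have hh_eq: "hh \<delta> (Suc p) = h"
      using eq eff_step_hh[OF \<delta>, of "Suc p"] eff_step_hh[OF \<delta> p1 p] True
      by (simp add: eff_step_def r_def h_def)
    have "L * (T - tt \<delta> (Suc p)) = L * (T - tt \<delta> p) + - x"
      using aleph_nD(11)[OF \<delta>, of p] True by (simp add: hh_eq x_def algebra_simps)
    then have "exp (L * (T - tt \<delta> (Suc p))) = E * exp (- x)" unfolding E_def by (simp only: exp_add)
    then have "D = E * exp (- x) * (r / 2 - 3 / 8 * growth x * r)"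
      using True err_drop_eq[OF r0] eq by (simp add: D_def r_def[symmetric] hh_eq x_def[symmetric])
    also have "\<dots> = E * ((P * h) * (x * exp (- x) * (1 - 3 / 4 * growth x)))"
      unfolding r by (simp add: field_simps)
    finally show ?thesis ..
  qed
  moreover have total: "err T L P (subdivide \<delta> p) - err T L P \<delta> \<le> E * ((P * h) * S) + D"
    using inner unfolding err_diff[OF \<delta> p1 p] h_def[symmetric] \<rho>_def[symmetric] r_def[symmetric] D_def
    by simp
  ultimately have "err T L P (subdivide \<delta> p) - err T L P \<delta> \<le> E * ((P * h) * S) \<or>
      err T L P (subdivide \<delta> p) - err T L P \<delta> \<le> E * ((P * h) * (S + x * exp (- x) * (1 - 3 / 4 * growth x)))"
    by (auto simp: distrib_left)
  moreover have "S \<le> - x\<^sup>2 / 4" "S + x * exp (- x) * (1 - 3 / 4 * growth x) \<le> - x\<^sup>2 / 4"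
    unfolding S_def by (rule second_order_gain[OF x])+
  ultimately have "err T L P (subdivide \<delta> p) - err T L P \<delta> \<le> - (P * L\<^sup>2 / 4) * h ^ 3"
    using final order_trans by blast
  then show ?thesis by (simp add: eff_step_hh[OF \<delta> p1 p] h_def)
qed

section \<open>Smallness and positivity of the error\<close>

lemma err_term_pos:
  assumes "0 < L * h" "0 < \<rho>" "0 \<le> \<rho>'"
  shows "0 < err_term t h \<rho> \<rho>'"
proof -
  have h: "h > 0" using assms(1) L_pos by (simp add: zero_less_mult_iff)
  have "0 < P * h + (1 + L * h)\<^sup>2 / (L * h) * (\<rho> / 2)"
    using assms h P_pos by (intro add_pos_nonneg) auto
  then have "0 < (exp (L * h) - 1) * (P * h + (1 + L * h)\<^sup>2 / (L * h) * (\<rho> / 2))"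
    using assms by (intro mult_pos_pos) auto
  then show ?thesis
    unfolding err_term_def using assms(3) by (intro mult_pos_pos[OF exp_gt_zero] add_pos_nonneg) simp_all
qed

lemma err_pos:
  assumes \<delta>: "\<delta> \<in> aleph_n T L P n"
  shows "0 < err T L P \<delta>"
  unfolding err_def
proof (rule sum_pos)
  fix k assume k: "k \<in> {0..nsteps \<delta>}"
  show "0 < local_error T L P \<delta> k"
  proof (cases "k = 0")
    case True
    then show ?thesis using aleph_nD(7)[OF \<delta>, of 0] by (simp add: local_error_def)
  next
    case False
    then show ?thesis
      using k aleph_nD(1)[OF \<delta>] aleph_nD(7)[OF \<delta>, of k] aleph_nD(7)[OF \<delta>, of "k - 1"]
        step_facts(1)[OF \<delta>, of k]
      by (auto simp: local_error_err_term intro!: err_term_pos)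
  qed
qed auto

text \<open>Local errors are quadratic in the step sizes of the cell and its left neighbour. One
  factor is at most \<open>s\<close>, and the other sums up to \<open>T\<close>; the cell 0 is
  outside this sum and is estimated separately.\<close>

lemma err_le_mesh:
  assumes \<delta>: "\<delta> \<in> aleph_n T L P n" and n: "1 \<le> n" and s: "0 < s" "s \<le> 1"
    and small: "\<And>k. k \<le> n \<Longrightarrow> eff_step \<delta> k \<le> s"
  shows "err T L P \<delta> \<le> exp (L * T) * L * P * (4 + 6 * T) * s"
proof -
  let ?c = "exp (L * T) * L * P"
  let ?e = "eff_step \<delta>"
  have c: "0 < ?c" using L_pos P_pos by simp
  have sq: "(?e k)\<^sup>2 \<le> s * ?e k" "(?e k)\<^sup>2 \<le> s" if "k \<le> n" for k
  proof -
    show "(?e k)\<^sup>2 \<le> s * ?e k"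
      using eff_step(1)[OF \<delta> that] small[OF that] by (simp add: power2_eq_square)
    also have "\<dots> \<le> s * 1" using s small[OF that] by (intro mult_left_mono) auto
    finally show "(?e k)\<^sup>2 \<le> s" by simp
  qed
  have term_le: "local_error T L P \<delta> k \<le> ?c * (3 * (?e k)\<^sup>2 + 3 * (?e (k - 1))\<^sup>2)" if k: "k \<in> {1..n}" for k
  proof -
    have k': "1 \<le> k" "k \<le> n" "k - 1 \<le> n" using k by auto
    define x where "x = L * hh \<delta> k"
    note S = step_facts[OF \<delta> k'(1,2)]
    have x: "0 < x" "x \<le> 1 / 4" using S by (auto simp: x_def)
    have "x * x \<le> 1 / 4 * x" using x by (intro mult_right_mono) auto
    moreover have "exp x \<le> 1 + x + x * x" using exp_bounds(2)[of x] x by (simp add: power2_eq_square)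
    ultimately have "exp x - 1 \<le> 2 * x" using x by linarith
    then have "(exp x - 1) * (P * hh \<delta> k) \<le> 2 * x * (P * hh \<delta> k)"
      using S(7) by (intro mult_right_mono) auto
    then have a: "(exp x - 1) * P * hh \<delta> k \<le> 2 * L * P * (?e k)\<^sup>2"
      unfolding eff_step_hh[OF \<delta> k'(1,2)] by (simp add: x_def power2_eq_square mult_ac)
    have "growth x * (rr \<delta> (k - 1) / 2) \<le> 11 / 4 * (rr \<delta> (k - 1) / 2)"
      using growth_bounds(2)[OF x] x aleph_nD(7)[OF \<delta> k'(3)] by (intro mult_right_mono) auto
    also have "\<dots> \<le> 3 * L * P * (?e (k - 1))\<^sup>2"
      unfolding eff_step(2)[OF \<delta> k'(3)] using L_pos P_pos by simp
    finally have b: "growth x * (rr \<delta> (k - 1) / 2) \<le> 3 * L * P * (?e (k - 1))\<^sup>2" .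
    have d: "(if rr \<delta> (k - 1) < rr \<delta> k then rr \<delta> k / 2 else 0) \<le> L * P * (?e k)\<^sup>2"
      using eff_step(2)[OF \<delta> k'(2)] L_pos P_pos by auto
    have "local_error T L P \<delta> k \<le> exp (L * (T - tt \<delta> k)) * (L * P * (3 * (?e k)\<^sup>2 + 3 * (?e (k - 1))\<^sup>2))"
      unfolding local_error_err_term[OF k'(1)] err_term_growth x_def[symmetric]
      using a b d by (intro mult_left_mono) (auto simp: algebra_simps)
    also have "\<dots> \<le> exp (L * T) * (L * P * (3 * (?e k)\<^sup>2 + 3 * (?e (k - 1))\<^sup>2))"
      using S(4) L_pos P_pos by (intro mult_right_mono) auto
    finally show ?thesis by (simp add: mult_ac)
  qed
  have T: "(\<Sum>k=1..n. ?e k) = T"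
  proof -
    have "(\<Sum>k=1..n. ?e k) = (\<Sum>k=1..n. hh \<delta> k)" using eff_step_hh[OF \<delta>] by (intro sum.cong) auto
    also have "\<dots> = tt \<delta> n"
    proof -
      have "\<forall>k\<in>{0..n}. tt \<delta> k = (\<Sum>j=1..k. hh \<delta> j)" using \<delta> unfolding aleph_n_def by blast
      then show ?thesis by (metis atLeastAtMost_iff le0 order_refl)
    qed
    finally show ?thesis using aleph_nD(10)[OF \<delta>] by simp
  qed
  have "(\<Sum>k=1..n. (?e k)\<^sup>2) \<le> (\<Sum>k=1..n. s * ?e k)" using sq(1) by (intro sum_mono) auto
  then have sum1: "(\<Sum>k=1..n. (?e k)\<^sup>2) \<le> s * T" by (simp only: T flip: sum_distrib_left)
  have "(\<Sum>k=1..n. (?e (k - 1))\<^sup>2) = (\<Sum>k<n. (?e k)\<^sup>2)"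
    by (rule sum.reindex_bij_witness[of _ Suc "\<lambda>k. k - 1"]) auto
  also have "\<dots> \<le> (\<Sum>k\<in>{0} \<union> {1..n}. (?e k)\<^sup>2)" by (rule sum_mono2) auto
  also have "\<dots> = (?e 0)\<^sup>2 + (\<Sum>k=1..n. (?e k)\<^sup>2)" by simp
  finally have sum2: "(\<Sum>k=1..n. (?e (k - 1))\<^sup>2) \<le> s + s * T" using sum1 sq(2)[of 0] by simp
  have "err T L P \<delta> = local_error T L P \<delta> 0 + (\<Sum>k=1..n. local_error T L P \<delta> k)"
    unfolding err_def aleph_nD(1)[OF \<delta>] by (simp add: sum.atLeast_Suc_atMost)
  also have "local_error T L P \<delta> 0 = ?c * (?e 0)\<^sup>2"
    using eff_step(2)[OF \<delta>, of 0] by (simp add: local_error_def mult_ac)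
  also have "(\<Sum>k=1..n. local_error T L P \<delta> k) \<le> (\<Sum>k=1..n. ?c * (3 * (?e k)\<^sup>2 + 3 * (?e (k - 1))\<^sup>2))"
    using term_le by (rule sum_mono)
  also have "\<dots> = ?c * (3 * (\<Sum>k=1..n. (?e k)\<^sup>2) + 3 * (\<Sum>k=1..n. (?e (k - 1))\<^sup>2))"
    by (simp add: sum.distrib flip: sum_distrib_left)
  also have "?c * (?e 0)\<^sup>2 + \<dots> = ?c * ((?e 0)\<^sup>2 + 3 * (\<Sum>k=1..n. (?e k)\<^sup>2) + 3 * (\<Sum>k=1..n. (?e (k - 1))\<^sup>2))"
    by (simp add: distrib_left)
  also have "\<dots> \<le> ?c * (s + 3 * (s * T) + 3 * (s + s * T))"
    using c sum1 sum2 sq(2)[of 0] by (intro mult_left_mono add_mono) auto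
  finally show ?thesis by (simp add: algebra_simps)
qed

end

section \<open>Cost increments\<close>

locale weighted_rates = rates +
  fixes dR dF :: nat and v :: "real \<Rightarrow> real"
  assumes dR: "dR \<ge> 1" and v_cont: "continuous_on {0..T} v" and v_pos: "\<And>s. s \<in> {0..T} \<Longrightarrow> v s > 0"
begin

definition speed :: "real \<Rightarrow> real" where
  "speed h = (1 + L * h) * ((1 + L * h) / (1 - L * h) + 6)"

lemma speed_bounds:
  assumes "0 \<le> L * h" "L * h \<le> 1 / 4"
  shows "7 \<le> speed h" "speed h \<le> 10"
proof -
  have "sigma L h 4 = speed h" by (simp add: sigma_def speed_def)
  then show "7 \<le> speed h" "speed h \<le> 10" using sigma_bounds[OF assms(2,1), of 4] by simp_all
qed

lemma speed_half:
  assumes "0 \<le> L * h" "L * h \<le> 1 / 4"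
  shows "speed (h / 2) \<le> speed h"
proof -
  have "(1 + L * h / 2) / (1 - L * h / 2) \<le> (1 + L * h) / (1 - L * h)"
    using assms by (intro frac_le) auto
  then show ?thesis unfolding speed_def using assms by (intro mult_mono) auto
qed

text \<open>The factor \<open>\<rho> / 4\<close> of \<open>sigma\<close> is cancelled against 4 and
  one power of \<rho>, which is possible because \<open>dR \<ge> 1\<close>.\<close>

definition cost_term :: "real \<Rightarrow> real \<Rightarrow> real \<Rightarrow> real \<Rightarrow> real" where
  "cost_term w h \<rho> \<rho>' = w * h ^ dF * speed h / (\<rho> ^ (dR - 1) * min \<rho> \<rho>' ^ (dF + 1))"

lemma cost_eq:
  assumes \<delta>: "\<delta> \<in> aleph_n T L P n"
  shows "cost L dR dF v \<delta> = (\<Sum>k<n. cost_term (v (tt \<delta> k)) (hh \<delta> (Suc k)) (rr \<delta> k) (rr \<delta> (Suc k)))"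
proof -
  have pow: "\<rho> ^ dR = \<rho> * \<rho> ^ (dR - 1)" for \<rho> :: real using dR by (cases dR) auto
  show ?thesis
    unfolding cost_def aleph_nD(1)[OF \<delta>]
  proof (rule sum.cong[OF refl])
    fix k assume "k \<in> {..<n}"
    then have "rr \<delta> k > 0" using aleph_nD(7)[OF \<delta>] by simp
    then show "4 * v (tt \<delta> k) * hh \<delta> (Suc k) ^ dF / (rr \<delta> k ^ dR * min (rr \<delta> k) (rr \<delta> (Suc k)) ^ (dF + 1))
        * sigma L (hh \<delta> (Suc k)) (rr \<delta> k) = cost_term (v (tt \<delta> k)) (hh \<delta> (Suc k)) (rr \<delta> k) (rr \<delta> (Suc k))"
      unfolding pow cost_term_def sigma_def speed_def by simp
  qed
qed

lemma cost_term_pos: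
  assumes "0 < w" "0 < L * h" "L * h \<le> 1 / 4" "0 < \<rho>" "0 < \<rho>'"
  shows "0 < cost_term w h \<rho> \<rho>'"
proof -
  have "h > 0" using assms(2) L_pos by (simp add: zero_less_mult_iff)
  then show ?thesis
    unfolding cost_term_def using assms speed_bounds(1)[of h]
    by (intro divide_pos_pos mult_pos_pos zero_less_power) auto
qed

lemma cost_pos:
  assumes \<delta>: "\<delta> \<in> aleph_n T L P n" and n: "1 \<le> n"
  shows "0 < cost L dR dF v \<delta>"
  unfolding cost_eq[OF \<delta>]
proof (rule sum_pos)
  fix k assume "k \<in> {..<n}"
  then show "0 < cost_term (v (tt \<delta> k)) (hh \<delta> (Suc k)) (rr \<delta> k) (rr \<delta> (Suc k))"
    using step_facts[OF \<delta>, of "Suc k"] tt_range[OF \<delta>, of k] v_pos aleph_nD(7)[OF \<delta>]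
    by (intro cost_term_pos) auto
qed (use n in \<open>auto simp: lessThan_empty_iff\<close>)

definition cost_rise :: "real \<Rightarrow> real \<Rightarrow> real \<Rightarrow> real \<Rightarrow> real" where
  "cost_rise w h \<rho> \<rho>' = cost_term w h (\<rho> / 4) \<rho>' - cost_term w h \<rho> \<rho>'"

text \<open>Each summand is moved to the right end of its step, with a zero at index 0, so that
  \<open>sum_subdivide\<close> applies.\<close>

lemma cost_eq_shifted:
  assumes \<delta>: "\<delta> \<in> aleph_n T L P n"
  shows "cost L dR dF v \<delta> =
    (\<Sum>i=0..n. if i = 0 then 0 else cost_term (v (tt \<delta> (i - 1))) (hh \<delta> i) (rr \<delta> (i - 1)) (rr \<delta> i))"
    (is "_ = (\<Sum>i=0..n. ?f i)")
proof -
  have "(\<Sum>i=0..n. ?f i) = ?f 0 + (\<Sum>i=1..n. ?f i)" by (simp add: sum.atLeast_Suc_atMost)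
  also have "(\<Sum>i=1..n. ?f i) = (\<Sum>k<n. ?f (Suc k))"
    by (rule sum.reindex_bij_witness[of _ Suc "\<lambda>k. k - 1"]) auto
  finally show ?thesis by (simp add: cost_eq[OF \<delta>])
qed

lemma cost_diff_0:
  assumes \<delta>: "\<delta> \<in> aleph_n T L P n" and n: "1 \<le> n"
  shows "cost L dR dF v (subdivide \<delta> 0) - cost L dR dF v \<delta> = cost_rise (v 0) (hh \<delta> 1) (rr \<delta> 0) (rr \<delta> 1)"
proof -
  have \<delta>': "subdivide \<delta> 0 \<in> aleph_n T L P n" using subdivide_aleph_n[OF \<delta>, of 0] L_pos P_pos by simp
  have split: "(\<Sum>k<n. f k) = f 0 + (\<Sum>k=1..<n. f k)" for f :: "nat \<Rightarrow> real"
    using n by (simp add: lessThan_atLeast0 sum.atLeast_Suc_lessThan)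
  have "(\<Sum>k=1..<n. cost_term (v (tt (subdivide \<delta> 0) k)) (hh (subdivide \<delta> 0) (Suc k)) (rr (subdivide \<delta> 0) k)
      (rr (subdivide \<delta> 0) (Suc k))) = (\<Sum>k=1..<n. cost_term (v (tt \<delta> k)) (hh \<delta> (Suc k)) (rr \<delta> k) (rr \<delta> (Suc k)))"
    using rr_subdivide_0[OF \<delta>] hh_subdivide_0[OF \<delta>] tt_subdivide_0[OF \<delta>] by (intro sum.cong) auto
  then show ?thesis
    unfolding cost_eq[OF \<delta>] cost_eq[OF \<delta>'] split cost_rise_def
    using n rr_subdivide_0[OF \<delta>] hh_subdivide_0[OF \<delta>] tt_subdivide_0[OF \<delta>] aleph_nD(9)[OF \<delta>] by simp
qed

lemma cost_diff:
  assumes \<delta>: "\<delta> \<in> aleph_n T L P n" and j: "1 \<le> j" "j \<le> n"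
  shows "cost L dR dF v (subdivide \<delta> j) - cost L dR dF v \<delta> =
    cost_term (v (tt \<delta> (j - 1))) (hh \<delta> j / 2) (rr \<delta> (j - 1)) (rr \<delta> j / 4)
    + cost_term (v (tt \<delta> j - hh \<delta> j / 2)) (hh \<delta> j / 2) (rr \<delta> j / 4) (rr \<delta> j / 4)
    - cost_term (v (tt \<delta> (j - 1))) (hh \<delta> j) (rr \<delta> (j - 1)) (rr \<delta> j)
    + (if j < n then cost_rise (v (tt \<delta> j)) (hh \<delta> (Suc j)) (rr \<delta> j) (rr \<delta> (Suc j)) else 0)"
proof -
  have \<delta>': "subdivide \<delta> j \<in> aleph_n T L P (Suc n)"
    using subdivide_aleph_n[OF \<delta> j(2)] j L_pos P_pos by simp
  define F where "F \<delta> i = (if i = 0 then 0 else cost_term (v (tt \<delta> (i - 1))) (hh \<delta> i) (rr \<delta> (i - 1)) (rr \<delta> i))"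
    for \<delta> i
  let ?f = "F \<delta>" and ?g = "F (subdivide \<delta> j)"
  note H = hh_subdivide[OF \<delta> j] and R = rr_subdivide[OF \<delta> j] and S = tt_subdivide[OF \<delta> j]
  have "cost L dR dF v (subdivide \<delta> j) - cost L dR dF v \<delta> = (\<Sum>k=0..Suc n. ?g k) - (\<Sum>k=0..n. ?f k)"
    unfolding cost_eq_shifted[OF \<delta>] cost_eq_shifted[OF \<delta>'] F_def ..
  also have "\<dots> = ?g j + ?g (Suc j) - ?f j + (if j < n then ?g (Suc (Suc j)) - ?f (Suc j) else 0)"
  proof (rule sum_subdivide[OF j])
    fix i assume "i < j"
    then show "?g i = ?f i"
      using R[of "i - 1"] R[of i] H[of i] S[of "i - 1"] j by (cases i) (auto simp: F_def)
  next
    fix i assume "Suc j < i" "i \<le> n"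
    then show "?g (Suc i) = ?f i"
      using R[of "Suc i"] R[of i] H[of "Suc i"] S[of i] by (simp add: F_def)
  qed
  also have "?g j = cost_term (v (tt \<delta> (j - 1))) (hh \<delta> j / 2) (rr \<delta> (j - 1)) (rr \<delta> j / 4)"
    unfolding F_def subdivide_values[OF \<delta> j] using j by simp
  also have "?g (Suc j) = cost_term (v (tt \<delta> j - hh \<delta> j / 2)) (hh \<delta> j / 2) (rr \<delta> j / 4) (rr \<delta> j / 4)"
    unfolding F_def diff_Suc_1 subdivide_values[OF \<delta> j] by simp
  also have "?f j = cost_term (v (tt \<delta> (j - 1))) (hh \<delta> j) (rr \<delta> (j - 1)) (rr \<delta> j)"
    using j by (simp add: F_def)
  also have "(if j < n then ?g (Suc (Suc j)) - ?f (Suc j) else 0) =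
      (if j < n then cost_rise (v (tt \<delta> j)) (hh \<delta> (Suc j)) (rr \<delta> j) (rr \<delta> (Suc j)) else 0)"
    by (intro if_cong refl) (simp only: F_def diff_Suc_1 cost_rise_def subdivide_values[OF \<delta> j] nat.simps if_False)
  finally show ?thesis .
qed

lemma weight_bounds:
  obtains a b where "0 < a" "0 < b" "\<And>s. s \<in> {0..T} \<Longrightarrow> a \<le> v s" "\<And>s. s \<in> {0..T} \<Longrightarrow> v s \<le> b"
proof -
  have ne: "compact {0..T}" "{0..T} \<noteq> {}" using T_pos by auto
  obtain s0 where s0: "s0 \<in> {0..T}" "\<And>s. s \<in> {0..T} \<Longrightarrow> v s0 \<le> v s"
    using continuous_attains_inf[OF ne v_cont] by blast
  obtain s1 where s1: "s1 \<in> {0..T}" "\<And>s. s \<in> {0..T} \<Longrightarrow> v s \<le> v s1"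
    using continuous_attains_sup[OF ne v_cont] by blast
  show ?thesis using that[of "v s0" "v s1"] s0 s1 v_pos by blast
qed

lemma cost_term_antimono:
  assumes "0 < w" "0 < L * h" "L * h \<le> 1 / 4" "0 < \<rho>1" "\<rho>1 \<le> \<rho>2" "0 < \<rho>'"
  shows "cost_term w h \<rho>2 \<rho>' \<le> cost_term w h \<rho>1 \<rho>'"
proof -
  have "h > 0" using assms(2) L_pos by (simp add: zero_less_mult_iff)
  then have "0 \<le> w * h ^ dF * speed h" using assms speed_bounds(1)[of h] by auto
  then show ?thesis
    unfolding cost_term_def using assms
    by (intro divide_left_mono mult_mono power_mono mult_pos_pos zero_less_power) auto
qed

lemma cost_rise_nonneg:
  assumes "0 < w" "0 < L * h" "L * h \<le> 1 / 4" "0 < \<rho>" "0 < \<rho>'"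
  shows "0 \<le> cost_rise w h \<rho> \<rho>'"
  using cost_term_antimono[of w h "\<rho> / 4" \<rho> \<rho>'] assms by (simp add: cost_rise_def)

text \<open>Regular picks are expensive, and all other picks do not lower the smallest mesh size.\<close>

definition regular :: "discretization \<Rightarrow> nat \<Rightarrow> bool" where
  "regular \<delta> j \<longleftrightarrow> (if j = 0 then rr \<delta> 0 \<le> rr \<delta> 1 else rr \<delta> j \<le> rr \<delta> (j - 1))"

text \<open>For meshes of order \<open>e\<^sup>2\<close> and a step of order \<open>e\<close>, the
  cost scales like \<open>e ^ dF / (e\<^sup>2) ^ (dR + dF) = 1 / e ^ (dF + 2 * dR)\<close>.\<close>

lemma cost_term_lower:
  assumes "0 < a" "a \<le> w" "0 < L * h" "L * h \<le> 1 / 4" "0 < e" "e / 2 \<le> h" "0 < k"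
  shows "a * 7 / (2 ^ dF * k ^ (dR + dF)) \<le> cost_term w h (k * e\<^sup>2) (k * e\<^sup>2) * e ^ (dF + 2 * dR)"
proof -
  define q where "q = k * e\<^sup>2"
  have q: "0 < q" using assms by (simp add: q_def)
  have "Suc (dR - 1) = dR" using dR by simp
  then have "q ^ (dR - 1) * q ^ (dF + 1) = q ^ (dR + dF)" by (metis add_Suc_shift power_add Suc_eq_plus1)
  then have ct: "cost_term w h q q = w * h ^ dF * speed h / q ^ (dR + dF)" by (simp add: cost_term_def)
  have "a * (e / 2) ^ dF * 7 \<le> w * h ^ dF * speed h"
    using assms speed_bounds(1)[of h] by (intro mult_mono power_mono) auto
  then have "a * (e / 2) ^ dF * 7 / q ^ (dR + dF) * e ^ (dF + 2 * dR) \<le> cost_term w h q q * e ^ (dF + 2 * dR)"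
    unfolding ct using q assms by (intro mult_right_mono divide_right_mono) auto
  moreover have "a * (e / 2) ^ dF * 7 / q ^ (dR + dF) * e ^ (dF + 2 * dR) = a * 7 / (2 ^ dF * k ^ (dR + dF))"
  proof -
    have "q ^ (dR + dF) = k ^ (dR + dF) * (e ^ dF * e ^ (dF + 2 * dR))"
      by (simp add: q_def power_mult_distrib flip: power_mult power_add) (simp add: algebra_simps)
    then show ?thesis using assms by (simp add: power_divide)
  qed
  ultimately show ?thesis by (simp add: q_def)
qed

text \<open>For \<open>j \<ge> 1\<close>, regularity makes \<open>rr \<delta> j\<close> the relevant
  minimum; quartering it outweighs halving the step, so the first half step alone costs as much as
  the old step, and the second half step is pure increase. For \<open>j = 0\<close>, quartering at
  least doubles the cost of the first step.\<close>

lemma cost_diff_lower: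
  obtains c where "0 < c" "\<And>n \<delta> j. \<delta> \<in> aleph_n T L P n \<Longrightarrow> 1 \<le> n \<Longrightarrow> j \<le> n \<Longrightarrow> regular \<delta> j \<Longrightarrow>
    c \<le> (cost L dR dF v (subdivide \<delta> j) - cost L dR dF v \<delta>) * eff_step \<delta> j ^ (dF + 2 * dR)"
proof -
  obtain a where a: "0 < a" "\<And>s. s \<in> {0..T} \<Longrightarrow> a \<le> v s" using weight_bounds by metis
  \<comment> \<open>\<open>k2 * e\<^sup>2\<close> is a mesh before the subdivision, used for
    \<open>j = 0\<close>, and \<open>k1 * e\<^sup>2\<close> is a quartered one, used for the second
    half step.\<close>
  define k1 k2 where "k1 = L * P / 2" and "k2 = 2 * L * P"
  have k: "0 < k1" "0 < k2" using L_pos P_pos by (auto simp: k1_def k2_def)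
  define c1 c2 where "c1 = a * 7 / (2 ^ dF * k1 ^ (dR + dF))" and "c2 = a * 7 / (2 ^ dF * k2 ^ (dR + dF))"
  have c: "0 < c1" "0 < c2" using a(1) k by (auto simp: c1_def c2_def)
  have "min c1 c2 \<le> (cost L dR dF v (subdivide \<delta> j) - cost L dR dF v \<delta>) * eff_step \<delta> j ^ (dF + 2 * dR)"
    if \<delta>: "\<delta> \<in> aleph_n T L P n" and n: "1 \<le> n" and j: "j \<le> n" and reg: "regular \<delta> j" for n \<delta> j
  proof (cases "j = 0")
    case True
    define e where "e = eff_step \<delta> 0"
    have e: "0 < e" "rr \<delta> 0 = k2 * e\<^sup>2" using eff_step[OF \<delta>, of 0] by (auto simp: e_def k2_def)
    have r: "rr \<delta> 0 \<le> rr \<delta> 1" "0 < rr \<delta> 0" using reg True aleph_nD(7)[OF \<delta>] by (auto simp: regular_def)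
    note S = step_facts[OF \<delta> _ n]
    have "e \<le> eff_step \<delta> 1" unfolding e_def eff_step_def using r L_pos P_pos by (simp add: divide_right_mono)
    then have eh: "e / 2 \<le> hh \<delta> 1" using e eff_step_hh[OF \<delta> _ n] by simp
    let ?old = "cost_term (v 0) (hh \<delta> 1) (rr \<delta> 0) (rr \<delta> 1)"
    have old_eq: "?old = cost_term (v 0) (hh \<delta> 1) (k2 * e\<^sup>2) (k2 * e\<^sup>2)"
      using r e(2) by (simp add: cost_term_def min_def)
    have "c2 \<le> ?old * e ^ (dF + 2 * dR)"
      unfolding old_eq c2_def using a(1) a(2)[of 0] T_pos S e(1) eh k(2) by (intro cost_term_lower) auto
    moreover have "2 * ?old \<le> cost_term (v 0) (hh \<delta> 1) (rr \<delta> 0 / 4) (rr \<delta> 1)"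
    proof -
      let ?w = "v 0 * hh \<delta> 1 ^ dF * speed (hh \<delta> 1)"
      have w: "0 \<le> ?w" using S v_pos[of 0] T_pos speed_bounds(1)[of "hh \<delta> 1"] by auto
      have "cost_term (v 0) (hh \<delta> 1) (rr \<delta> 0 / 4) (rr \<delta> 1) = ?w / ((rr \<delta> 0 / 4) ^ (dR - 1) * (rr \<delta> 0 / 4) ^ (dF + 1))"
        using r by (simp add: cost_term_def min_def)
      also have "\<dots> = 4 ^ (dR - 1) * 4 ^ (dF + 1) * (?w / (rr \<delta> 0 ^ (dR - 1) * rr \<delta> 0 ^ (dF + 1)))"
        by (simp add: power_divide)
      also have "\<dots> = 4 ^ (dR - 1) * 4 ^ (dF + 1) * ?old"
        using r by (simp add: cost_term_def min_def)
      finally have eq: "cost_term (v 0) (hh \<delta> 1) (rr \<delta> 0 / 4) (rr \<delta> 1) = 4 ^ (dR - 1) * 4 ^ (dF + 1) * ?old" .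
      have "1 \<le> (4 :: real) ^ (dR - 1)" "1 \<le> (4 :: real) ^ dF" by (intro one_le_power; simp)+
      moreover from this have "2 \<le> (4 :: real) ^ (dF + 1)" unfolding power_add power_one_right by linarith
      ultimately have "1 * 2 \<le> (4 :: real) ^ (dR - 1) * 4 ^ (dF + 1)" by (intro mult_mono) simp_all
      moreover have "0 \<le> ?old" using w r by (simp add: cost_term_def)
      ultimately show ?thesis unfolding eq using mult_right_mono by fastforce
    qed
    then have "?old \<le> cost L dR dF v (subdivide \<delta> 0) - cost L dR dF v \<delta>"
      unfolding cost_diff_0[OF \<delta> n] cost_rise_def by simp
    then have "?old * e ^ (dF + 2 * dR) \<le> (cost L dR dF v (subdivide \<delta> 0) - cost L dR dF v \<delta>) * e ^ (dF + 2 * dR)"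
      using e(1) by (intro mult_right_mono) auto
    ultimately show ?thesis by (simp add: True e_def)
  next
    case False
    then have j1: "1 \<le> j" by simp
    define e where "e = hh \<delta> j"
    note S = step_facts[OF \<delta> j1 j]
    have e: "0 < e" "rr \<delta> j / 4 = k1 * e\<^sup>2"
      using S aleph_nD(13)[OF \<delta> j1 j] by (auto simp: e_def k1_def)
    have r: "rr \<delta> j \<le> rr \<delta> (j - 1)" "0 < rr \<delta> j" using reg False aleph_nD(7)[OF \<delta> j] by (auto simp: regular_def)
    have t: "tt \<delta> (j - 1) \<in> {0..T}" "tt \<delta> j = tt \<delta> (j - 1) + e" "tt \<delta> j \<in> {0..T}"
      using tt_range[OF \<delta>, of "j - 1"] tt_range[OF \<delta> j] aleph_nD(11)[OF \<delta>, of "j - 1"] j j1 by (auto simp: e_def)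
    then have mid: "tt \<delta> j - e / 2 \<in> {0..T}" using e by auto
    have "c1 \<le> cost_term (v (tt \<delta> j - e / 2)) (e / 2) (rr \<delta> j / 4) (rr \<delta> j / 4) * e ^ (dF + 2 * dR)"
      unfolding e(2) c1_def using a(1) a(2)[OF mid] S e(1) k(1) by (intro cost_term_lower) (auto simp: e_def)
    moreover have "cost_term (v (tt \<delta> (j - 1))) e (rr \<delta> (j - 1)) (rr \<delta> j) \<le>
        cost_term (v (tt \<delta> (j - 1))) (e / 2) (rr \<delta> (j - 1)) (rr \<delta> j / 4)"
    proof -
      let ?v = "v (tt \<delta> (j - 1))" and ?\<rho> = "rr \<delta> (j - 1)"
      have v: "0 < ?v" using v_pos t(1) by blast
      have sp: "7 \<le> speed (e / 2)" "speed e \<le> 10"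
        using speed_bounds(1)[of "e / 2"] speed_bounds(2)[of e] S by (auto simp: e_def)
      have "?v * e ^ dF * speed e \<le> ?v * e ^ dF * (2 * speed (e / 2))"
        using v e sp by (intro mult_left_mono) auto
      also have "\<dots> \<le> (2 ^ dF * 4) * (?v * (e / 2) ^ dF * speed (e / 2))"
        using v e sp by (simp add: power_divide)
      also have "\<dots> \<le> 4 ^ (dF + 1) * (?v * (e / 2) ^ dF * speed (e / 2))"
        using v e sp power_mono[of 2 "4 :: real" dF] by (intro mult_right_mono) auto
      finally have "?v * e ^ dF * speed e / (?\<rho> ^ (dR - 1) * rr \<delta> j ^ (dF + 1)) \<le>
          4 ^ (dF + 1) * (?v * (e / 2) ^ dF * speed (e / 2)) / (?\<rho> ^ (dR - 1) * rr \<delta> j ^ (dF + 1))"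
        using r by (intro divide_right_mono) auto
      moreover have min: "min ?\<rho> (rr \<delta> j) = rr \<delta> j" "min ?\<rho> (rr \<delta> j / 4) = rr \<delta> j / 4" using r by auto
      ultimately show ?thesis unfolding cost_term_def min by (simp add: power_divide mult_ac)
    qed
    moreover have "0 \<le> (if j < n then cost_rise (v (tt \<delta> j)) (hh \<delta> (Suc j)) (rr \<delta> j) (rr \<delta> (Suc j)) else 0)"
      using step_facts[OF \<delta>, of "Suc j"] v_pos[OF t(3)] r aleph_nD(7)[OF \<delta>, of "Suc j"]
      by (auto intro!: cost_rise_nonneg)
    ultimately have "cost_term (v (tt \<delta> j - e / 2)) (e / 2) (rr \<delta> j / 4) (rr \<delta> j / 4) \<le>
        cost L dR dF v (subdivide \<delta> j) - cost L dR dF v \<delta>"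
      unfolding cost_diff[OF \<delta> j1 j] e_def[symmetric] by simp
    then have "cost_term (v (tt \<delta> j - e / 2)) (e / 2) (rr \<delta> j / 4) (rr \<delta> j / 4) * e ^ (dF + 2 * dR) \<le>
        (cost L dR dF v (subdivide \<delta> j) - cost L dR dF v \<delta>) * e ^ (dF + 2 * dR)"
      using e(1) by (intro mult_right_mono) auto
    with \<open>c1 \<le> _\<close> show ?thesis by (simp add: eff_step_hh[OF \<delta> j1 j] e_def)
  qed
  then show ?thesis using that[of "min c1 c2"] c by simp
qed

lemma cost_term_upper:
  assumes "0 < w" "w \<le> b" "0 < L * h" "L * h \<le> 1 / 4" "0 < q" "q \<le> \<rho>" "0 < m" "m \<le> min \<rho> \<rho>'"
  shows "cost_term w h \<rho> \<rho>' \<le> b * h ^ dF * 10 / (q ^ (dR - 1) * m ^ (dF + 1))"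
proof -
  have "h > 0" using assms(3) L_pos by (simp add: zero_less_mult_iff)
  then show ?thesis
    unfolding cost_term_def using assms speed_bounds[of h]
    by (intro frac_le mult_mono power_mono mult_pos_pos zero_less_power) auto
qed

text \<open>For a fixed size \<open>e\<close> of the cell, only finer neighbours could make the cost
  unbounded. A finer left mesh determines the denominators both before and after, and the shorter
  step is not dearer. A finer right mesh \<open>2 * L * P * h\<^sup>2\<close> yields the power
  \<open>1 / h ^ (dF + 2)\<close>.\<close>

lemma cost_diff_upper:
  assumes "0 < e"
  obtains K where "0 < K" "\<And>n \<delta> p. \<delta> \<in> aleph_n T L P n \<Longrightarrow> 1 \<le> n \<Longrightarrow> p \<le> n \<Longrightarrow> eff_step \<delta> p = e \<Longrightarrow>
    cost L dR dF v (subdivide \<delta> p) - cost L dR dF v \<delta>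
      \<le> K * (1 + (if p < n then 1 / hh \<delta> (Suc p) ^ (dF + 2) else 0))"
proof -
  obtain b where b: "0 < b" "\<And>s. s \<in> {0..T} \<Longrightarrow> v s \<le> b" using weight_bounds by metis
  define q B where "q = 2 * L * P * e\<^sup>2 / 4" and "B = 1 / (4 * L)"
  have q: "0 < q" and B: "0 < B" using assms L_pos P_pos by (auto simp: q_def B_def)
  define K1 K3 where "K1 = b * B ^ dF * 10 / (q ^ (dR - 1) * q ^ (dF + 1))"
    and "K3 = b * 10 / (q ^ (dR - 1) * (2 * L * P) ^ (dF + 1))"
  have K: "0 < K1" "0 < K3" using b q B L_pos P_pos by (auto simp: K1_def K3_def)
  have le_K1: "cost_term w h \<rho> \<rho>' \<le> K1"
    if w: "0 < w" "w \<le> b" and h: "0 < L * h" "L * h \<le> 1 / 4" and \<rho>: "q \<le> \<rho>" "q \<le> \<rho>'" for w h \<rho> \<rho>'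
  proof -
    have "0 < h" "h \<le> B" using h L_pos by (auto simp: B_def zero_less_mult_iff field_simps)
    then have "b * h ^ dF * 10 / (q ^ (dR - 1) * q ^ (dF + 1)) \<le> K1"
      unfolding K1_def using b q by (intro divide_right_mono mult_mono power_mono) auto
    then show ?thesis using cost_term_upper[OF w h q \<rho>(1) q, of \<rho>'] \<rho> by simp
  qed
  have "cost L dR dF v (subdivide \<delta> p) - cost L dR dF v \<delta>
      \<le> (3 * K1 + K3) * (1 + (if p < n then 1 / hh \<delta> (Suc p) ^ (dF + 2) else 0))"
    if \<delta>: "\<delta> \<in> aleph_n T L P n" and n: "1 \<le> n" and p: "p \<le> n" and e: "eff_step \<delta> p = e" for n \<delta> p
  proof -
    have r: "rr \<delta> p / 4 = q" "0 < rr \<delta> p" using eff_step(2)[OF \<delta> p] aleph_nD(7)[OF \<delta> p] e by (auto simp: q_def)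
    have tp: "tt \<delta> p \<in> {0..T}" using tt_range[OF \<delta> p] by simp
    define R where "R = (if p < n then cost_rise (v (tt \<delta> p)) (hh \<delta> (Suc p)) (rr \<delta> p) (rr \<delta> (Suc p)) else 0)"
    define Z where "Z = (if p < n then 1 / hh \<delta> (Suc p) ^ (dF + 2) else 0)"
    have Z: "0 \<le> Z" unfolding Z_def using less_imp_le[OF step_facts(3)[OF \<delta>, of "Suc p"]] by auto
    have R: "R \<le> K1 + K3 * Z"
    proof (cases "p < n")
      case True
      define h where "h = hh \<delta> (Suc p)"
      define w where "w = v (tt \<delta> p)"
      note S = step_facts[OF \<delta>, of "Suc p"]
      have h: "0 < h" "0 < L * h" "L * h \<le> 1 / 4" using S True by (auto simp: h_def)
      have w: "0 < w" "w \<le> b" using v_pos[OF tp] b(2)[OF tp] by (auto simp: w_def)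
      have r': "rr \<delta> (Suc p) = 2 * L * P * h\<^sup>2" "0 < rr \<delta> (Suc p)"
        using aleph_nD(13)[OF \<delta>, of "Suc p"] aleph_nD(7)[OF \<delta>, of "Suc p"] True by (auto simp: h_def)
      have "R \<le> cost_term w h q (rr \<delta> (Suc p))"
        using cost_term_pos[OF w(1) h(2,3) r(2) r'(2)] True r(1)
        by (simp add: R_def cost_rise_def w_def h_def)
      also have "\<dots> \<le> K1 + K3 * Z"
      proof (cases "q \<le> rr \<delta> (Suc p)")
        case True
        have "0 \<le> K3 * Z" using K Z by simp
        then show ?thesis using le_K1[OF w h(2,3) order_refl True] by linarith
      next
        case False
        have "(h\<^sup>2) ^ (dF + 1) = h ^ (dF + 2) * h ^ dF"
          by (simp add: power2_eq_square power_mult_distrib power_add mult_ac)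
        then have "rr \<delta> (Suc p) ^ (dF + 1) = (2 * L * P) ^ (dF + 1) * (h ^ (dF + 2) * h ^ dF)"
          unfolding r'(1) by (simp only: power_mult_distrib[of "2 * L * P" "h\<^sup>2"])
        then have "b * h ^ dF * 10 / (q ^ (dR - 1) * rr \<delta> (Suc p) ^ (dF + 1)) = K3 * (1 / h ^ (dF + 2))"
          unfolding K3_def using h(1) by simp
        then have "cost_term w h q (rr \<delta> (Suc p)) \<le> K3 * Z"
          using cost_term_upper[OF w h(2,3) q order_refl r'(2), of "rr \<delta> (Suc p)"] False \<open>p < n\<close>
          by (simp add: Z_def h_def)
        then show ?thesis using K by simp
      qed
      finally show ?thesis .
    next
      case False
      then show ?thesis using K Z by (simp add: R_def)
    qed
    have "cost L dR dF v (subdivide \<delta> p) - cost L dR dF v \<delta> \<le> 2 * K1 + R"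
    proof (cases "p = 0")
      case True
      then have "cost L dR dF v (subdivide \<delta> p) - cost L dR dF v \<delta> = R"
        using cost_diff_0[OF \<delta> n] n aleph_nD(9)[OF \<delta>] by (simp add: R_def)
      then show ?thesis using K by simp
    next
      case False
      then have p1: "1 \<le> p" by simp
      define h where "h = hh \<delta> p"
      note S = step_facts[OF \<delta> p1 p]
      have h: "0 < h" "0 < L * h" "L * h \<le> 1 / 4" using S by (auto simp: h_def)
      have h2: "0 < L * (h / 2)" "L * (h / 2) \<le> 1 / 4" using h by auto
      have t: "tt \<delta> (p - 1) \<in> {0..T}" "tt \<delta> p = tt \<delta> (p - 1) + h"
        using tt_range[OF \<delta>, of "p - 1"] aleph_nD(11)[OF \<delta>, of "p - 1"] p p1 by (auto simp: h_def)
      then have mid: "tt \<delta> p - h / 2 \<in> {0..T}" using h tp by auto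
      have \<rho>: "0 < rr \<delta> (p - 1)" using aleph_nD(7)[OF \<delta>, of "p - 1"] p by simp
      have "cost_term (v (tt \<delta> p - h / 2)) (h / 2) q q \<le> K1"
        using le_K1[OF v_pos[OF mid] b(2)[OF mid] h2] by simp
      moreover have "cost_term (v (tt \<delta> (p - 1))) (h / 2) (rr \<delta> (p - 1)) q
          - cost_term (v (tt \<delta> (p - 1))) h (rr \<delta> (p - 1)) (rr \<delta> p) \<le> K1"
      proof (cases "q \<le> rr \<delta> (p - 1)")
        case True
        then show ?thesis
          using le_K1[OF v_pos[OF t(1)] b(2)[OF t(1)] h2 True order_refl]
            cost_term_pos[OF v_pos[OF t(1)] h(2,3) \<rho> r(2)] by simp
      next
        case False
        then have "min (rr \<delta> (p - 1)) q = rr \<delta> (p - 1)" "min (rr \<delta> (p - 1)) (rr \<delta> p) = rr \<delta> (p - 1)"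
          using r q by auto
        moreover have "v (tt \<delta> (p - 1)) * (h / 2) ^ dF * speed (h / 2) \<le> v (tt \<delta> (p - 1)) * h ^ dF * speed h"
          using h v_pos[OF t(1)] speed_half[of h] speed_bounds(1)[of "h / 2"]
          by (intro mult_mono power_mono) auto
        ultimately have "cost_term (v (tt \<delta> (p - 1))) (h / 2) (rr \<delta> (p - 1)) q
            \<le> cost_term (v (tt \<delta> (p - 1))) h (rr \<delta> (p - 1)) (rr \<delta> p)"
          unfolding cost_term_def using \<rho> by (auto intro!: divide_right_mono)
        then show ?thesis using K by simp
      qed
      ultimately show ?thesis
        unfolding cost_diff[OF \<delta> p1 p] h_def[symmetric] R_def[symmetric] r(1) by simp
    qed
    also have "\<dots> \<le> 3 * K1 + K3 * Z" using R by simp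
    also have "\<dots> \<le> (3 * K1 + K3) * (1 + Z)" using K Z by (simp add: algebra_simps)
    finally show ?thesis unfolding Z_def .
  qed
  moreover have "0 < 3 * K1 + K3" using K by simp
  ultimately show ?thesis using that by blast
qed

end

section \<open>Termination of the refinement\<close>

context rates
begin

text \<open>The summand is chosen such that two halves of a cell never weigh more than the cell, and
  weigh at least 1 less if its size is at least \<open>s\<close>. Its initial value thus bounds the
  number of picks of size at least \<open>s\<close>.\<close>

definition size_potential :: "real \<Rightarrow> discretization \<Rightarrow> real" where
  "size_potential s \<delta> = (\<Sum>i=0..nsteps \<delta>. max 0 (2 * eff_step \<delta> i / s - 1))"

lemma size_potential_subdivide:
  assumes \<delta>: "\<delta> \<in> aleph_n T L P n" and j: "j \<le> n" and s: "s > 0"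
  shows "size_potential s (subdivide \<delta> j) \<le> size_potential s \<delta> - (if s \<le> eff_step \<delta> j then 1 else 0)"
proof -
  define \<phi> where "\<phi> h = max 0 (2 * h / s - 1)" for h :: real
  have \<phi>: "\<phi> (h / 2) + \<phi> (h / 2) \<le> \<phi> h - (if s \<le> h then 1 else 0)" if "h > 0" for h
    using s that by (auto simp: \<phi>_def max_def field_simps)
  have \<phi>_nonneg: "0 \<le> \<phi> h" for h by (simp add: \<phi>_def)
  let ?f = "\<lambda>i. \<phi> (eff_step \<delta> i)" and ?g = "\<lambda>i. \<phi> (eff_step (subdivide \<delta> j) i)"
  show ?thesis
  proof (cases "j = 0")
    case True
    have "(\<Sum>i=1..n. ?g i) = (\<Sum>i=1..n. ?f i)"
      using eff_step_subdivide_0[OF \<delta>] True by (intro sum.cong) auto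
    then have "(\<Sum>i=0..n. ?g i) = ?g 0 + (\<Sum>i=1..n. ?f i)" by (simp add: sum.atLeast_Suc_atMost)
    moreover have "(\<Sum>i=0..n. ?f i) = ?f 0 + (\<Sum>i=1..n. ?f i)" by (simp add: sum.atLeast_Suc_atMost)
    moreover have "?g 0 \<le> ?f 0 - (if s \<le> eff_step \<delta> 0 then 1 else 0)"
    proof -
      have half: "eff_step (subdivide \<delta> j) 0 = eff_step \<delta> 0 / 2"
        using eff_step_subdivide_0[OF \<delta>, of 0] True by simp
      show ?thesis
        unfolding half using \<phi>[of "eff_step \<delta> 0"] \<phi>_nonneg[of "eff_step \<delta> 0 / 2"] eff_step(1)[OF \<delta>, of 0]
        by linarith
    qed
    ultimately show ?thesis
      using nsteps_subdivide[OF \<delta> j] aleph_nD(1)[OF \<delta>] True by (simp add: size_potential_def flip: \<phi>_def)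
  next
    case False
    then have j1: "1 \<le> j" by simp
    note E = eff_step_subdivide[OF \<delta> j1 j]
    have "(\<Sum>i=0..Suc n. ?g i) - (\<Sum>i=0..n. ?f i) =
      ?g j + ?g (Suc j) - ?f j + (if j < n then ?g (Suc (Suc j)) - ?f (Suc j) else 0)"
      by (rule sum_subdivide[OF j1 j]) (use E j in auto)
    also have "\<dots> \<le> - (if s \<le> eff_step \<delta> j then 1 else 0)"
    proof -
      have half: "eff_step (subdivide \<delta> j) j = eff_step \<delta> j / 2"
        "eff_step (subdivide \<delta> j) (Suc j) = eff_step \<delta> j / 2"
        using E[of j] E[of "Suc j"] j by simp_all
      have "(if j < n then ?g (Suc (Suc j)) - ?f (Suc j) else 0) = 0" using E[of "Suc (Suc j)"] by simp
      then show ?thesis unfolding half using \<phi>[OF eff_step(1)[OF \<delta> j]] by linarith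
    qed
    finally show ?thesis
      using nsteps_subdivide[OF \<delta> j] aleph_nD(1)[OF \<delta>] False by (simp add: size_potential_def flip: \<phi>_def)
  qed
qed

end

lemma refine_choice_le:
  assumes "refine_choice C E \<delta> k"
  shows "k \<le> nsteps \<delta>"
  using assms by (auto simp: refine_choice_def Let_def is_arg_min_def split: if_splits)

text \<open>In the other branch \<open>k\<close> would minimize the cost increment, so a positive
  increment at \<open>k\<close> would make the minimum positive and contradict that branch.\<close>

lemma refine_choice_ratio:
  assumes ch: "refine_choice C E \<delta> k" and pos: "0 < C (subdivide \<delta> k) - C \<delta>" and p: "p \<le> nsteps \<delta>"
  shows "0 < C (subdivide \<delta> p) - C \<delta>"
    "(E (subdivide \<delta> k) - E \<delta>) / (C (subdivide \<delta> k) - C \<delta>) \<le> (E (subdivide \<delta> p) - E \<delta>) / (C (subdivide \<delta> p) - C \<delta>)"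
proof -
  let ?J = "{0..nsteps \<delta>}" and ?dC = "\<lambda>j. C (subdivide \<delta> j) - C \<delta>" and ?dE = "\<lambda>j. E (subdivide \<delta> j) - E \<delta>"
  have fin: "finite (?dC ` ?J)" "?dC ` ?J \<noteq> {}" by auto
  have min_pos: "Min (?dC ` ?J) > 0"
  proof (rule ccontr)
    assume not: "\<not> Min (?dC ` ?J) > 0"
    then have "is_arg_min ?dC (\<lambda>j. j \<in> ?J) k"
      using ch unfolding refine_choice_def Let_def by (simp only: if_False)
    then have "\<forall>j\<in>?J. ?dC k \<le> ?dC j" by (auto simp: is_arg_min_linorder)
    then have "0 < Min (?dC ` ?J)" using Min_in[OF fin] pos by fastforce
    then show False using not by simp
  qed
  then show "0 < C (subdivide \<delta> p) - C \<delta>" using fin p by auto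
  have "is_arg_min (\<lambda>j. ?dE j / ?dC j) (\<lambda>j. j \<in> ?J) k"
    using ch min_pos unfolding refine_choice_def Let_def by (simp only: if_True)
  then show "?dE k / ?dC k \<le> ?dE p / ?dC p" using p by (simp add: is_arg_min_linorder)
qed

lemma refine_choice_exists: "\<exists>k. refine_choice C E \<delta> k"
proof -
  let ?J = "{0..nsteps \<delta>}" and ?dC = "\<lambda>j. C (subdivide \<delta> j) - C \<delta>" and ?dE = "\<lambda>j. E (subdivide \<delta> j) - E \<delta>"
  have ex: "\<exists>k. is_arg_min f (\<lambda>j. j \<in> ?J) k" for f :: "nat \<Rightarrow> real"
    using ex_is_arg_min_if_finite[of ?J f] by auto
  show ?thesis
    unfolding refine_choice_def Let_def
    using ex[of ?dC] ex[of "\<lambda>j. ?dE j / ?dC j"] by (cases "Min (?dC ` ?J) > 0") (simp_all only: if_True if_False)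
qed

text \<open>An infinite sequence of admissible choices without stopping test; it turns out that the
  error still becomes arbitrarily small.\<close>

locale refinement_run = weighted_rates +
  fixes D :: "nat \<Rightarrow> discretization" and \<kappa> :: "nat \<Rightarrow> nat"
  assumes D0: "D 0 \<in> aleph T L P"
    and choice: "refine_choice (cost L dR dF v) (err T L P) (D m) (\<kappa> m)"
    and step: "D (Suc m) = subdivide (D m) (\<kappa> m)"
begin

abbreviation N :: "nat \<Rightarrow> nat" where "N m \<equiv> nsteps (D m)"
abbreviation pick :: "nat \<Rightarrow> real" where "pick m \<equiv> eff_step (D m) (\<kappa> m)"

lemma \<kappa>_le: "\<kappa> m \<le> N m"
  using choice by (rule refine_choice_le)

lemma D_aleph: "D m \<in> aleph_n T L P (N m) \<and> 1 \<le> N m"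
proof (induction m)
  case 0 then show ?case using alephE[OF D0] by blast
next
  case (Suc m)
  then have "subdivide (D m) (\<kappa> m) \<in> aleph_n T L P (if \<kappa> m = 0 then N m else Suc (N m))"
    using subdivide_aleph_n[OF _ \<kappa>_le] L_pos P_pos by blast
  then show ?case using Suc aleph_nD(1) step by (auto split: if_splits)
qed

lemmas D_aleph_n = D_aleph[THEN conjunct1] and N_pos = D_aleph[THEN conjunct2]

lemma N_Suc: "N (Suc m) = (if \<kappa> m = 0 then N m else Suc (N m))"
  unfolding step using nsteps_subdivide[OF D_aleph_n \<kappa>_le] .

lemma pick_pos: "0 < pick m"
  using eff_step(1)[OF D_aleph_n \<kappa>_le] .

lemma pick_vanishes:
  assumes "s > 0"
  shows "\<exists>M. \<forall>m\<ge>M. pick m < s"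
proof -
  let ?S = "{m. s \<le> pick m}"
  have count: "real (card {i \<in> ?S. i < m}) + size_potential s (D m) \<le> size_potential s (D 0)" for m
  proof (induction m)
    case (Suc m)
    have "{i \<in> ?S. i < Suc m} = {i \<in> ?S. i < m} \<union> (if m \<in> ?S then {m} else {})" by (auto simp: less_Suc_eq)
    then have "real (card {i \<in> ?S. i < Suc m}) \<le> real (card {i \<in> ?S. i < m}) + (if s \<le> pick m then 1 else 0)"
      by auto
    moreover have "size_potential s (D (Suc m)) \<le> size_potential s (D m) - (if s \<le> pick m then 1 else 0)"
      unfolding step by (rule size_potential_subdivide[OF D_aleph_n \<kappa>_le assms])
    ultimately show ?case using Suc by linarith
  qed simp
  have "finite ?S"
  proof (rule ccontr)
    assume "infinite ?S"
    then obtain B where B: "finite B" "card B = Suc (nat \<lceil>size_potential s (D 0)\<rceil>)" "B \<subseteq> ?S"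
      using infinite_arbitrarily_large by blast
    obtain m where m: "\<forall>i\<in>B. i < m" using B(1) finite_nat_set_iff_bounded by blast
    have "card B \<le> card {i \<in> ?S. i < m}" using B m by (intro card_mono) auto
    moreover have "0 \<le> size_potential s (D m)" unfolding size_potential_def by (intro sum_nonneg) auto
    ultimately have "real (card B) \<le> size_potential s (D 0)" using count[of m] by linarith
    then show False unfolding B(2) by linarith
  qed
  then obtain M where "\<forall>i\<in>?S. i < M" using finite_nat_set_iff_bounded by blast
  then have "\<forall>m\<ge>M. pick m < s" by (metis mem_Collect_eq not_le)
  then show ?thesis ..
qed

text \<open>An irregular pick has a neighbour of strictly smaller mesh, hence of at most a quarter
  of its mesh. If all picks from some point on were irregular, the smallest mesh at that point would
  bound all later ones from below, although the picked sizes tend to zero.\<close>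

lemma regular_infinitely_often: "\<exists>m\<ge>M. regular (D m) (\<kappa> m)"
proof (rule ccontr)
  assume "\<not> ?thesis"
  then have irr: "\<not> regular (D m) (\<kappa> m)" if "m \<ge> M" for m using that by blast
  define \<nu> where "\<nu> = Min (rr (D M) ` {0..N M})"
  have "\<nu> \<in> rr (D M) ` {0..N M}" unfolding \<nu>_def by (intro Min_in) auto
  then have \<nu>: "0 < \<nu>" using aleph_nD(7)[OF D_aleph_n] by auto
  have inv: "\<forall>i\<le>N m. \<nu> \<le> rr (D m) i" if "M \<le> m" for m
    using that
  proof (induction m rule: dec_induct)
    case base then show ?case by (auto simp: \<nu>_def)
  next
    case (step m)
    note D = D_aleph_n[of m]
    have k: "\<kappa> m \<le> N m" by (rule \<kappa>_le)
    have "\<nu> \<le> rr (D m) (\<kappa> m) / 4"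
    proof (cases "\<kappa> m = 0")
      case True
      then have "rr (D m) 1 < rr (D m) 0" using irr[OF step.hyps(1)] by (simp add: regular_def)
      then have "rr (D m) 1 \<le> rr (D m) 0 / 4" using rr_less_imp_quarter[OF D, of 0 1] N_pos[of m] by simp
      then show ?thesis using step.IH N_pos[of m] True by fastforce
    next
      case False
      then have "rr (D m) (\<kappa> m - 1) < rr (D m) (\<kappa> m)" using irr[OF step.hyps(1)] by (simp add: regular_def)
      then have "rr (D m) (\<kappa> m - 1) \<le> rr (D m) (\<kappa> m) / 4"
        using rr_less_imp_quarter[OF D k, of "\<kappa> m - 1"] k by simp
      moreover have "\<nu> \<le> rr (D m) (\<kappa> m - 1)" using step.IH k by simp
      ultimately show ?thesis by simp
    qed
    then show ?case
      using step.IH rr_subdivide_0[OF D] rr_subdivide[OF D, of "\<kappa> m"] k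
      unfolding refinement_run.step[OF refinement_run_axioms] N_Suc[unfolded refinement_run.step[OF refinement_run_axioms]]
      by (cases "\<kappa> m = 0") auto
  qed
  define s where "s = sqrt (\<nu> / (2 * L * P))"
  have "0 < s" using \<nu> L_pos P_pos by (simp add: s_def)
  then obtain M' where M': "\<forall>m\<ge>M'. pick m < s" using pick_vanishes by blast
  have "s \<le> pick (max M M')"
    unfolding s_def eff_step_def using inv[of "max M M'"] \<kappa>_le L_pos P_pos by (simp add: divide_right_mono)
  then show False using M' by (meson max.cobounded2 not_le)
qed

end

section \<open>A cell that is never picked\<close>

locale persistent_cell = refinement_run +
  fixes p0 :: nat
  assumes p0: "p0 \<le> N 0" and unpicked: "pick m < eff_step (D 0) p0"
begin

text \<open>The current index of the persistent cell: a subdivision to its left shifts it by one,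
  except at index 0, where no entry is inserted.\<close>

primrec p :: "nat \<Rightarrow> nat" where
  "p 0 = p0"
| "p (Suc m) = (if 0 < \<kappa> m \<and> \<kappa> m < p m then Suc (p m) else p m)"

lemma p_invariant: "p m \<le> N m \<and> eff_step (D m) (p m) = eff_step (D 0) p0"
proof (induction m)
  case 0 then show ?case using p0 by simp
next
  case (Suc m)
  note E = eff_step_subdivide[OF D_aleph_n, of "\<kappa> m" m] eff_step_subdivide_0[OF D_aleph_n, of _ m]
  have "\<kappa> m \<noteq> p m" using Suc unpicked[of m] by auto
  then consider "\<kappa> m = 0" "p m \<noteq> 0" | "0 < \<kappa> m" "\<kappa> m < p m" | "p m < \<kappa> m" by linarith
  then show ?case
    using Suc \<kappa>_le[of m] N_Suc[of m] E(1)[of "p m"] E(1)[of "Suc (p m)"] E(2)[of "p m"] unfolding step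
    by cases auto
qed

lemmas p_le = p_invariant[THEN conjunct1] and eff_step_p = p_invariant[THEN conjunct2]

lemma \<kappa>_neq_p: "\<kappa> m \<noteq> p m"
  using eff_step_p[of m] unpicked[of m] by auto

lemma right_neighbour_Suc:
  assumes "\<kappa> m \<noteq> Suc (p m)"
  shows "p (Suc m) < N (Suc m) \<longleftrightarrow> p m < N m"
    "p m < N m \<Longrightarrow> eff_step (D (Suc m)) (Suc (p (Suc m))) = eff_step (D m) (Suc (p m))"
proof -
  note E = eff_step_subdivide[OF D_aleph_n, of "\<kappa> m" m] eff_step_subdivide_0[OF D_aleph_n, of _ m]
  consider "\<kappa> m = 0" "p m \<noteq> 0" | "0 < \<kappa> m" "\<kappa> m < p m" | "Suc (p m) < \<kappa> m"
    using \<kappa>_neq_p[of m] assms by linarith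
  note cases = this
  show "p (Suc m) < N (Suc m) \<longleftrightarrow> p m < N m"
    using cases \<kappa>_le[of m] N_Suc[of m] by cases auto
  show "eff_step (D (Suc m)) (Suc (p (Suc m))) = eff_step (D m) (Suc (p m))" if "p m < N m"
    using cases that \<kappa>_le[of m] E(1)[of "Suc (p m)"] E(1)[of "Suc (Suc (p m))"] E(2)[of "Suc (p m)"] unfolding step
    by cases auto
qed

definition right_cost :: "nat \<Rightarrow> real" where
  "right_cost m = (if p m < N m then 1 / eff_step (D m) (Suc (p m)) ^ (dF + 2) else 0)"

lemma right_cost_nonneg: "0 \<le> right_cost m"
  unfolding right_cost_def using less_imp_le[OF eff_step(1)[OF D_aleph_n, of "Suc (p m)" m]] by auto

text \<open>A regular pick has a positive cost increment, so the ratio rule is in force and the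
  persistent cell is a competitor. Its error decrease is bounded below by \<open>c1\<close>, since
  its size is fixed. Cross-multiplying the ratios and inserting the bounds for the pick gives the
  claim.\<close>

lemma regular_pick_bound:
  obtains c where "0 < c"
    "\<And>m. regular (D m) (\<kappa> m) \<Longrightarrow> c \<le> pick m ^ (dF + 2 * dR + 1) * (1 + right_cost m)"
proof -
  let ?a = "eff_step (D 0) p0"
  have a: "0 < ?a" using eff_step(1)[OF D_aleph_n p0] .
  obtain c0 where c0: "0 < c0" "\<And>n \<delta> j. \<delta> \<in> aleph_n T L P n \<Longrightarrow> 1 \<le> n \<Longrightarrow> j \<le> n \<Longrightarrow> regular \<delta> j \<Longrightarrow>
    c0 \<le> (cost L dR dF v (subdivide \<delta> j) - cost L dR dF v \<delta>) * eff_step \<delta> j ^ (dF + 2 * dR)"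
    using cost_diff_lower by blast
  obtain K where K: "0 < K" "\<And>n \<delta> p. \<delta> \<in> aleph_n T L P n \<Longrightarrow> 1 \<le> n \<Longrightarrow> p \<le> n \<Longrightarrow> eff_step \<delta> p = ?a \<Longrightarrow>
    cost L dR dF v (subdivide \<delta> p) - cost L dR dF v \<delta>
      \<le> K * (1 + (if p < n then 1 / hh \<delta> (Suc p) ^ (dF + 2) else 0))"
    using cost_diff_upper[OF a] by blast
  define c1 C where "c1 = P * L\<^sup>2 / 4 * ?a ^ 3" and "C = 2 * exp (L * T) * P"
  have c1: "0 < c1" and C: "0 < C" using a L_pos P_pos by (auto simp: c1_def C_def)
  have "c1 * c0 / (C * K) \<le> pick m ^ (dF + 2 * dR + 1) * (1 + right_cost m)" if reg: "regular (D m) (\<kappa> m)" for m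
  proof -
    define dC dE where "dC j = cost L dR dF v (subdivide (D m) j) - cost L dR dF v (D m)"
      and "dE j = err T L P (subdivide (D m) j) - err T L P (D m)" for j
    note D = D_aleph_n[of m] N_pos[of m]
    have q: "0 < pick m ^ (dF + 2 * dR)" using pick_pos by simp
    have low: "c0 \<le> dC (\<kappa> m) * pick m ^ (dF + 2 * dR)" unfolding dC_def by (rule c0(2)[OF D \<kappa>_le reg])
    then have dC: "0 < dC (\<kappa> m)" using c0(1) q by (smt (verit) zero_less_mult_pos2)
    have dCp: "0 < dC (p m)" and ratio: "dE (\<kappa> m) / dC (\<kappa> m) \<le> dE (p m) / dC (p m)"
      using refine_choice_ratio[OF choice _ p_le, of m] dC unfolding dC_def dE_def by auto
    have "dC (p m) \<le> K * (1 + (if p m < N m then 1 / hh (D m) (Suc (p m)) ^ (dF + 2) else 0))"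
      unfolding dC_def by (rule K(2)[OF D p_le eff_step_p])
    also have "(if p m < N m then 1 / hh (D m) (Suc (p m)) ^ (dF + 2) else 0) = right_cost m"
      using eff_step_hh[OF D(1), of "Suc (p m)"] by (simp add: right_cost_def)
    finally have up: "dC (p m) \<le> K * (1 + right_cost m)" .
    have dEp: "c1 \<le> - dE (p m)"
      using err_diff_upper[OF D p_le] unfolding dE_def eff_step_p c1_def by simp
    have dEk: "- dE (\<kappa> m) \<le> C * pick m"
      using err_diff_lower[OF D \<kappa>_le] unfolding dE_def C_def by simp
    have "c1 * dC (\<kappa> m) \<le> - dE (p m) * dC (\<kappa> m)" using dEp dC by (intro mult_right_mono) auto
    also have "\<dots> \<le> - dE (\<kappa> m) * dC (p m)" using ratio dC dCp by (simp add: field_simps)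
    also have "\<dots> \<le> C * pick m * dC (p m)" using dEk dCp by (intro mult_right_mono) auto
    also have "\<dots> \<le> C * pick m * (K * (1 + right_cost m))"
      using up C pick_pos[of m] by (intro mult_left_mono) auto
    finally have "c1 * dC (\<kappa> m) * pick m ^ (dF + 2 * dR) \<le>
        C * pick m * (K * (1 + right_cost m)) * pick m ^ (dF + 2 * dR)"
      using q by (intro mult_right_mono) auto
    moreover have "c1 * c0 \<le> c1 * (dC (\<kappa> m) * pick m ^ (dF + 2 * dR))" using low c1 by (intro mult_left_mono) auto
    ultimately have "c1 * c0 \<le> C * K * (pick m ^ (dF + 2 * dR + 1) * (1 + right_cost m))"
      by (simp add: mult_ac)
    then show ?thesis using C K(1) by (simp add: pos_divide_le_eq mult_ac)
  qed
  then show ?thesis using that[of "c1 * c0 / (C * K)"] c1 c0(1) C K(1) by simp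
qed

lemma contradiction: False
proof -
  obtain c where c: "0 < c" "\<And>m. regular (D m) (\<kappa> m) \<Longrightarrow> c \<le> pick m ^ (dF + 2 * dR + 1) * (1 + right_cost m)"
    using regular_pick_bound by blast
  have small_power: "pick m ^ k \<le> pick m" if "pick m < 1" "1 \<le> k" for m k
    using power_decreasing[OF that(2), of "pick m"] that(1) pick_pos[of m] by simp
  show False
  proof (cases "\<forall>M. \<exists>m\<ge>M. \<kappa> m = Suc (p m)")
    case True
    let ?t = "min 1 (c / 2)"
    obtain M where M: "\<forall>m\<ge>M. pick m < ?t" using pick_vanishes[of ?t] c(1) by auto
    obtain m where m: "m \<ge> M" "\<kappa> m = Suc (p m)" using True by blast
    have t: "pick m < 1" "pick m < c / 2" using M m(1) by auto
    \<comment> \<open>The left neighbour of the pick is the persistent cell, which is larger than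
      every pick; hence the pick is regular.\<close>
    have "rr (D m) (\<kappa> m) \<le> rr (D m) (p m)"
    proof -
      have "(pick m)\<^sup>2 \<le> (eff_step (D m) (p m))\<^sup>2"
        using unpicked[of m] eff_step_p[of m] pick_pos[of m] by (intro power_mono) auto
      then show ?thesis
        unfolding eff_step(2)[OF D_aleph_n \<kappa>_le] eff_step(2)[OF D_aleph_n p_le]
        using L_pos P_pos by (intro mult_left_mono) auto
    qed
    then have "regular (D m) (\<kappa> m)" using m(2) by (simp add: regular_def)
    then have "c \<le> pick m ^ (dF + 2 * dR + 1) * (1 + right_cost m)" by (rule c(2))
    also have "\<dots> = pick m ^ (dF + 2 * dR + 1) + pick m ^ (dF + 2 * dR + 1) / pick m ^ (dF + 2)"
      using m(2) \<kappa>_le[of m] by (simp add: right_cost_def distrib_left)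
    \<comment> \<open>By \<open>dR \<ge> 1\<close> the subtraction is not truncated, and a positive
      power of the pick remains after division by \<open>pick m ^ (dF + 2)\<close>.\<close>
    also have "dF + 2 * dR + 1 = (2 * dR - 1) + (dF + 2)" using dR by simp
    also have "pick m ^ \<dots> / pick m ^ (dF + 2) = pick m ^ (2 * dR - 1)"
      unfolding power_add using pick_pos[of m] by simp
    also have "pick m ^ (2 * dR - 1 + (dF + 2)) + pick m ^ (2 * dR - 1) \<le> pick m + pick m"
      by (intro add_mono small_power[OF t(1)]) (use dR in linarith)+
    finally show False using t(2) by simp
  next
    case False
    then obtain M where M: "\<And>m. m \<ge> M \<Longrightarrow> \<kappa> m \<noteq> Suc (p m)" by blast
    have const: "right_cost m = right_cost M" if "M \<le> m" for m
      using that
    proof (induction m rule: dec_induct)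
      case (step m)
      then show ?case using right_neighbour_Suc[OF M[OF step.hyps(1)]] by (auto simp: right_cost_def)
    qed simp
    let ?t = "min 1 (c / (1 + right_cost M))"
    have pos: "0 < 1 + right_cost M" using right_cost_nonneg[of M] by simp
    obtain M' where M': "\<forall>m\<ge>M'. pick m < ?t" using pick_vanishes[of ?t] c(1) pos by auto
    obtain m where m: "m \<ge> max M M'" "regular (D m) (\<kappa> m)" using regular_infinitely_often by blast
    have t: "pick m < 1" "pick m < c / (1 + right_cost M)" using M' m(1) by auto
    have "c \<le> pick m ^ (dF + 2 * dR + 1) * (1 + right_cost M)" using c(2)[OF m(2)] const[of m] m(1) by simp
    also have "\<dots> \<le> pick m * (1 + right_cost M)" by (intro mult_right_mono small_power[OF t(1)]) (use pos in linarith)+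
    also have "\<dots> < c" using t(2) pos by (simp add: pos_less_divide_eq)
    finally show False by simp
  qed
qed

end

context refinement_run
begin

lemma err_reaches:
  assumes "\<epsilon> > 0"
  shows "\<exists>m. err T L P (D m) \<le> \<epsilon>"
proof (rule ccontr)
  assume "\<not> ?thesis"
  then have big: "err T L P (D m) > \<epsilon>" for m by (simp add: not_le)
  define C where "C = exp (L * T) * L * P * (4 + 6 * T)"
  have C: "0 < C" using L_pos P_pos T_pos by (simp add: C_def)
  define s where "s = min 1 (\<epsilon> / C)"
  have s: "0 < s" "s \<le> 1" "s \<le> \<epsilon> / C" using assms C by (auto simp: s_def)
  then have Cs: "C * s \<le> \<epsilon>" using C by (simp add: pos_le_divide_eq mult.commute)
  obtain M where M: "\<forall>m\<ge>M. pick m < s" using pick_vanishes[OF s(1)] by blast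
  have "\<not> (\<forall>k\<le>N M. eff_step (D M) k \<le> s)"
    using err_le_mesh[OF D_aleph_n N_pos s(1,2), of M] Cs big[of M] unfolding C_def by fastforce
  then obtain p0 where p0: "p0 \<le> N M" "s < eff_step (D M) p0" by (auto simp: not_le)
  \<comment> \<open>Starting at \<open>M\<close>, all picks are smaller than \<open>s\<close>, hence
    smaller than the cell \<open>p0\<close>, which therefore is never picked.\<close>
  interpret shifted: persistent_cell T L P dR dF v "\<lambda>m. D (M + m)" "\<lambda>m. \<kappa> (M + m)" p0
  proof
    show "D (M + 0) \<in> aleph T L P" using D_aleph[of M] by (auto simp: aleph_def)
    show "pick (M + m) < eff_step (D (M + 0)) p0" for m
      using M[rule_format, of "M + m"] p0(2) by simp
  qed (use choice step p0 in auto)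
  show False by (rule shifted.contradiction)
qed

end

section \<open>The algorithm\<close>

locale ibta = tracking_data T L P X0 F
  for T L P :: real and X0 :: "(real^'n) set" and F :: "real^'n \<Rightarrow> (real^'n) set" +
  fixes dR dF lmax :: nat and \<epsilon> :: "nat \<Rightarrow> real"
  assumes dR: "dR \<ge> 1" and lmax: "lmax \<ge> 1"
    and \<epsilon>_decreasing: "\<And>i j. 1 \<le> i \<Longrightarrow> i < j \<Longrightarrow> j \<le> lmax \<Longrightarrow> \<epsilon> i > \<epsilon> j" and \<epsilon>_last: "\<epsilon> lmax > 0"
begin

sublocale rates T L P
  by unfold_locales (rule T_pos L_pos P_pos)+

abbreviation step :: "(real^'n) ibta_state \<Rightarrow> (real^'n) ibta_state \<Rightarrow> bool" where
  "step \<equiv> ibta_step T L P X0 F dR dF lmax \<epsilon>"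

lemma \<epsilon>_pos: "1 \<le> l \<Longrightarrow> l \<le> lmax \<Longrightarrow> \<epsilon> l > 0"
  using \<epsilon>_decreasing[of l lmax] \<epsilon>_last by (cases "l = lmax") auto

text \<open>\<open>n \<ge> 4 * L * T\<close> amounts to \<open>T / n \<le> 1 / (4 * L)\<close>, and
  then the mesh \<open>2 * L * P * (T / n)\<^sup>2\<close> is at most
  \<open>P / (8 * L)\<close>.\<close>

lemma initial_disc_aleph: "initial_disc T L P \<in> aleph T L P"
proof -
  define n where "n = nat \<lceil>4 * L * T\<rceil>"
  have LT: "0 < 4 * L * T" using L_pos T_pos by simp
  then have n: "1 \<le> n" "4 * L * T \<le> real n" by (auto simp: n_def le_nat_iff Suc_le_eq)
  let ?\<delta> = "initial_disc T L P"
  have fields: "step_sizes ?\<delta> = replicate n (T / real n)"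
    "nodes ?\<delta> = map (\<lambda>k. real k * T / real n) [0..<Suc n]"
    "meshes ?\<delta> = replicate (Suc n) (2 * L * P * T\<^sup>2 / (real n)\<^sup>2)"
    unfolding initial_disc_def Let_def n_def by simp_all
  have hh: "hh ?\<delta> j = T / real n" if "1 \<le> j" "j \<le> n" for j using that by (simp add: hh_def fields)
  have rr: "rr ?\<delta> k = 2 * L * P * (T / real n)\<^sup>2" if "k \<le> n" for k
    using that unfolding rr_def fields by (simp add: nth_replicate power_divide del: replicate.simps)
  have tt: "tt ?\<delta> k = real k * T / real n" if "k \<le> n" for k
    using that unfolding tt_def fields by (subst nth_map) (auto simp del: upt_Suc)
  have "0 < real n" using n(1) by simp
  then have h: "0 < T / real n" "T / real n \<le> 1 / (4 * L)"
    using n(2) T_pos L_pos by (simp_all add: field_simps)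
  have "?\<delta> \<in> aleph_n T L P n"
  proof (rule aleph_nI[where c = "2 * L * P * (T / real n)\<^sup>2"])
    fix k assume k: "k \<le> n"
    have "(T / real n)\<^sup>2 \<le> (1 / (4 * L))\<^sup>2" using h by (intro power_mono) auto
    then have "2 * L * P * (T / real n)\<^sup>2 \<le> 2 * L * P * (1 / (4 * L))\<^sup>2"
      using L_pos P_pos by (intro mult_left_mono) auto
    also have "\<dots> = P / (8 * L)" using L_pos by (simp add: power2_eq_square field_simps)
    finally show "0 < rr ?\<delta> k \<and> rr ?\<delta> k \<le> P / (8 * L) \<and> (\<exists>l::int. rr ?\<delta> k = 2 * L * P * (T / real n)\<^sup>2 * 4 powi l)"
      unfolding rr[OF k] using zero_less_power[OF h(1), of 2] L_pos P_pos
      by (auto intro: exI[of _ "0 :: int"])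
  next
    show "tt ?\<delta> (Suc k) = tt ?\<delta> k + hh ?\<delta> (Suc k)" if "k < n" for k
    proof -
      have k: "k \<le> n" "Suc k \<le> n" "1 \<le> Suc k" using that by simp_all
      show ?thesis unfolding tt[OF k(1)] tt[OF k(2)] hh[OF k(3,2)] by (simp add: distrib_right add_divide_distrib)
    qed
  qed (use n h zero_less_power[OF h(1), of 2] L_pos P_pos hh rr tt in \<open>auto simp: fields simp del: upt_Suc\<close>)
  then show ?thesis using n(1) by (auto simp: aleph_def)
qed

definition positive_weight :: "(real \<Rightarrow> real) \<Rightarrow> bool" where
  "positive_weight v \<longleftrightarrow> continuous_on {0..T} v \<and> (\<forall>s\<in>{0..T}. v s > 0)"

lemma weighted_rates: "positive_weight v \<Longrightarrow> weighted_rates T L P dR v"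
  using dR by unfold_locales (auto simp: positive_weight_def)

lemma interpolated_weight:
  assumes "\<delta> \<in> aleph T L P"
  shows "positive_weight (\<lambda>s. pl_interp \<delta> (vhat_R L F dR \<delta> (initial_pair X0 \<delta>)) s *
    pl_interp \<delta> (vhat_F L F dF \<delta> (initial_pair X0 \<delta>)) s)"
proof -
  obtain n where n: "1 \<le> n" "\<delta> \<in> aleph_n T L P n" using assms alephE by metis
  show ?thesis
    unfolding positive_weight_def
    using pl_interp_continuous_pos[OF n(2,1) vhat_pos(1)[OF n(2,1)]]
      pl_interp_continuous_pos[OF n(2,1) vhat_pos(2)[OF n(2,1)]]
    by (auto intro!: continuous_on_mult mult_pos_pos)
qed

lemma cost_err_pos:
  assumes "positive_weight v" "\<delta> \<in> aleph T L P"
  shows "cost L dR dF v \<delta> > 0" "err T L P \<delta> > 0"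
proof -
  interpret weighted_rates T L P dR dF v using weighted_rates[OF assms(1)] .
  obtain n where n: "1 \<le> n" "\<delta> \<in> aleph_n T L P n" using assms(2) alephE by metis
  show "cost L dR dF v \<delta> > 0" "err T L P \<delta> > 0" using cost_pos[OF n(2,1)] err_pos[OF n(2)] by auto
qed

text \<open>No error bound is claimed for index 0, where tracking precedes any refinement. The bound
  for the returned discretization relies on \<open>lmax \<ge> 1\<close>.\<close>

fun invariant :: "(real^'n) ibta_state \<Rightarrow> bool" where
  "invariant (Tracking l \<delta>) \<longleftrightarrow> l \<le> lmax \<and> \<delta> \<in> aleph T L P \<and> (1 \<le> l \<longrightarrow> err T L P \<delta> \<le> \<epsilon> l)"
| "invariant (Refining l v \<delta>) \<longleftrightarrow> l < lmax \<and> \<delta> \<in> aleph T L P \<and> positive_weight v"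
| "invariant (Returned n \<delta> Ds) \<longleftrightarrow> \<delta> \<in> aleph T L P \<and> n = nsteps \<delta> \<and> err T L P \<delta> \<le> \<epsilon> lmax \<and>
     Ds = map (track_pair L F \<delta> (initial_pair X0 \<delta>)) [0..<Suc n]"

lemma subdivide_aleph:
  assumes "\<delta> \<in> aleph T L P" "k \<le> nsteps \<delta>"
  shows "subdivide \<delta> k \<in> aleph T L P"
proof -
  have n: "1 \<le> nsteps \<delta>" "\<delta> \<in> aleph_n T L P (nsteps \<delta>)" using assms(1) by (auto elim: alephE)
  show ?thesis
    using subdivide_aleph_n[OF n(2) assms(2) L_pos P_pos] n(1) unfolding aleph_def by (auto split: if_splits)
qed

lemma invariant_step:
  assumes "step s s'" "invariant s"
  shows "invariant s'"
  using assms
proof cases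
  case (refine \<delta> l v k)
  then show ?thesis using assms(2) subdivide_aleph refine_choice_le by auto
qed (use assms(2) lmax in \<open>auto simp: positive_weight_def\<close>)

lemma invariant_steps: "step\<^sup>*\<^sup>* s s' \<Longrightarrow> invariant s \<Longrightarrow> invariant s'"
  by (induction rule: rtranclp_induct) (auto intro: invariant_step)

lemma invariant_init: "invariant (Tracking 0 (initial_disc T L P))"
  by (simp add: initial_disc_aleph)

text \<open>All preconditions of the transitions hold along the invariant and a minimizer always
  exists, so the machine cannot get stuck before returning.\<close>

lemma progress:
  assumes "invariant s" "\<nexists>s'. step s s'"
  shows "\<exists>n \<delta> Ds. s = Returned n \<delta> Ds"
proof (cases s)
  case (Tracking l \<delta>)
  then have \<delta>: "\<delta> \<in> aleph T L P" "l \<le> lmax" using assms(1) by auto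
  note ok = tracking_ok_initial_pair[OF \<delta>(1)]
  show ?thesis
  proof (cases "l = lmax")
    case True
    have "step (Tracking lmax \<delta>) (Returned (nsteps \<delta>) \<delta>
        (map (track_pair L F \<delta> (initial_pair X0 \<delta>)) [0..<Suc (nsteps \<delta>)]))"
      by (rule return_result[OF refl ok])
    then show ?thesis using assms(2) Tracking True by blast
  next
    case False
    define v where "v = (\<lambda>s. pl_interp \<delta> (vhat_R L F dR \<delta> (initial_pair X0 \<delta>)) s *
      pl_interp \<delta> (vhat_F L F dF \<delta> (initial_pair X0 \<delta>)) s)"
    have v: "positive_weight v" unfolding v_def by (rule interpolated_weight[OF \<delta>(1)])
    have "step (Tracking l \<delta>) (Refining l v \<delta>)"
      using False \<delta>(2) v cost_err_pos[OF v]
      by (intro start_refinement[OF _ refl ok refl refl v_def]) (auto simp: positive_weight_def)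
    then show ?thesis using assms(2) Tracking by blast
  qed
next
  case (Refining l v \<delta>)
  have "\<exists>s'. step s s'"
  proof (cases "err T L P \<delta> > \<epsilon> (Suc l)")
    case True
    obtain k where "refine_choice (cost L dR dF v) (err T L P) \<delta> k" using refine_choice_exists by blast
    then have "step (Refining l v \<delta>) (Refining l v (subdivide \<delta> k))" using True by (intro ibta_step.refine)
    then show ?thesis unfolding Refining by blast
  next
    case False
    then have "step (Refining l v \<delta>) (Tracking (Suc l) \<delta>)" by (rule ibta_step.end_refinement)
    then show ?thesis unfolding Refining by blast
  qed
  then show ?thesis using assms(2) by blast
qed auto

text \<open>Staying in the inner loop forever would be a \<open>refinement_run\<close> whose error
  remains above \<open>\<epsilon> (Suc l)\<close>, against \<open>err_reaches\<close>.\<close>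

lemma leaves_refinement:
  assumes run: "\<And>i. step (run i) (run (Suc i))" and start: "run 0 = Refining l v \<delta>" "invariant (run 0)"
  shows "\<exists>i \<delta>'. run i = Tracking (Suc l) \<delta>'"
proof (rule ccontr)
  assume not: "\<not> ?thesis"
  have "\<exists>\<delta>'. run i = Refining l v \<delta>'" for i
  proof (induction i)
    case (Suc i)
    then obtain \<delta>' where "run i = Refining l v \<delta>'" by blast
    then show ?case using run[of i] not by (auto elim: ibta_step.cases)
  qed (use start in blast)
  then obtain D where D: "\<And>i. run i = Refining l v (D i)" by metis
  have "\<exists>k. err T L P (D i) > \<epsilon> (Suc l) \<and> refine_choice (cost L dR dF v) (err T L P) (D i) k \<and>
      D (Suc i) = subdivide (D i) k" for i
    using run[of i] unfolding D by (auto elim: ibta_step.cases)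
  then obtain \<kappa> where \<kappa>: "\<And>i. err T L P (D i) > \<epsilon> (Suc l)"
    "\<And>i. refine_choice (cost L dR dF v) (err T L P) (D i) (\<kappa> i)" "\<And>i. D (Suc i) = subdivide (D i) (\<kappa> i)"
    by metis
  have "l < lmax" "D 0 \<in> aleph T L P" "positive_weight v" using start(2) by (auto simp: D)
  then interpret refinement_run T L P dR dF v D \<kappa>
    by (intro refinement_run.intro weighted_rates refinement_run_axioms.intro \<kappa>)
  obtain m where "err T L P (D m) \<le> \<epsilon> (Suc l)" using err_reaches \<epsilon>_pos[of "Suc l"] \<open>l < lmax\<close> by auto
  then show False using \<kappa>(1)[of m] by simp
qed

text \<open>Induction on the number of remaining outer rounds: an infinite run leaves each inner
  loop, so its tail is an infinite run with a larger index.\<close>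

lemma no_infinite_run_Tracking:
  assumes "invariant (Tracking l \<delta>)" "run 0 = Tracking l \<delta>" "\<And>i. step (run i) (run (Suc i))"
  shows False
  using assms
proof (induction "lmax - l" arbitrary: l \<delta> run rule: less_induct)
  case less
  note run = less.prems(3)
  have inv: "invariant (run i)" for i
    by (induction i) (use less.prems invariant_step in auto)
  show False
  proof (cases "l = lmax")
    case True
    then have "\<exists>n \<delta> Ds. run 1 = Returned n \<delta> Ds" using run[of 0] less.prems(2) by (auto elim: ibta_step.cases)
    then show False using run[of 1] by (auto elim: ibta_step.cases)
  next
    case False
    then have l: "l < lmax" using less.prems(1) by simp
    obtain v where v: "run (Suc 0) = Refining l v \<delta>"
      using run[of 0] less.prems(2) False by (auto elim: ibta_step.cases)
    obtain i \<delta>' where i: "run (Suc i) = Tracking (Suc l) \<delta>'"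
      using leaves_refinement[of "\<lambda>i. run (Suc i)", OF run v inv] by blast
    show False
    proof (rule less.hyps[of "Suc l" \<delta>' "\<lambda>j. run (Suc i + j)"])
      show "lmax - Suc l < lmax - l" using l by simp
      show "invariant (Tracking (Suc l) \<delta>')" using inv[of "Suc i"] i by simp
    qed (use run i in auto)
  qed
qed

lemma returned_result:
  assumes "invariant (Returned n \<delta> Ds)"
  shows "1 \<le> n \<and> \<delta> \<in> aleph_n T L P n \<and> err T L P \<delta> \<le> \<epsilon> lmax \<and> length Ds = Suc n \<and>
    (\<forall>k\<le>n. Ds ! k = tr (rr \<delta> k) (discrete_reach L X0 F \<delta> k)) \<and>
    tr (rr \<delta> 0) (discrete_reach L X0 F \<delta> 0) = tr (rr \<delta> 0) (grid_proj (rr \<delta> 0 / 2) (rr \<delta> 0) X0) \<and>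
    (\<forall>k\<in>{1..n}. tr (rr \<delta> k) (discrete_reach L X0 F \<delta> k) = Psi L F (hh \<delta> k) (rr \<delta> (k - 1)) (rr \<delta> k)
       (tr (rr \<delta> (k - 1)) (discrete_reach L X0 F \<delta> (k - 1))))"
proof -
  have n: "n = nsteps \<delta>" "1 \<le> n" "\<delta> \<in> aleph_n T L P n" using assms by (auto elim: alephE)
  have Ds: "Ds ! k = tr (rr \<delta> k) (discrete_reach L X0 F \<delta> k)" if "k \<le> n" for k
    using assms that track_pair_eq[OF n(3) that] by (simp add: nth_append del: upt_Suc)
  show ?thesis
    using assms n Ds Psi_discrete_reach[OF n(3)] by (auto simp del: upt_Suc)
qed

end

theorem theorem6p7:
  fixes T L P :: real
    and X0 :: "(real^'n) set"
    and F :: "real^'n \<Rightarrow> (real^'n) set"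
    and sdim :: "(real^'n) set \<Rightarrow> int"
    and dR dF lmax :: nat
    and \<epsilon> :: "nat \<Rightarrow> real"
    and init :: "(real^'n) ibta_state"
    and step :: "(real^'n) ibta_state \<Rightarrow> (real^'n) ibta_state \<Rightarrow> bool"
  assumes "T > 0" and "L > 0" and "P > 0"
    and "X0 \<noteq> {}" and "compact X0" and "path_connected X0"
    and "\<And>x. F x \<noteq> {} \<and> compact (F x) \<and> convex (F x)"
    and "\<And>x y. linf_hausdist (F x) (F y) \<le> ereal (L * infnorm (x - y))"
    and "\<And>x f. f \<in> F x \<Longrightarrow> infnorm f \<le> P"
    and "dimension_notion sdim"
    and "dR = dim_R sdim T X0 F" and "dF = dim_F sdim T X0 F" and "dR \<ge> 1"
    and "lmax \<ge> 1"
    and "\<And>i j. 1 \<le> i \<Longrightarrow> i < j \<Longrightarrow> j \<le> lmax \<Longrightarrow> \<epsilon> i > \<epsilon> j"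
    and "\<epsilon> lmax > 0"
    and "step = ibta_step T L P X0 F dR dF lmax \<epsilon>"
    and "init = Tracking 0 (initial_disc T L P)"
  shows "(\<nexists>run. run 0 = init \<and> (\<forall>i. step (run i) (run (Suc i)))) \<and>
    (\<forall>s. step\<^sup>*\<^sup>* init s \<and> (\<nexists>s'. step s s') \<longrightarrow>
       (\<exists>n \<delta> Ds. s = Returned n \<delta> Ds \<and>
          1 \<le> n \<and> \<delta> \<in> aleph_n T L P n \<and>
          err T L P \<delta> \<le> \<epsilon> lmax \<and>
          length Ds = Suc n \<and>
          (\<forall>k\<le>n. Ds ! k = tr (rr \<delta> k) (discrete_reach L X0 F \<delta> k)) \<and>
          tr (rr \<delta> 0) (discrete_reach L X0 F \<delta> 0)
            = tr (rr \<delta> 0) (grid_proj (rr \<delta> 0 / 2) (rr \<delta> 0) X0) \<and>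
          (\<forall>k\<in>{1..n}. tr (rr \<delta> k) (discrete_reach L X0 F \<delta> k)
             = Psi L F (hh \<delta> k) (rr \<delta> (k - 1)) (rr \<delta> k)
                 (tr (rr \<delta> (k - 1)) (discrete_reach L X0 F \<delta> (k - 1))))))"
proof -
  interpret ibta T L P X0 F dR dF lmax \<epsilon>
    using assms(1-8,13-16) by unfold_locales
  have "False" if "run 0 = init" "\<forall>i. step (run i) (run (Suc i))" for run
    using no_infinite_run_Tracking[OF invariant_init, of run] that assms(17,18) by simp
  moreover have "\<exists>n \<delta> Ds. s = Returned n \<delta> Ds \<and> invariant s"
    if "step\<^sup>*\<^sup>* init s" "\<nexists>s'. step s s'" for s
  proof -
    have "invariant s" using invariant_steps[OF _ invariant_init] that(1) assms(17,18) by simp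
    then show ?thesis using progress that(2) assms(17) by blast
  qed
  ultimately show ?thesis using returned_result by blast
qed

end
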